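(* Let $r\in\mathbb{N}_0$ and let $G=V_{h_r}f+N$, where $f\in M^1$ and $N\in L^1(\mathbb{R}^2)$ is supported in a measurable set $\Delta\subset\mathbb{R}^2$. Suppose that for some $R>0$ $$A_r(\Delta,R)<\frac{C_r(R)}{2},$$ where $A_r(\Delta,R)=\sup_{z\in\mathbb{R}^2}\int_{\Delta\cap(z+D_R)}|L_r^0(\pi|z-w|^2)|e^{-\pi|z-w|^2/2}dw$ and $C_r(R)=\int_0^{\pi R^2}\big(L_r^0(t)\big)^2e^{-t}dt$. Then $$\delta(\Delta):=\sup_{u\in M^1,\,u\neq0}\frac{\|V_{h_r}u\cdot\chi_\Delta\|_1}{\|V_{h_r}u\|_1}<\frac12 ,$$ and the minimization problem $$\beta(G)=\arg\min_{g\in M^1}\|G-V_{h_r}g\|_1$$ has a unique solution, which is $\beta(G)=f$.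
   Context: For $z=(x,\xi)\in\mathbb{R}^2$ put $\pi(z)g(t)=e^{2\pi i\xi t}g(t-x)$. The short-time Fourier transform of $f$ with window $g$ is $V_gf(z)=\langle f,\pi(z)g\rangle=\int_{\mathbb{R}}f(t)\overline{g(t-x)}e^{-2\pi i\xi t}dt$ (with $\langle\cdot,\cdot\rangle$ linear in the first and conjugate-linear in the second argument, extended by duality to tempered distributions $f$ and Schwartz windows $g$). The Hermite functions are $h_r(t)=\frac{2^{1/4}}{\sqrt{r!}}\left(\frac{-1}{2\sqrt{\pi}}\right)^{r}e^{\pi t^2}\frac{d^r}{dt^r}\left(e^{-2\pi t^2}\right)$, $r\ge0$; they form an orthonormal basis of $L^2(\mathbb{R})$. The modulation space $M^1$ is the set of tempered distributions $f$ on $\mathbb{R}$ with $V_{h_0}f\in L^1(\mathbb{R}^2)$; any other nonzero window $g$ with $\|V_gg\|_1<\infty$ (in particular $h_r$) gives the same space. $L_r^0(x)=\sum_{i=0}^r(-1)^i\binom{r}{i}\frac{x^i}{i!}$ is the Laguerre polynomial. $D_R\subset\mathbb{R}^2$ is the disc of radius $R$ centered at $0$, $\chi_\Delta$ is the indicator function, and $\|\cdot\|_1$ is the norm of $L^1(\mathbb{R}^2)$. *)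

theory Defs
  imports "HOL-Analysis.Analysis"
begin

section \<open>Schwartz functions and tempered distributions on the real line\<close>

definition nth_vderiv :: "nat \<Rightarrow> (real \<Rightarrow> complex) \<Rightarrow> real \<Rightarrow> complex" where
  "nth_vderiv n = (\<lambda>f x. vector_derivative f (at x)) ^^ n"

definition schwartz_seminorm :: "nat \<Rightarrow> nat \<Rightarrow> (real \<Rightarrow> complex) \<Rightarrow> real" where
  "schwartz_seminorm i j \<phi> = (SUP x. \<bar>x\<bar> ^ i * norm (nth_vderiv j \<phi> x))"

definition schwartz :: "(real \<Rightarrow> complex) set" where
  "schwartz = {\<phi>. (\<forall>j x. nth_vderiv j \<phi> differentiable at x) \<and>
                  (\<forall>i j. bdd_above (range (\<lambda>x. \<bar>x\<bar> ^ i * norm (nth_vderiv j \<phi> x))))}"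

text \<open>A tempered distribution is a linear functional on the Schwartz space that is continuous for
  its Frechet topology, i.e. dominated by finitely many seminorms. Such a functional is represented
  by a total function that is 0 outside the Schwartz space, so that equality of distributions
  is equality of functions and the zero distribution is \<open>\<lambda>_. 0\<close>.\<close>

definition tempered_distributions :: "((real \<Rightarrow> complex) \<Rightarrow> complex) set" where
  "tempered_distributions = {T.
     (\<forall>\<phi>. \<phi> \<notin> schwartz \<longrightarrow> T \<phi> = 0) \<and>
     (\<forall>\<phi>\<in>schwartz. \<forall>\<psi>\<in>schwartz. T (\<lambda>t. \<phi> t + \<psi> t) = T \<phi> + T \<psi>) \<and>
     (\<forall>c. \<forall>\<phi>\<in>schwartz. T (\<lambda>t. c * \<phi> t) = c * T \<phi>) \<and>
     (\<exists>C n. \<forall>\<phi>\<in>schwartz. norm (T \<phi>) \<le> C * (\<Sum>i\<le>n. \<Sum>j\<le>n. schwartz_seminorm i j \<phi>))}"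

section \<open>Short-time Fourier transform and the modulation space\<close>

text \<open>The pairing is the extension of
  \<open>\<langle>f, \<phi>\<rangle> = \<integral> f(t) cnj (\<phi>(t)) dt\<close>,
  linear in the distribution and conjugate-linear in the test function.\<close>

definition pairing :: "((real \<Rightarrow> complex) \<Rightarrow> complex) \<Rightarrow> (real \<Rightarrow> complex) \<Rightarrow> complex" where
  "pairing T \<phi> = T (\<lambda>t. cnj (\<phi> t))"

definition tf_shift :: "real \<times> real \<Rightarrow> (real \<Rightarrow> complex) \<Rightarrow> real \<Rightarrow> complex" where
  "tf_shift = (\<lambda>(x, \<xi>) g t. exp (2 * pi * \<i> * \<xi> * t) * g (t - x))"

definition stft :: "(real \<Rightarrow> complex) \<Rightarrow> ((real \<Rightarrow> complex) \<Rightarrow> complex) \<Rightarrow> real \<times> real \<Rightarrow> complex" where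
  "stft g T z = pairing T (tf_shift z g)"

definition hermite_fun :: "nat \<Rightarrow> real \<Rightarrow> complex" where
  "hermite_fun r t = complex_of_real
     (2 powr (1/4) / sqrt (fact r) * (- 1 / (2 * sqrt pi)) ^ r * exp (pi * t\<^sup>2) *
      (deriv ^^ r) (\<lambda>s. exp (- 2 * pi * s\<^sup>2)) t)"

definition M1 :: "((real \<Rightarrow> complex) \<Rightarrow> complex) set" where
  "M1 = {T \<in> tempered_distributions. integrable lebesgue (stft (hermite_fun 0) T)}"

definition L1_norm :: "(real \<times> real \<Rightarrow> complex) \<Rightarrow> ennreal" where
  "L1_norm F = (\<integral>\<^sup>+z. ennreal (norm (F z)) \<partial>lebesgue)"

section \<open>The quantities attached to the set\<close>

definition laguerre :: "nat \<Rightarrow> real \<Rightarrow> real" where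
  "laguerre r x = (\<Sum>i\<le>r. (-1) ^ i * real (r choose i) * (x ^ i / fact i))"

definition A_quant :: "nat \<Rightarrow> (real \<times> real) set \<Rightarrow> real \<Rightarrow> ennreal" where
  "A_quant r \<Delta> R = (SUP z. \<integral>\<^sup>+w\<in>\<Delta> \<inter> ball z R.
     ennreal (\<bar>laguerre r (pi * (norm (z - w))\<^sup>2)\<bar> * exp (- pi * (norm (z - w))\<^sup>2 / 2)) \<partial>lebesgue)"

definition C_quant :: "nat \<Rightarrow> real \<Rightarrow> real" where
  "C_quant r R = integral {0..pi * R\<^sup>2} (\<lambda>t. (laguerre r t)\<^sup>2 * exp (- t))"

text \<open>For nonzero \<open>u \<in> M1\<close> the denominator is neither 0 nor infinite, so
  the conventions for division in \<^typ>\<open>ennreal\<close> play no role.\<close>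

definition concentration :: "nat \<Rightarrow> (real \<times> real) set \<Rightarrow> ennreal" where
  "concentration r \<Delta> = (SUP u \<in> M1 - {\<lambda>_. 0}.
     L1_norm (\<lambda>z. stft (hermite_fun r) u z * indicator \<Delta> z) / L1_norm (stft (hermite_fun r) u))"

end

theory Submission
  imports Defs "HOL-Complex_Analysis.Complex_Analysis"
begin

text \<open>
  Pairing a tempered distribution \<open>T\<close> with the Gaussians \<open>exp (- \<pi> t\<^sup>2 + 2 \<pi> t w)\<close> gives an entire function
  \<open>B\<close> (the Bargmann transform), and up to a phase and a constant \<open>stft (hermite_fun r) T\<close> at \<open>(x, \<xi>)\<close> is
  \<open>e\<^bsup>-\<pi>|w|\<^sup>2/2\<^esup> \<Sum>\<^sub>k (r choose k) (-\<pi> cnj w)\<^sup>k B\<^bsup>(r-k)\<^esup>(w)\<close> with \<open>w = x - \<i>\<xi>\<close>. Averaged over \<open>|w| = \<rho>\<close>, where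
  \<open>cnj w = \<rho>\<^sup>2 / w\<close>, Cauchy's formula for derivatives turns this sum into its value at \<open>0\<close> times
  \<open>L\<^sub>r(\<pi>\<rho>\<^sup>2) e\<^bsup>-\<pi>\<rho>\<^sup>2/2\<^esup>\<close>; by translation covariance the same holds around every centre. Multiplying by
  the absolute value of that factor and integrating over the disc of radius \<open>R\<close> bounds
  \<open>C\<^sub>r(R) |V T(z)|\<close> by an integral of \<open>|V T|\<close> over \<open>z + D\<^sub>R\<close>, and Tonelli yields
  \<open>\<parallel>V T \<chi>\<^sub>\<Delta>\<parallel>\<^sub>1 \<le> (A\<^sub>r / C\<^sub>r) \<parallel>V T\<parallel>\<^sub>1\<close>. If \<open>\<parallel>V (f - g)\<parallel>\<^sub>1 = \<infinity>\<close>, then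
  \<open>g\<close> is trivially no minimizer; otherwise the triangle inequality on and off \<open>\<Delta>\<close> decides.
  That \<open>V T = 0\<close> forces \<open>T = 0\<close> follows by analytic continuation in the
  exponents: \<open>T\<close> kills all Gaussians of all widths, hence all mollified test functions.
\<close>

section \<open>Schwartz functions and tempered distributions\<close>

text \<open>The factor in the circular mean vanishes and changes sign with the radius, so a plain
  average over the disc could cancel; weighting by its modulus makes it a square. Since p \<mapsto>
  \<pi>|p|^2 carries area to length, the integral of that square is exactly C_r(R), and the weight
  left on the other side is the kernel in A_r(\<Delta>, R). The threshold 1/2 balances two effects
  of adding V to N: off \<Delta> the norm grows by all of |V|, on \<Delta> it drops by at most |V|.
  Injectivity is delicate because \<open>T\<close> is only a functional with a seminorm bound.
  Moving it past a derivative or an integral means estimating a remainder in finitely many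
  seminorms, and Gaussians times powers form a family closed under all derivatives involved, with
  locally uniform bounds. The transform sees one Gaussian width only, whereas mollification needs
  widths tending to 0; this is why the width becomes a complex variable.\<close>

lemma nth_vderiv_0 [simp]: "nth_vderiv 0 \<phi> = \<phi>"
  by (simp add: nth_vderiv_def)

lemma nth_vderiv_Suc: "nth_vderiv (Suc n) \<phi> = (\<lambda>x. vector_derivative (nth_vderiv n \<phi>) (at x))"
  by (simp add: nth_vderiv_def)

lemma nth_vderiv_eqI:
  assumes "D 0 = \<phi>" "\<And>j t. (D j has_vector_derivative D (Suc j) t) (at t)"
  shows "nth_vderiv j \<phi> = D j"
proof (induction j)
  case (Suc j)
  then show ?case
    using assms(2) by (auto simp: nth_vderiv_Suc vector_derivative_at)
qed (use assms in auto)

text \<open>Exhibiting all derivatives at once as a sequence \<open>D\<close> reduces membership to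
  one recursion and to decay bounds that need not be optimal. Linear combinations, Gaussians,
  convolutions and translates all enter in this way.\<close>

lemma schwartzI:
  assumes "D 0 = \<phi>" "\<And>j t. (D j has_vector_derivative D (Suc j) t) (at t)"
    and "\<And>i j. \<exists>M. \<forall>t. \<bar>t\<bar> ^ i * norm (D j t) \<le> M"
  shows "\<phi> \<in> schwartz"
proof -
  have eq: "nth_vderiv j \<phi> = D j" for j
    by (rule nth_vderiv_eqI) (use assms in auto)
  show ?thesis
    unfolding schwartz_def mem_Collect_eq eq
  proof (intro conjI allI)
    show "D j differentiable at x" for j x
      using assms(2) by (meson differentiableI_vector)
    show "bdd_above (range (\<lambda>x. \<bar>x\<bar> ^ i * norm (D j x)))" for i j
      using assms(3)[of i j] by (auto simp: bdd_above_def)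
  qed
qed

lemma schwartz_has_vderiv:
  assumes "\<phi> \<in> schwartz"
  shows "(nth_vderiv j \<phi> has_vector_derivative nth_vderiv (Suc j) \<phi> t) (at t)"
  using assms by (simp add: schwartz_def nth_vderiv_Suc vector_derivative_works[symmetric])

lemma schwartz_bounded:
  assumes "\<phi> \<in> schwartz"
  shows "\<exists>M\<ge>0. \<forall>t. \<bar>t\<bar> ^ i * norm (nth_vderiv j \<phi> t) \<le> M"
proof -
  obtain M where M: "\<And>t. \<bar>t\<bar> ^ i * norm (nth_vderiv j \<phi> t) \<le> M"
    using assms unfolding schwartz_def bdd_above_def by blast
  moreover have "M \<ge> 0"
    using M[of 0] by (rule order_trans[rotated]) simp
  ultimately show ?thesis by auto
qed

lemma schwartz_lincomb:
  assumes "\<phi> \<in> schwartz" "\<psi> \<in> schwartz"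
  shows "(\<lambda>t. c * \<phi> t + d * \<psi> t) \<in> schwartz"
    and "nth_vderiv j (\<lambda>t. c * \<phi> t + d * \<psi> t)
         = (\<lambda>t. c * nth_vderiv j \<phi> t + d * nth_vderiv j \<psi> t)"
proof -
  define D where "D = (\<lambda>j t. c * nth_vderiv j \<phi> t + d * nth_vderiv j \<psi> t)"
  have D0: "D 0 = (\<lambda>t. c * \<phi> t + d * \<psi> t)"
    by (simp add: D_def)
  have D: "(D j has_vector_derivative D (Suc j) t) (at t)" for j t
    unfolding D_def using assms by (auto intro!: derivative_intros schwartz_has_vderiv)
  have bd: "\<exists>M. \<forall>t. \<bar>t\<bar> ^ i * norm (D j t) \<le> M" for i j
  proof -
    obtain M where M: "\<And>t. \<bar>t\<bar> ^ i * norm (nth_vderiv j \<phi> t) \<le> M"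
      using schwartz_bounded[OF assms(1)] by blast
    obtain M' where M': "\<And>t. \<bar>t\<bar> ^ i * norm (nth_vderiv j \<psi> t) \<le> M'"
      using schwartz_bounded[OF assms(2)] by blast
    have "\<bar>t\<bar> ^ i * norm (D j t) \<le> norm c * M + norm d * M'" for t
    proof -
      have "norm (D j t) \<le> norm c * norm (nth_vderiv j \<phi> t) + norm d * norm (nth_vderiv j \<psi> t)"
        unfolding D_def by (metis norm_mult norm_triangle_ineq)
      then have "\<bar>t\<bar> ^ i * norm (D j t)
          \<le> \<bar>t\<bar> ^ i * (norm c * norm (nth_vderiv j \<phi> t) + norm d * norm (nth_vderiv j \<psi> t))"
        by (rule mult_left_mono) simp
      also have "\<dots> = norm c * (\<bar>t\<bar> ^ i * norm (nth_vderiv j \<phi> t))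
          + norm d * (\<bar>t\<bar> ^ i * norm (nth_vderiv j \<psi> t))"
        by (simp add: algebra_simps)
      also have "\<dots> \<le> norm c * M + norm d * M'"
        by (intro add_mono mult_left_mono M M') auto
      finally show ?thesis .
    qed
    then show ?thesis by blast
  qed
  show "(\<lambda>t. c * \<phi> t + d * \<psi> t) \<in> schwartz"
    by (rule schwartzI[OF D0 D bd])
  show "nth_vderiv j (\<lambda>t. c * \<phi> t + d * \<psi> t)
         = (\<lambda>t. c * nth_vderiv j \<phi> t + d * nth_vderiv j \<psi> t)"
    using nth_vderiv_eqI[OF D0 D] by (simp add: D_def)
qed

lemma schwartz_zero: "(\<lambda>_. 0) \<in> schwartz"
  by (rule schwartzI[where D = "\<lambda>_ _. 0"]) auto

lemma schwartz_cmult: "\<phi> \<in> schwartz \<Longrightarrow> (\<lambda>t. c * \<phi> t) \<in> schwartz"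
  using schwartz_lincomb(1)[of \<phi> \<phi> c 0] by simp

lemma schwartz_sum:
  assumes "finite A" "\<And>k. k \<in> A \<Longrightarrow> \<phi> k \<in> schwartz"
  shows "(\<lambda>t. \<Sum>k\<in>A. c k * \<phi> k t) \<in> schwartz"
  using assms
proof (induction A rule: finite_induct)
  case (insert x A)
  then show ?case
    using schwartz_lincomb(1)[of "\<phi> x" "\<lambda>t. \<Sum>k\<in>A. c k * \<phi> k t" "c x" 1] by simp
qed (simp add: schwartz_zero)

lemma tempered_lincomb:
  assumes "T \<in> tempered_distributions" "\<phi> \<in> schwartz" "\<psi> \<in> schwartz"
  shows "T (\<lambda>t. c * \<phi> t + d * \<psi> t) = c * T \<phi> + d * T \<psi>"
proof -
  have add: "T (\<lambda>t. \<phi> t + \<psi> t) = T \<phi> + T \<psi>" if "\<phi> \<in> schwartz" "\<psi> \<in> schwartz" for \<phi> \<psi>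
    using assms(1) that by (auto simp: tempered_distributions_def)
  have mult: "T (\<lambda>t. c * \<phi> t) = c * T \<phi>" if "\<phi> \<in> schwartz" for c \<phi>
    using assms(1) that by (auto simp: tempered_distributions_def)
  have "T (\<lambda>t. c * \<phi> t + d * \<psi> t) = T (\<lambda>t. c * \<phi> t) + T (\<lambda>t. d * \<psi> t)"
    by (rule add) (auto intro: schwartz_cmult assms)
  with assms show ?thesis by (simp add: mult)
qed

lemma tempered_cmult:
  assumes "T \<in> tempered_distributions" "\<phi> \<in> schwartz"
  shows "T (\<lambda>t. c * \<phi> t) = c * T \<phi>"
  using assms by (auto simp: tempered_distributions_def)

lemma tempered_zero: "T \<in> tempered_distributions \<Longrightarrow> T (\<lambda>_. 0) = 0"
  using tempered_cmult[OF _ schwartz_zero, of T 0] by simp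

lemma tempered_sum:
  assumes "T \<in> tempered_distributions" "finite A" "\<And>k. k \<in> A \<Longrightarrow> \<phi> k \<in> schwartz"
  shows "T (\<lambda>t. \<Sum>k\<in>A. c k * \<phi> k t) = (\<Sum>k\<in>A. c k * T (\<phi> k))"
  using assms(2,3)
proof (induction A rule: finite_induct)
  case (insert x A)
  have "T (\<lambda>t. c x * \<phi> x t + 1 * (\<Sum>k\<in>A. c k * \<phi> k t))
      = c x * T (\<phi> x) + 1 * T (\<lambda>t. \<Sum>k\<in>A. c k * \<phi> k t)"
    by (rule tempered_lincomb) (use assms insert in \<open>auto intro: schwartz_sum\<close>)
  with insert show ?case by simp
qed (simp add: assms tempered_zero)

text \<open>Trades the sum of suprema for a single pointwise bound \<open>M\<close>, the form in
  which every later estimate arrives; the number \<open>Suc n * Suc n\<close> of seminorms is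
  absorbed into the constant.\<close>

lemma tempered_bound:
  assumes "T \<in> tempered_distributions"
  obtains C n where "C \<ge> 0"
    "\<And>\<phi> M. \<phi> \<in> schwartz \<Longrightarrow>
      (\<And>i j t. i \<le> n \<Longrightarrow> j \<le> n \<Longrightarrow> \<bar>t\<bar> ^ i * norm (nth_vderiv j \<phi> t) \<le> M) \<Longrightarrow> norm (T \<phi>) \<le> C * M"
proof -
  obtain C n where C: "\<And>\<phi>. \<phi> \<in> schwartz \<Longrightarrow>
      norm (T \<phi>) \<le> C * (\<Sum>i\<le>n. \<Sum>j\<le>n. schwartz_seminorm i j \<phi>)"
    using assms unfolding tempered_distributions_def by blast
  show ?thesis
  proof (rule that[of "\<bar>C\<bar> * real (Suc n) * real (Suc n)" n])
    fix \<phi> M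
    assume \<phi>: "\<phi> \<in> schwartz"
      and M: "\<And>i j t. i \<le> n \<Longrightarrow> j \<le> n \<Longrightarrow> \<bar>t\<bar> ^ i * norm (nth_vderiv j \<phi> t) \<le> M"
    have le: "schwartz_seminorm i j \<phi> \<le> M" if "i \<le> n" "j \<le> n" for i j
      unfolding schwartz_seminorm_def using M[OF that] by (intro cSUP_least) auto
    have ge: "0 \<le> schwartz_seminorm i j \<phi>" for i j
      unfolding schwartz_seminorm_def
      by (rule cSUP_upper2[where x = 0]) (use \<phi> in \<open>auto simp: schwartz_def\<close>)
    have "norm (T \<phi>) \<le> C * (\<Sum>i\<le>n. \<Sum>j\<le>n. schwartz_seminorm i j \<phi>)"
      by (rule C[OF \<phi>])
    also have "\<dots> \<le> \<bar>C\<bar> * (\<Sum>i\<le>n. \<Sum>j\<le>n. schwartz_seminorm i j \<phi>)"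
      by (intro mult_right_mono sum_nonneg ge) auto
    also have "\<dots> \<le> \<bar>C\<bar> * (\<Sum>i\<le>n. \<Sum>j\<le>n. M)"
      by (intro mult_left_mono sum_mono le) auto
    finally show "norm (T \<phi>) \<le> \<bar>C\<bar> * real (Suc n) * real (Suc n) * M"
      by (simp add: mult.assoc)
  qed auto
qed

text \<open>The second-order Taylor remainder is controlled in every seminorm, so \<open>T\<close> inherits the
  complex differentiability of the test functions.\<close>

lemma tempered_has_field_derivative:
  fixes \<Phi> :: "nat \<Rightarrow> complex \<Rightarrow> real \<Rightarrow> complex"
  assumes T: "T \<in> tempered_distributions" and "\<delta> > 0"
    and S: "\<And>m a. m \<le> 2 \<Longrightarrow> a \<in> ball a0 \<delta> \<Longrightarrow> \<Phi> m a \<in> schwartz"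
    and D: "\<And>m j a t. m < 2 \<Longrightarrow> a \<in> ball a0 \<delta> \<Longrightarrow>
      ((\<lambda>a. nth_vderiv j (\<Phi> m a) t) has_field_derivative nth_vderiv j (\<Phi> (Suc m) a) t) (at a)"
    and B: "\<And>i j. \<exists>M. \<forall>a\<in>ball a0 \<delta>. \<forall>t. \<bar>t\<bar> ^ i * norm (nth_vderiv j (\<Phi> 2 a) t) \<le> M"
  shows "((\<lambda>a. T (\<Phi> 0 a)) has_field_derivative T (\<Phi> 1 a0)) (at a0)"
proof -
  obtain C n where C: "C \<ge> 0" "\<And>\<phi> M. \<phi> \<in> schwartz \<Longrightarrow>
      (\<And>i j t. i \<le> n \<Longrightarrow> j \<le> n \<Longrightarrow> \<bar>t\<bar> ^ i * norm (nth_vderiv j \<phi> t) \<le> M) \<Longrightarrow> norm (T \<phi>) \<le> C * M"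
    using tempered_bound[OF T] by metis
  obtain M where M: "\<And>i j a t. a \<in> ball a0 \<delta> \<Longrightarrow> \<bar>t\<bar> ^ i * norm (nth_vderiv j (\<Phi> 2 a) t) \<le> M i j"
    using B by metis
  define K where "K = (\<Sum>i\<le>n. \<Sum>j\<le>n. \<bar>M i j\<bar>)"
  have K: "M i j \<le> K" if "i \<le> n" "j \<le> n" for i j
  proof -
    have "M i j \<le> (\<Sum>j\<le>n. \<bar>M i j\<bar>)"
      using member_le_sum[of j "{..n}" "\<lambda>j. \<bar>M i j\<bar>"] that by auto
    also have "\<dots> \<le> K"
      unfolding K_def using member_le_sum[of i "{..n}" "\<lambda>i. \<Sum>j\<le>n. \<bar>M i j\<bar>"] that
      by (auto simp: sum_nonneg)
    finally show ?thesis .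
  qed
  have a0: "a0 \<in> ball a0 \<delta>" using \<open>\<delta> > 0\<close> by simp
  define Rm where "Rm a = (\<lambda>t. \<Phi> 0 a t - \<Phi> 0 a0 t - \<Phi> 1 a0 t * (a - a0))" for a
  have Rm: "Rm a \<in> schwartz"
      "nth_vderiv j (Rm a) = (\<lambda>t. nth_vderiv j (\<Phi> 0 a) t - nth_vderiv j (\<Phi> 0 a0) t
        - nth_vderiv j (\<Phi> 1 a0) t * (a - a0))"
      "T (Rm a) = T (\<Phi> 0 a) - T (\<Phi> 0 a0) - T (\<Phi> 1 a0) * (a - a0)"
    if "a \<in> ball a0 \<delta>" for a j
  proof -
    have S': "\<Phi> 0 a \<in> schwartz" "\<Phi> 0 a0 \<in> schwartz" "\<Phi> 1 a0 \<in> schwartz"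
      using S that a0 by auto
    define E where "E = (\<lambda>t. 1 * \<Phi> 0 a t + (-1) * \<Phi> 0 a0 t)"
    have E: "E \<in> schwartz" unfolding E_def by (intro schwartz_lincomb S')
    have eq: "Rm a = (\<lambda>t. 1 * E t + (a0 - a) * \<Phi> 1 a0 t)"
      by (simp add: Rm_def E_def algebra_simps fun_eq_iff)
    show "Rm a \<in> schwartz" unfolding eq by (intro schwartz_lincomb S' E)
    have "nth_vderiv j E = (\<lambda>t. 1 * nth_vderiv j (\<Phi> 0 a) t + (-1) * nth_vderiv j (\<Phi> 0 a0) t)"
      unfolding E_def by (intro schwartz_lincomb S')
    moreover have "nth_vderiv j (Rm a) = (\<lambda>t. 1 * nth_vderiv j E t + (a0 - a) * nth_vderiv j (\<Phi> 1 a0) t)"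
      unfolding eq by (intro schwartz_lincomb S' E)
    ultimately show "nth_vderiv j (Rm a) = (\<lambda>t. nth_vderiv j (\<Phi> 0 a) t - nth_vderiv j (\<Phi> 0 a0) t
        - nth_vderiv j (\<Phi> 1 a0) t * (a - a0))"
      by (simp add: algebra_simps)
    have TE: "T E = 1 * T (\<Phi> 0 a) + (-1) * T (\<Phi> 0 a0)"
      unfolding E_def by (intro tempered_lincomb T S')
    have TR: "T (Rm a) = 1 * T E + (a0 - a) * T (\<Phi> 1 a0)"
      unfolding eq by (intro tempered_lincomb T S' E)
    show "T (Rm a) = T (\<Phi> 0 a) - T (\<Phi> 0 a0) - T (\<Phi> 1 a0) * (a - a0)"
      unfolding TR TE by (simp add: algebra_simps)
  qed
  have bnd: "norm (T (Rm a)) \<le> C * K * norm (a - a0) ^ 2" if a: "a \<in> ball a0 \<delta>" for a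
  proof -
    have "norm (T (Rm a)) \<le> C * (K * norm (a - a0) ^ 2)"
    proof (rule C(2)[OF Rm(1)[OF a]])
      fix i j t assume ij: "i \<le> n" "j \<le> n"
      \<comment> \<open>Taylor's formula is applied in the parameter for each fixed
        \<open>t\<close>, with the weight absorbed into the function, so the remainder bound
        \<open>K\<close> is the same for all \<open>t\<close>.\<close>
      have taylor: "norm (of_real (\<bar>t\<bar> ^ i) * nth_vderiv j (\<Phi> 0 a) t
          - (\<Sum>m\<le>1. of_real (\<bar>t\<bar> ^ i) * nth_vderiv j (\<Phi> m a0) t * (a - a0) ^ m / fact m))
          \<le> K * norm (a - a0) ^ Suc 1 / fact 1"
      proof (rule complex_Taylor[where S = "ball a0 \<delta>"
            and f = "\<lambda>m a. of_real (\<bar>t\<bar> ^ i) * nth_vderiv j (\<Phi> m a) t"])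
        fix m x assume "x \<in> ball a0 \<delta>" "m \<le> (1::nat)"
        then show "((\<lambda>a. of_real (\<bar>t\<bar> ^ i) * nth_vderiv j (\<Phi> m a) t) has_field_derivative
            of_real (\<bar>t\<bar> ^ i) * nth_vderiv j (\<Phi> (Suc m) x) t) (at x within ball a0 \<delta>)"
          by (intro has_field_derivative_at_within[OF DERIV_cmult[OF D]]) auto
      next
        fix x assume "x \<in> ball a0 \<delta>"
        then show "norm (of_real (\<bar>t\<bar> ^ i) * nth_vderiv j (\<Phi> (Suc 1) x) t) \<le> K"
          unfolding Suc_1 using M[of x t i j] K[OF ij] by (simp add: norm_mult norm_power)
      qed (use a a0 in auto)
      have sum1: "(\<Sum>m\<le>(1::nat). g m) = g 0 + g 1" for g :: "nat \<Rightarrow> complex"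
        by simp
      have "of_real (\<bar>t\<bar> ^ i) * nth_vderiv j (\<Phi> 0 a) t
          - (\<Sum>m\<le>1. of_real (\<bar>t\<bar> ^ i) * nth_vderiv j (\<Phi> m a0) t * (a - a0) ^ m / fact m)
          = of_real (\<bar>t\<bar> ^ i) * nth_vderiv j (Rm a) t"
        unfolding sum1 Rm(2)[OF a] by (simp add: right_diff_distrib)
      then have "norm (of_real (\<bar>t\<bar> ^ i) * nth_vderiv j (Rm a) t) \<le> K * norm (a - a0) ^ Suc 1 / fact 1"
        using taylor by (simp only:)
      then show "\<bar>t\<bar> ^ i * norm (nth_vderiv j (Rm a) t) \<le> K * norm (a - a0) ^ 2"
        unfolding Suc_1 by (simp add: norm_mult norm_power)
    qed
    then show ?thesis by (simp add: mult.assoc)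
  qed
  show ?thesis
    unfolding has_field_derivative_def
  proof (rule has_derivativeI_sandwich[where e = \<delta> and H = "\<lambda>a. C * K * norm (a - a0)"])
    show "bounded_linear ((*) (T (\<Phi> 1 a0)))" by (rule bounded_linear_mult_right)
    fix a assume "a \<in> UNIV" "a \<noteq> a0" "dist a a0 < \<delta>"
    then have "norm (T (Rm a)) / norm (a - a0) \<le> C * K * norm (a - a0)"
      using bnd[of a] by (simp add: divide_simps power2_eq_square dist_commute)
    with Rm(3)[of a] \<open>dist a a0 < \<delta>\<close>
    show "norm (T (\<Phi> 0 a) - T (\<Phi> 0 a0) - T (\<Phi> 1 a0) * (a - a0)) / norm (a - a0) \<le> C * K * norm (a - a0)"
      by (simp add: dist_commute)
  next
    have "((\<lambda>a. C * K * norm (a - a0)) \<longlongrightarrow> C * K * norm (a0 - a0)) (at a0)"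
      by (intro tendsto_intros)
    then show "((\<lambda>a. C * K * norm (a - a0)) \<longlongrightarrow> 0) (at a0)"
      by simp
  qed (use \<open>\<delta> > 0\<close> in auto)
qed

section \<open>Gaussians as test functions\<close>

text \<open>\<open>gauss_deriv a b j k\<close> is the \<open>j\<close>-th derivative of \<open>t \<mapsto> t\<^sup>k exp (a t\<^sup>2 + b t)\<close>.\<close>

primrec gauss_deriv :: "complex \<Rightarrow> complex \<Rightarrow> nat \<Rightarrow> nat \<Rightarrow> real \<Rightarrow> complex" where
  "gauss_deriv a b 0 = (\<lambda>k t. of_real t ^ k * exp (a * of_real t ^ 2 + b * of_real t))"
| "gauss_deriv a b (Suc j) = (\<lambda>k t. of_nat k * gauss_deriv a b j (k - 1) t
     + 2 * a * gauss_deriv a b j (k + 1) t + b * gauss_deriv a b j k t)"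

abbreviation gauss :: "complex \<Rightarrow> complex \<Rightarrow> nat \<Rightarrow> real \<Rightarrow> complex" where
  "gauss a b k \<equiv> gauss_deriv a b 0 k"

lemma gauss_deriv_has_vector_derivative:
  "(gauss_deriv a b j k has_vector_derivative gauss_deriv a b (Suc j) k t) (at t)"
proof (induction j arbitrary: k t)
  case 0
  have "((\<lambda>z. z ^ k * exp (a * z ^ 2 + b * z)) has_field_derivative
      gauss_deriv a b (Suc 0) k t) (at (of_real t))"
    by (rule derivative_eq_intros refl)+ (simp add: algebra_simps power2_eq_square)
  then show ?case
    unfolding gauss_deriv.simps(1) by (rule has_vector_derivative_real_field)
next
  case (Suc j)
  have eq1: "gauss_deriv a b (Suc j) k = (\<lambda>t. of_nat k * gauss_deriv a b j (k - 1) t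
      + 2 * a * gauss_deriv a b j (k + 1) t + b * gauss_deriv a b j k t)"
    by simp
  have eq2: "gauss_deriv a b (Suc (Suc j)) k t = of_nat k * gauss_deriv a b (Suc j) (k - 1) t
      + 2 * a * gauss_deriv a b (Suc j) (k + 1) t + b * gauss_deriv a b (Suc j) k t"
    by (simp only: gauss_deriv.simps(2)[of a b "Suc j"])
  show ?case
    unfolding eq2
    by (subst eq1) (intro has_vector_derivative_add has_vector_derivative_mult_right Suc)
qed

text \<open>Differentiating in \<open>b\<close> multiplies the Gaussian by t, in \<open>a\<close> by
  t^2. The exponent \<open>k\<close> is carried along so that the family is closed under both
  operations.\<close>

lemma gauss_deriv_DERIV_lin:
  "((\<lambda>b. gauss_deriv a b j k t) has_field_derivative gauss_deriv a b j (k + 1) t) (at b)"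
proof (induction j arbitrary: k)
  case 0
  show ?case
    unfolding gauss_deriv.simps(1)
    by (rule derivative_eq_intros refl)+ simp
next
  case (Suc j)
  have D: "((\<lambda>b. gauss_deriv a b (Suc j) k t) has_field_derivative
      of_nat k * gauss_deriv a b j (k - 1 + 1) t + 2 * a * gauss_deriv a b j (k + 1 + 1) t
      + (1 * gauss_deriv a b j k t + gauss_deriv a b j (k + 1) t * b)) (at b)"
    unfolding gauss_deriv.simps(2)
    by (intro DERIV_add DERIV_cmult Suc DERIV_mult DERIV_ident)
  \<comment> \<open>At \<open>k = 0\<close> the truncated \<open>k - 1\<close> is harmless, because
    its coefficient vanishes.\<close>
  show ?case
    by (rule DERIV_cong[OF D]) (cases k; simp add: algebra_simps)
qed

lemma gauss_deriv_DERIV_quad: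
  "((\<lambda>a. gauss_deriv a b j k t) has_field_derivative gauss_deriv a b j (k + 2) t) (at a)"
proof (induction j arbitrary: k)
  case 0
  show ?case
    unfolding gauss_deriv.simps(1)
    by (rule derivative_eq_intros refl)+ (simp add: power2_eq_square)
next
  case (Suc j)
  have D: "((\<lambda>a. gauss_deriv a b (Suc j) k t) has_field_derivative
      of_nat k * gauss_deriv a b j (k - 1 + 2) t
      + (2 * 1 * gauss_deriv a b j (k + 1) t + gauss_deriv a b j (k + 1 + 2) t * (2 * a))
      + b * gauss_deriv a b j (k + 2) t) (at a)"
    unfolding gauss_deriv.simps(2)
    by (intro DERIV_add DERIV_cmult Suc DERIV_mult DERIV_ident)
  show ?case
    by (rule DERIV_cong[OF D]) (cases k; simp add: algebra_simps)
qed

section \<open>Uniform seminorm bounds for Gaussians\<close>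

lemma power_le_fact_exp: "(x::real) \<ge> 0 \<Longrightarrow> x ^ n \<le> fact n * exp x"
proof -
  assume x: "x \<ge> 0"
  have "x ^ n /\<^sub>R fact n \<le> (\<Sum>k\<le>n. x ^ k /\<^sub>R fact k)"
    using x by (intro member_le_sum) auto
  also have "\<dots> \<le> exp x"
    unfolding exp_def using x by (intro sum_le_suminf summable_exp_generic) auto
  finally show ?thesis by (simp add: field_simps)
qed

text \<open>The bound has to be uniform in \<open>a\<close> and \<open>b\<close>, since the Taylor
  remainder in a parameter ranges over a whole ball of them. The induction keeps \<open>i\<close>
  and \<open>k\<close> arbitrary because the recursion for the derivatives shifts
  \<open>k\<close>.\<close>

lemma gauss_deriv_bound:
  assumes "\<alpha> > 0"
  shows "\<exists>M. \<forall>a b t. Re a \<le> - \<alpha> \<longrightarrow> norm a \<le> A \<longrightarrow> norm b \<le> A \<longrightarrow>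
    \<bar>t\<bar> ^ i * norm (gauss_deriv a b j k t) \<le> M"
proof (induction j arbitrary: i k)
  case 0
  \<comment> \<open>\<open>K\<close> is the maximum of (A + 1)s - \<alpha>s^2, found by completing
    the square. The extra 1 reserves a factor exp(-|t|), which then beats the power of |t|.\<close>
  define K where "K = (A + 1)\<^sup>2 / (4 * \<alpha>)"
  have "\<bar>t\<bar> ^ i * norm (gauss_deriv a b 0 k t) \<le> fact (i + k) * exp K"
    if ab: "Re a \<le> - \<alpha>" "norm b \<le> A" for a b t
  proof -
    have "Re a * t\<^sup>2 + Re b * t \<le> - \<alpha> * t\<^sup>2 + A * \<bar>t\<bar>"
    proof (intro add_mono mult_right_mono ab)
      have "Re b * t \<le> \<bar>Re b\<bar> * \<bar>t\<bar>" by (metis abs_ge_self abs_mult)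
      also have "\<dots> \<le> A * \<bar>t\<bar>"
        using abs_Re_le_cmod[of b] ab by (intro mult_right_mono) auto
      finally show "Re b * t \<le> A * \<bar>t\<bar>" .
    qed auto
    also have "\<dots> = K - \<bar>t\<bar> - \<alpha> * (\<bar>t\<bar> - (A + 1) / (2 * \<alpha>))\<^sup>2"
      using assms by (simp add: K_def power2_diff power_divide field_simps) (simp add: power2_eq_square algebra_simps)
    also have "\<dots> \<le> K - \<bar>t\<bar>" using assms by simp
    finally have le: "Re a * t\<^sup>2 + Re b * t \<le> K - \<bar>t\<bar>" .
    have "\<bar>t\<bar> ^ i * norm (gauss_deriv a b 0 k t) = \<bar>t\<bar> ^ (i + k) * exp (Re a * t\<^sup>2 + Re b * t)"
      by (simp add: norm_mult norm_power power_add power_abs flip: of_real_power)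
    also have "\<dots> \<le> (fact (i + k) * exp \<bar>t\<bar>) * exp (K - \<bar>t\<bar>)"
      using le by (intro mult_mono power_le_fact_exp) auto
    finally show ?thesis by (simp add: exp_diff)
  qed
  then show ?case by blast
next
  case (Suc j)
  obtain M where M: "\<And>k a b t. Re a \<le> - \<alpha> \<Longrightarrow> norm a \<le> A \<Longrightarrow> norm b \<le> A \<Longrightarrow>
      \<bar>t\<bar> ^ i * norm (gauss_deriv a b j k t) \<le> M k"
    using Suc by metis
  have "\<bar>t\<bar> ^ i * norm (gauss_deriv a b (Suc j) k t)
      \<le> real k * M (k - 1) + 2 * A * \<bar>M (k + 1)\<bar> + A * \<bar>M k\<bar>"
    if ab: "Re a \<le> - \<alpha>" "norm a \<le> A" "norm b \<le> A" for a b t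
  proof -
    have "A \<ge> 0" using ab norm_ge_zero[of b] by linarith
    have "norm (gauss_deriv a b (Suc j) k t) \<le> real k * norm (gauss_deriv a b j (k - 1) t)
        + 2 * norm a * norm (gauss_deriv a b j (k + 1) t) + norm b * norm (gauss_deriv a b j k t)"
      unfolding gauss_deriv.simps
      by (intro norm_triangle_le add_mono) (auto simp: norm_mult)
    then have "\<bar>t\<bar> ^ i * norm (gauss_deriv a b (Suc j) k t)
        \<le> \<bar>t\<bar> ^ i * (real k * norm (gauss_deriv a b j (k - 1) t)
        + 2 * norm a * norm (gauss_deriv a b j (k + 1) t) + norm b * norm (gauss_deriv a b j k t))"
      by (rule mult_left_mono) simp
    also have "\<dots> = real k * (\<bar>t\<bar> ^ i * norm (gauss_deriv a b j (k - 1) t))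
        + 2 * norm a * (\<bar>t\<bar> ^ i * norm (gauss_deriv a b j (k + 1) t))
        + norm b * (\<bar>t\<bar> ^ i * norm (gauss_deriv a b j k t))"
      by (simp add: algebra_simps)
    also have "\<dots> \<le> real k * M (k - 1) + 2 * A * \<bar>M (k + 1)\<bar> + A * \<bar>M k\<bar>"
      using ab \<open>A \<ge> 0\<close> M[OF ab, of t "k + 1"] M[OF ab, of t k]
      by (intro add_mono mult_mono M ab mult_left_mono) auto
    finally show ?thesis .
  qed
  then show ?case by blast
qed

lemma gauss_schwartz:
  assumes "Re a < 0"
  shows "gauss a b k \<in> schwartz" "nth_vderiv j (gauss a b k) = gauss_deriv a b j k"
proof -
  have D: "(gauss_deriv a b j k has_vector_derivative gauss_deriv a b (Suc j) k t) (at t)" for j t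
    by (rule gauss_deriv_has_vector_derivative)
  show "nth_vderiv j (gauss a b k) = gauss_deriv a b j k"
    by (rule nth_vderiv_eqI[where D = "\<lambda>j. gauss_deriv a b j k"]) (use D in auto)
  show "gauss a b k \<in> schwartz"
  proof (rule schwartzI[where D = "\<lambda>j. gauss_deriv a b j k"])
    fix i j
    obtain M where "\<forall>a' b' t. Re a' \<le> - (- Re a) \<longrightarrow> norm a' \<le> max (norm a) (norm b) \<longrightarrow>
        norm b' \<le> max (norm a) (norm b) \<longrightarrow> \<bar>t\<bar> ^ i * norm (gauss_deriv a' b' j k t) \<le> M"
      using gauss_deriv_bound[of "- Re a" "max (norm a) (norm b)" i j k] assms by auto
    then show "\<exists>M. \<forall>t. \<bar>t\<bar> ^ i * norm (gauss_deriv a b j k t) \<le> M"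
      by (intro exI[of _ M]) auto
  qed (use D in auto)
qed

section \<open>Analytic dependence of \<open>T\<close> on the Gaussian parameters\<close>

lemma tempered_gauss_DERIV_lin:
  assumes T: "T \<in> tempered_distributions" and a: "Re a < 0"
  shows "((\<lambda>b. T (gauss a b k)) has_field_derivative T (gauss a b (k + 1))) (at b)"
proof -
  have "((\<lambda>b. T (gauss a b (k + 0))) has_field_derivative T (gauss a b (k + 1))) (at b)"
  proof (rule tempered_has_field_derivative[OF T, where \<delta> = 1])
    fix i j
    obtain M where "\<forall>a' b' t. Re a' \<le> - (- Re a) \<longrightarrow> norm a' \<le> norm a + norm b + 1 \<longrightarrow>
        norm b' \<le> norm a + norm b + 1 \<longrightarrow> \<bar>t\<bar> ^ i * norm (gauss_deriv a' b' j (k + 2) t) \<le> M"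
      using gauss_deriv_bound[of "- Re a" "norm a + norm b + 1" i j "k + 2"] a by auto
    moreover have "norm b' \<le> norm a + norm b + 1" if "b' \<in> ball b 1" for b'
      using that norm_triangle_sub[of b' b] norm_ge_zero[of a] 
      by (simp add: dist_norm norm_minus_commute del: norm_ge_zero)
    ultimately show "\<exists>M. \<forall>b'\<in>ball b 1. \<forall>t.
        \<bar>t\<bar> ^ i * norm (nth_vderiv j (gauss a b' (k + 2)) t) \<le> M"
      using a by (intro exI[of _ M]) (auto simp: gauss_schwartz simp del: gauss_deriv.simps)
  next
    fix m j b t
    show "((\<lambda>b. nth_vderiv j (gauss a b (k + m)) t) has_field_derivative
        nth_vderiv j (gauss a b (k + Suc m)) t) (at b)"
      using gauss_deriv_DERIV_lin[of a j "k + m" t b] a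
      by (simp add: gauss_schwartz del: gauss_deriv.simps)
  qed (use a in \<open>auto simp: gauss_schwartz simp del: gauss_deriv.simps\<close>)
  then show ?thesis by simp
qed

lemma tempered_gauss_DERIV_quad:
  assumes T: "T \<in> tempered_distributions" and a: "Re a < 0"
  shows "((\<lambda>a. T (gauss a b k)) has_field_derivative T (gauss a b (k + 2))) (at a)"
proof -
  \<comment> \<open>Half the distance from \<open>a\<close> to the imaginary axis, so that Re stays
    at most \<open>- \<delta>\<close> on the whole ball.\<close>
  define \<delta> where "\<delta> = - Re a / 2"
  have "\<delta> > 0" using a by (simp add: \<delta>_def)
  have Re: "Re a' \<le> - \<delta>" if "a' \<in> ball a \<delta>" for a'
    using that abs_Re_le_cmod[of "a' - a"] by (simp add: \<delta>_def dist_norm norm_minus_commute field_simps)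
  have "((\<lambda>a. T (gauss a b (k + 2 * 0))) has_field_derivative T (gauss a b (k + 2 * 1))) (at a)"
  proof (rule tempered_has_field_derivative[OF T \<open>\<delta> > 0\<close>])
    fix i j
    obtain M where "\<forall>a' b' t. Re a' \<le> - \<delta> \<longrightarrow> norm a' \<le> norm a + norm b + \<delta> \<longrightarrow>
        norm b' \<le> norm a + norm b + \<delta> \<longrightarrow> \<bar>t\<bar> ^ i * norm (gauss_deriv a' b' j (k + 2 * 2) t) \<le> M"
      using gauss_deriv_bound[OF \<open>\<delta> > 0\<close>, of "norm a + norm b + \<delta>" i j "k + 2 * 2"] by auto
    moreover have "norm a' \<le> norm a + norm b + \<delta>" if "a' \<in> ball a \<delta>" for a'
      using that norm_triangle_sub[of a' a] norm_ge_zero[of b] 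
      by (simp add: dist_norm norm_minus_commute del: norm_ge_zero)
    moreover have "Re a' < 0" if "a' \<in> ball a \<delta>" for a'
      using Re[OF that] \<open>\<delta> > 0\<close> by simp
    ultimately show "\<exists>M. \<forall>a'\<in>ball a \<delta>. \<forall>t.
        \<bar>t\<bar> ^ i * norm (nth_vderiv j (gauss a' b (k + 2 * 2)) t) \<le> M"
      using Re \<open>\<delta> > 0\<close>
      by (intro exI[of _ M]) (auto simp: gauss_schwartz simp del: gauss_deriv.simps mem_ball)
  next
    fix m j a' t
    assume "a' \<in> ball a \<delta>"
    have neg: "Re c < 0" if "c \<in> ball a \<delta>" for c
      using Re[OF that] \<open>\<delta> > 0\<close> by linarith
    \<comment> \<open>The function \<open>nth_vderiv j (gauss a b k)\<close> is known to be
      \<open>gauss_deriv a b j k\<close> only for Re a < 0, so the derivative is transferred within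
      the ball.\<close>
    have D: "((\<lambda>a. gauss_deriv a b j (k + 2 * m) t) has_field_derivative
        nth_vderiv j (gauss a' b (k + 2 * Suc m)) t) (at a')"
      using gauss_deriv_DERIV_quad[of b j "k + 2 * m" t a'] neg[OF \<open>a' \<in> ball a \<delta>\<close>]
      by (simp add: gauss_schwartz del: gauss_deriv.simps)
    show "((\<lambda>a. nth_vderiv j (gauss a b (k + 2 * m)) t) has_field_derivative
        nth_vderiv j (gauss a' b (k + 2 * Suc m)) t) (at a')"
      by (rule has_field_derivative_transform_within_open[OF D open_ball \<open>a' \<in> ball a \<delta>\<close>])
         (use neg in \<open>simp add: gauss_schwartz del: gauss_deriv.simps mem_ball\<close>)
  qed (use Re \<open>\<delta> > 0\<close> in \<open>fastforce simp: gauss_schwartz simp del: gauss_deriv.simps mem_ball\<close>)+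
  then show ?thesis by (simp del: gauss_deriv.simps)
qed

section \<open>Hermite windows and the Bargmann transform\<close>

abbreviation cpi :: complex where "cpi \<equiv> complex_of_real pi"

text \<open>An entire function that is real on the real axis has real derivatives there. This lets
  the real iterated derivative in the Hermite functions be handled by the complex chain and Leibniz
  rules.\<close>

lemma of_real_higher_deriv:
  fixes f :: "complex \<Rightarrow> complex" and g :: "real \<Rightarrow> real"
  assumes f: "f holomorphic_on UNIV" and fg: "\<And>t. f (of_real t) = of_real (g t)"
  shows "of_real ((deriv ^^ n) g t) = (deriv ^^ n) f (of_real t)"
proof (induction n arbitrary: t)
  case (Suc n)
  define gn where "gn = (deriv ^^ n) g"
  define fn where "fn = (deriv ^^ n) f"
  have "fn holomorphic_on UNIV"
    unfolding fn_def using f by (intro holomorphic_higher_deriv) auto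
  then have "(fn has_field_derivative deriv fn (of_real t)) (at (of_real t))"
    by (simp add: holomorphic_derivI)
  then have "((\<lambda>t. fn (of_real t)) has_vector_derivative deriv fn (of_real t)) (at t)"
    by (rule has_vector_derivative_real_field)
  then have D: "((\<lambda>t. of_real (gn t) :: complex) has_vector_derivative deriv fn (of_real t)) (at t)"
    using Suc by (simp add: fn_def gn_def)
  have "(gn has_real_derivative Re (deriv fn (of_real t))) (at t)"
    using bounded_linear.has_vector_derivative[OF bounded_linear_Re D]
    by (simp add: has_real_derivative_iff_has_vector_derivative)
  moreover have "((\<lambda>t. 0) has_real_derivative Im (deriv fn (of_real t))) (at t)"
    using bounded_linear.has_vector_derivative[OF bounded_linear_Im D]
    by (simp add: has_real_derivative_iff_has_vector_derivative)
  then have "Im (deriv fn (of_real t)) = 0"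
    using DERIV_const DERIV_unique by blast
  ultimately have "of_real (deriv gn t) = deriv fn (of_real t)"
    by (simp add: DERIV_imp_deriv complex_eq_iff)
  then show ?case by (simp add: gn_def fn_def)
qed (simp add: fg)

text \<open>What remains of the normalisation once (-1/2)^r has been absorbed into the generating
  function. It is positive and independent of the point, so it scales both sides of the
  concentration inequality alike.\<close>

definition hermite_const :: "nat \<Rightarrow> real" where
  "hermite_const r = 2 powr (1/4) / (sqrt (fact r) * sqrt pi ^ r)"

lemma hermite_const_pos: "hermite_const r > 0"
  by (simp add: hermite_const_def)

text \<open>The derivatives of exp(-2\<pi>x^2) at y are Taylor data of s \<mapsto> exp(-2\<pi>(y -
  s/2)^2) at 0, each derivative in s contributing -1/2. Multiplication by exp(\<pi>y^2) then gives
  the generating function of the Hermite functions.\<close>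

lemma hermite_fun_generating:
  "hermite_fun r y = hermite_const r *
     (deriv ^^ r) (\<lambda>s. exp (- cpi * (of_real y)\<^sup>2 + 2 * cpi * of_real y * s - cpi * s\<^sup>2 / 2)) 0"
proof -
  define e :: "complex \<Rightarrow> complex" where "e = (\<lambda>z. exp (- 2 * cpi * z\<^sup>2))"
  have e: "e holomorphic_on UNIV" unfolding e_def by (intro holomorphic_intros)
  have e_eq: "e (of_real t) = of_real (exp (- 2 * pi * t\<^sup>2))" for t
    by (simp add: e_def flip: exp_of_real)
  have "exp (- cpi * (of_real y)\<^sup>2 + 2 * cpi * of_real y * s - cpi * s\<^sup>2 / 2) = exp (of_real (pi * y\<^sup>2)) * e ((- 1 / 2) * s + of_real y)" for s :: complex
    by (simp add: e_def flip: exp_add) (simp add: algebra_simps power2_eq_square)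
  then have "(deriv ^^ r) (\<lambda>s. exp (- cpi * (of_real y)\<^sup>2 + 2 * cpi * of_real y * s - cpi * s\<^sup>2 / 2)) (0::complex)
      = (deriv ^^ r) (\<lambda>s. exp (of_real (pi * y\<^sup>2)) * e ((- 1 / 2) * s + of_real y)) 0"
    by presburger
  also have "\<dots> = exp (of_real (pi * y\<^sup>2)) * (deriv ^^ r) (\<lambda>s. e ((- 1 / 2) * s + of_real y)) 0"
    by (rule higher_deriv_cmult[where A = UNIV]) (auto simp: e_def intro!: holomorphic_intros)
  also have "(deriv ^^ r) (\<lambda>s. e ((- 1 / 2) * s + of_real y)) 0 = (- 1 / 2) ^ r * (deriv ^^ r) e ((- 1 / 2) * 0 + of_real y)"
    by (rule higher_deriv_compose_linear'[OF e open_UNIV open_UNIV]) auto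
  also have "(deriv ^^ r) e ((- 1 / 2) * 0 + of_real y) = of_real ((deriv ^^ r) (\<lambda>s. exp (- 2 * pi * s\<^sup>2)) y)"
    using of_real_higher_deriv[OF e e_eq] by simp
  also have "exp (of_real (pi * y\<^sup>2)) * ((- 1 / 2) ^ r * of_real ((deriv ^^ r) (\<lambda>s. exp (- 2 * pi * s\<^sup>2)) y))
      = complex_of_real (exp (pi * y\<^sup>2) * ((- 1 / 2) ^ r * (deriv ^^ r) (\<lambda>s. exp (- 2 * pi * s\<^sup>2)) y))"
    by (simp flip: exp_of_real)
  finally have eq: "(deriv ^^ r) (\<lambda>s. exp (- cpi * (of_real y)\<^sup>2 + 2 * cpi * of_real y * s - cpi * s\<^sup>2 / 2)) (0::complex)
      = complex_of_real (exp (pi * y\<^sup>2) * ((- 1 / 2) ^ r * (deriv ^^ r) (\<lambda>s. exp (- 2 * pi * s\<^sup>2)) y))" .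
  have "(- 1 / (2 * sqrt pi)) ^ r = (- 1 / 2) ^ r / sqrt pi ^ r"
  proof -
    have "- 1 / (2 * sqrt pi) = (- 1 / 2) / sqrt pi" by simp
    then show ?thesis by (simp only: power_divide)
  qed
  then have "hermite_fun r y = of_real (hermite_const r) *
      complex_of_real (exp (pi * y\<^sup>2) * ((- 1 / 2) ^ r * (deriv ^^ r) (\<lambda>s. exp (- 2 * pi * s\<^sup>2)) y))"
    unfolding hermite_fun_def hermite_const_def of_real_mult[symmetric] by simp
  then show ?thesis by (simp only: eq)
qed

section \<open>The entire functions obtained by pairing with Gaussians\<close>

lemma tempered_gauss_holomorphic:
  assumes "T \<in> tempered_distributions"
  shows "(\<lambda>s. T (gauss (- cpi) (2 * cpi * (w + s)) k)) holomorphic_on UNIV"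
    and "deriv (\<lambda>s. T (gauss (- cpi) (2 * cpi * (w + s)) k)) = (\<lambda>s. 2 * cpi * T (gauss (- cpi) (2 * cpi * (w + s)) (k + 1)))"
proof -
  have D: "((\<lambda>s. T (gauss (- cpi) (2 * cpi * (w + s)) k)) has_field_derivative
      T (gauss (- cpi) (2 * cpi * (w + s)) (k + 1)) * (2 * cpi * (0 + 1))) (at s)" for s
    by (rule DERIV_chain2[OF tempered_gauss_DERIV_lin[OF assms]]) (auto intro!: derivative_eq_intros)
  then show "(\<lambda>s. T (gauss (- cpi) (2 * cpi * (w + s)) k)) holomorphic_on UNIV"
    by (subst holomorphic_on_open) auto
  show "deriv (\<lambda>s. T (gauss (- cpi) (2 * cpi * (w + s)) k)) = (\<lambda>s. 2 * cpi * T (gauss (- cpi) (2 * cpi * (w + s)) (k + 1)))"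
    using DERIV_imp_deriv[OF D] by (simp add: fun_eq_iff mult.commute)
qed

lemma higher_deriv_tempered_gauss:
  assumes "T \<in> tempered_distributions"
  shows "(deriv ^^ m) (\<lambda>s. T (gauss (- cpi) (2 * cpi * (w + s)) k))
       = (\<lambda>s. (2 * cpi) ^ m * T (gauss (- cpi) (2 * cpi * (w + s)) (k + m)))"
proof (induction m)
  case (Suc m)
  have "deriv (\<lambda>s. (2 * cpi) ^ m * T (gauss (- cpi) (2 * cpi * (w + s)) (k + m)))
      = (\<lambda>s. (2 * cpi) ^ m * deriv (\<lambda>s. T (gauss (- cpi) (2 * cpi * (w + s)) (k + m))) s)"
    using tempered_gauss_holomorphic(1)[OF assms, of w "k + m"]
    by (intro ext deriv_cmult) (auto simp: holomorphic_on_open field_differentiable_def)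
  also have "\<dots> = (\<lambda>s. (2 * cpi) ^ m * (2 * cpi * T (gauss (- cpi) (2 * cpi * (w + s)) (k + m + 1))))"
    by (simp only: tempered_gauss_holomorphic(2)[OF assms])
  also have "\<dots> = (\<lambda>s. (2 * cpi) ^ Suc m * T (gauss (- cpi) (2 * cpi * (w + s)) (k + Suc m)))"
    by (simp add: mult.assoc mult.left_commute del: gauss_deriv.simps)
  finally show ?case
    unfolding funpow.simps o_def Suc .
qed simp

lemma gauss_holomorphic:
  "(\<lambda>s. gauss (- cpi) (2 * cpi * (w + s)) k t) holomorphic_on UNIV"
  unfolding gauss_deriv.simps by (intro holomorphic_intros)

lemma higher_deriv_gauss:
  "(deriv ^^ m) (\<lambda>s. gauss (- cpi) (2 * cpi * (w + s)) k t)
       = (\<lambda>s. (2 * cpi) ^ m * gauss (- cpi) (2 * cpi * (w + s)) (k + m) t)"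
proof (induction m)
  case (Suc m)
  have "deriv (\<lambda>s. (2 * cpi) ^ m * gauss (- cpi) (2 * cpi * (w + s)) (k + m) t)
      = (\<lambda>s. (2 * cpi) ^ m * (gauss (- cpi) (2 * cpi * (w + s)) (k + m + 1) t * (2 * cpi * (0 + 1))))"
    by (intro ext DERIV_imp_deriv DERIV_cmult DERIV_chain2[OF gauss_deriv_DERIV_lin])
       (auto intro!: derivative_eq_intros)
  then show ?case
    unfolding funpow.simps o_def Suc by (simp add: mult_ac del: gauss_deriv.simps)
qed simp

text \<open>By Leibniz both sides are the same finite combination of Gaussian moments.\<close>

lemma tempered_higher_deriv:
  assumes T: "T \<in> tempered_distributions" and c: "c holomorphic_on UNIV"
  shows "(\<lambda>t. (deriv ^^ r) (\<lambda>s. c s * gauss (- cpi) (2 * cpi * (w + s)) 0 t) 0) \<in> schwartz"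
    and "T (\<lambda>t. (deriv ^^ r) (\<lambda>s. c s * gauss (- cpi) (2 * cpi * (w + s)) 0 t) 0)
       = (deriv ^^ r) (\<lambda>s. c s * T (gauss (- cpi) (2 * cpi * (w + s)) 0)) 0"
proof -
  define C where "C = (\<lambda>i. of_nat (r choose i) * (deriv ^^ i) c 0 * (2 * cpi) ^ (r - i))"
  have eq: "(\<lambda>t. (deriv ^^ r) (\<lambda>s. c s * gauss (- cpi) (2 * cpi * (w + s)) 0 t) 0)
      = (\<lambda>t. \<Sum>i\<in>{0..r}. C i * gauss (- cpi) (2 * cpi * w) (r - i) t)"
    by (rule ext, subst higher_deriv_mult[OF c gauss_holomorphic])
       (simp_all only: higher_deriv_gauss C_def add_0_left add_0_right UNIV_I open_UNIV mult.assoc[symmetric])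
  have eqT: "(deriv ^^ r) (\<lambda>s. c s * T (gauss (- cpi) (2 * cpi * (w + s)) 0)) 0
      = (\<Sum>i\<in>{0..r}. C i * T (gauss (- cpi) (2 * cpi * w) (r - i)))"
    by (subst higher_deriv_mult[OF c tempered_gauss_holomorphic(1)[OF T]])
       (simp_all only: higher_deriv_tempered_gauss[OF T] C_def add_0_left add_0_right UNIV_I open_UNIV mult.assoc[symmetric])
  have S: "gauss (- cpi) (2 * cpi * w) k \<in> schwartz" for k
    by (rule gauss_schwartz) simp
  show "(\<lambda>t. (deriv ^^ r) (\<lambda>s. c s * gauss (- cpi) (2 * cpi * (w + s)) 0 t) 0) \<in> schwartz"
    unfolding eq by (intro schwartz_sum S) auto
  show "T (\<lambda>t. (deriv ^^ r) (\<lambda>s. c s * gauss (- cpi) (2 * cpi * (w + s)) 0 t) 0)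
       = (deriv ^^ r) (\<lambda>s. c s * T (gauss (- cpi) (2 * cpi * (w + s)) 0)) 0"
    unfolding eq eqT by (intro tempered_sum T S) auto
qed

text \<open>The customary normalising factor 2^(1/4) is left to
  \<open>hermite_const\<close>.\<close>

definition bargmann :: "((real \<Rightarrow> complex) \<Rightarrow> complex) \<Rightarrow> complex \<Rightarrow> complex" where
  "bargmann T v = exp (- cpi * v\<^sup>2 / 2) * T (gauss (- cpi) (2 * cpi * v) 0)"

text \<open>The \<open>r\<close>-th derivative in \<open>s\<close> extracts the \<open>r\<close>-th Hermite window from the generating function of the
  Hermite functions; \<open>true_poly_eq\<close> gives the expanded form.\<close>

definition true_poly :: "nat \<Rightarrow> (complex \<Rightarrow> complex) \<Rightarrow> complex \<Rightarrow> complex" where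
  "true_poly r B w = (deriv ^^ r) (\<lambda>s. exp (- cpi * norm w ^ 2 / 2 - cpi * cnj w * s) * B (w + s)) 0"

lemma bargmann_holomorphic:
  "T \<in> tempered_distributions \<Longrightarrow> bargmann T holomorphic_on UNIV"
  unfolding bargmann_def
  using tempered_gauss_holomorphic(1)[of T 0 0] by (intro holomorphic_intros) simp_all

text \<open>The conjugation in the pairing turns the modulation into w = x - i\<xi>. The exponent of
  the conjugated, shifted generating function splits into the phase -i\<pi>x\<xi>, the exponent
  -\<pi>|w|^2/2 - \<pi> cnj(w) s of \<open>true_poly\<close>, and the exponent of the Bargmann
  kernel at w + s; \<open>T\<close> and the derivatives in s may be exchanged.\<close>

lemma stft_hermite:
  assumes T: "T \<in> tempered_distributions"
  shows "stft (hermite_fun r) T (x, \<xi>) =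
    hermite_const r * exp (- \<i> * cpi * x * \<xi>) * true_poly r (bargmann T) (Complex x (- \<xi>))"
proof -
  define w where "w = Complex x (- \<xi>)"
  define c where "c = (\<lambda>s. exp (- cpi * norm w ^ 2 / 2 - cpi * cnj w * s - cpi * (w + s)\<^sup>2 / 2))"
  have c: "c holomorphic_on UNIV" unfolding c_def by (intro holomorphic_intros) auto
  define D where "D = hermite_const r * exp (- \<i> * cpi * x * \<xi>)"
  have w_eq: "w = of_real x - \<i> * of_real \<xi>" and cnj_eq: "cnj w = of_real x + \<i> * of_real \<xi>"
    by (auto simp: w_def complex_eq_iff)
  have norm_eq: "of_real (norm w ^ 2) = (of_real x ^ 2 + of_real \<xi> ^ 2 :: complex)"
    by (simp add: w_def cmod_power2 flip: of_real_power)
  have cnj_hermite: "cnj (hermite_fun r y) = hermite_fun r y" for y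
    by (simp add: hermite_fun_def)
  have "cnj (tf_shift (x, \<xi>) (hermite_fun r) t) =
      D * (deriv ^^ r) (\<lambda>s. c s * gauss (- cpi) (2 * cpi * (w + s)) 0 t) 0" for t
  proof -
    define E where "E = (\<lambda>s::complex. exp (- cpi * (of_real t - of_real x)\<^sup>2 + 2 * cpi * (of_real t - of_real x) * s - cpi * s\<^sup>2 / 2))"
    have E: "E holomorphic_on UNIV" unfolding E_def by (intro holomorphic_intros) auto
    define G where "G = (\<lambda>s. c s * gauss (- cpi) (2 * cpi * (w + s)) 0 t)"
    have G: "G holomorphic_on UNIV"
      unfolding G_def by (intro holomorphic_on_mult c gauss_holomorphic)
    have "exp (- (2 * cpi * \<i> * \<xi> * t)) * E s = exp (- \<i> * cpi * x * \<xi>) * G s" for s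
    proof -
      have "- (2 * cpi * \<i> * \<xi> * t) + (- cpi * (of_real t - of_real x)\<^sup>2 + 2 * cpi * (of_real t - of_real x) * s - cpi * s\<^sup>2 / 2)
        = - \<i> * cpi * x * \<xi> + ((- cpi * of_real (norm w ^ 2) / 2 - cpi * cnj w * s - cpi * (w + s)\<^sup>2 / 2)
           + (- cpi * of_real t ^ 2 + (2 * cpi * (w + s)) * of_real t))"
        unfolding norm_eq cnj_eq unfolding w_eq
        by (simp add: field_simps power2_eq_square)
      then show ?thesis
        unfolding E_def G_def c_def gauss_deriv.simps by (simp flip: exp_add)
    qed
    then have "(deriv ^^ r) (\<lambda>s. exp (- (2 * cpi * \<i> * \<xi> * t)) * E s) 0
        = (deriv ^^ r) (\<lambda>s. exp (- \<i> * cpi * x * \<xi>) * G s) 0"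
      by presburger
    then have eq: "exp (- (2 * cpi * \<i> * \<xi> * t)) * (deriv ^^ r) E 0 = exp (- \<i> * cpi * x * \<xi>) * (deriv ^^ r) G 0"
      by (simp add: higher_deriv_cmult[OF E] higher_deriv_cmult[OF G])
    have "cnj (tf_shift (x, \<xi>) (hermite_fun r) t) = exp (- (2 * cpi * \<i> * \<xi> * t)) * hermite_fun r (t - x)"
      by (simp add: tf_shift_def cnj_hermite exp_cnj)
    also have "\<dots> = hermite_const r * (exp (- (2 * cpi * \<i> * \<xi> * t)) * (deriv ^^ r) E 0)"
      unfolding hermite_fun_generating E_def by (simp only: of_real_diff mult.left_commute)
    also have "\<dots> = D * (deriv ^^ r) G 0"
      unfolding eq D_def by simp
    finally show ?thesis unfolding G_def .
  qed
  then have "stft (hermite_fun r) T (x, \<xi>) =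
      T (\<lambda>t. D * (deriv ^^ r) (\<lambda>s. c s * gauss (- cpi) (2 * cpi * (w + s)) 0 t) 0)"
    by (simp only: stft_def pairing_def)
  also have "\<dots> = D * (deriv ^^ r) (\<lambda>s. c s * T (gauss (- cpi) (2 * cpi * (w + s)) 0)) 0"
    using tempered_cmult[OF T tempered_higher_deriv(1)[OF T c, of r w], of D]
    by (simp only: tempered_higher_deriv(2)[OF T c])
  also have "(\<lambda>s. c s * T (gauss (- cpi) (2 * cpi * (w + s)) 0))
      = (\<lambda>s. exp (- cpi * norm w ^ 2 / 2 - cpi * cnj w * s) * bargmann T (w + s))"
    by (simp add: c_def bargmann_def mult.assoc[symmetric] exp_add[symmetric] del: gauss_deriv.simps)
  finally show ?thesis
    unfolding D_def w_def true_poly_def .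
qed

section \<open>Circular means\<close>

lemma higher_deriv_exp_linear:
  "(deriv ^^ k) (\<lambda>s::complex. exp (c + u * s)) = (\<lambda>s. u ^ k * exp (c + u * s))"
proof (induction k)
  case (Suc k)
  have "deriv (\<lambda>s. u ^ k * exp (c + u * s)) = (\<lambda>s. u ^ Suc k * exp (c + u * s))"
    by (intro ext DERIV_imp_deriv) (auto intro!: derivative_eq_intros)
  then show ?case by (simp add: Suc)
qed simp

lemma entire_compose:
  "f holomorphic_on UNIV \<Longrightarrow> g holomorphic_on UNIV \<Longrightarrow> (\<lambda>s. f (g s)) holomorphic_on UNIV"
  using holomorphic_on_compose_gen[of g UNIV f UNIV] by (simp add: o_def)

lemma true_poly_eq:
  assumes B: "B holomorphic_on UNIV"
  shows "true_poly r B w = exp (- cpi * norm w ^ 2 / 2) *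
    (\<Sum>k\<le>r. of_nat (r choose k) * (- cpi * cnj w) ^ k * (deriv ^^ (r - k)) B w)"
proof -
  have B': "(\<lambda>s. B (w + s)) holomorphic_on UNIV"
    by (intro entire_compose[OF B] holomorphic_intros)
  have D: "(deriv ^^ m) (\<lambda>s. B (w + s)) 0 = (deriv ^^ m) B w" for m
    using higher_deriv_compose_linear'[OF B open_UNIV open_UNIV UNIV_I, of 1 w m 0]
    by (simp add: add.commute)
  have "true_poly r B w = (deriv ^^ r) (\<lambda>s. exp (- cpi * norm w ^ 2 / 2 + (- cpi * cnj w) * s) * B (w + s)) 0"
    by (simp add: true_poly_def)
  also have "\<dots> = (\<Sum>k = 0..r. of_nat (r choose k) *
      ((- cpi * cnj w) ^ k * exp (- cpi * norm w ^ 2 / 2 + (- cpi * cnj w) * 0)) * (deriv ^^ (r - k)) B w)"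
    by (subst higher_deriv_mult[OF _ B'], (intro holomorphic_intros)[1])
       (simp_all only: higher_deriv_exp_linear D open_UNIV UNIV_I)
  also have "\<dots> = exp (- cpi * norm w ^ 2 / 2) *
    (\<Sum>k\<le>r. of_nat (r choose k) * (- cpi * cnj w) ^ k * (deriv ^^ (r - k)) B w)"
    by (simp add: atMost_atLeast0 sum_distrib_left mult_ac)
  finally show ?thesis .
qed

lemma true_poly_continuous:
  assumes B: "B holomorphic_on UNIV"
  shows "continuous_on UNIV (true_poly r B)"
proof -
  have "continuous_on UNIV (\<lambda>w. (deriv ^^ k) B w)" for k
    by (intro holomorphic_on_imp_continuous_on holomorphic_higher_deriv B open_UNIV)
  then show ?thesis
    unfolding true_poly_eq[OF B, abs_def] by (intro continuous_intros) auto
qed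

lemma true_poly_0: "B holomorphic_on UNIV \<Longrightarrow> true_poly r B 0 = (deriv ^^ r) B 0"
  by (simp add: true_poly_eq power_0_left if_distrib if_distribR cong: if_cong)

text \<open>One factor of Cauchy's denominator \<open>u ^ Suc k\<close> is cancelled by the path
  derivative 2\<pi>iu, so a mean over the circle with denominator \<open>u ^ k\<close>
  remains.\<close>

lemma circle_mean_power:
  assumes f: "f holomorphic_on UNIV" and "\<rho> > 0"
  shows "((\<lambda>t. f (of_real \<rho> * exp (2 * cpi * \<i> * of_real t)) / (of_real \<rho> * exp (2 * cpi * \<i> * of_real t)) ^ k)
    has_integral (deriv ^^ k) f 0 / fact k) {0..1}"
proof -
  have "((\<lambda>u. f u / (u - 0) ^ Suc k) has_contour_integral
      2 * pi * \<i> / fact k * (deriv ^^ k) f 0) (circlepath 0 \<rho>)"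
    using \<open>\<rho> > 0\<close> f
    by (intro Cauchy_has_contour_integral_higher_derivative_circlepath)
       (auto intro: holomorphic_on_subset holomorphic_on_imp_continuous_on)
  then have "((\<lambda>t. f (circlepath 0 \<rho> t) / circlepath 0 \<rho> t ^ Suc k * vector_derivative (circlepath 0 \<rho>) (at t))
      has_integral 2 * pi * \<i> / fact k * (deriv ^^ k) f 0) {0..1}"
    by (simp add: has_contour_integral)
  then have "((\<lambda>t. 1 / (2 * pi * \<i>) * (f (circlepath 0 \<rho> t) / circlepath 0 \<rho> t ^ Suc k * vector_derivative (circlepath 0 \<rho>) (at t)))
      has_integral 1 / (2 * pi * \<i>) * (2 * pi * \<i> / fact k * (deriv ^^ k) f 0)) {0..1}"
    by (rule has_integral_mult_right)
  moreover have "1 / (2 * pi * \<i>) * (f (circlepath 0 \<rho> t) / circlepath 0 \<rho> t ^ Suc k * vector_derivative (circlepath 0 \<rho>) (at t))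
      = f (of_real \<rho> * exp (2 * cpi * \<i> * of_real t)) / (of_real \<rho> * exp (2 * cpi * \<i> * of_real t)) ^ k" for t
    using \<open>\<rho> > 0\<close> unfolding vector_derivative_circlepath by (simp add: circlepath)
  ultimately show ?thesis by simp
qed

lemma true_poly_circle_real:
  assumes B: "B holomorphic_on UNIV" and "\<rho> > 0"
  shows "((\<lambda>t. true_poly r B (of_real \<rho> * exp (2 * cpi * \<i> * of_real t))) has_integral
    of_real (laguerre r (pi * \<rho>\<^sup>2) * exp (- pi * \<rho>\<^sup>2 / 2)) * true_poly r B 0) {0..1}"
proof -
  define u where "u = (\<lambda>t::real. of_real \<rho> * exp (2 * cpi * \<i> * of_real t))"
  have nu: "norm (u t) = \<rho>" for t
    using \<open>\<rho> > 0\<close> by (simp add: u_def norm_mult)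
  have u0: "u t \<noteq> 0" for t using \<open>\<rho> > 0\<close> by (simp add: u_def)
  have cnj_u: "cnj (u t) = of_real (\<rho>\<^sup>2) / u t" for t
    using complex_norm_square[of "u t"] u0[of t] by (simp add: nu field_simps)
  define C where "C k = exp (- cpi * of_real \<rho> ^ 2 / 2) * (of_nat (r choose k) * (- cpi * of_real (\<rho>\<^sup>2)) ^ k)" for k
  have eq: "true_poly r B (u t) = (\<Sum>k\<le>r. C k * ((deriv ^^ (r - k)) B (u t) / u t ^ k))" for t
    unfolding true_poly_eq[OF B] nu cnj_u C_def
    by (simp add: sum_distrib_left power_divide power_mult_distrib power_minus[of "_ / _"] power_minus[of "_ * _"] mult_ac)
  have "((\<lambda>t. \<Sum>k\<le>r. C k * ((deriv ^^ (r - k)) B (u t) / u t ^ k)) has_integral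
      (\<Sum>k\<le>r. C k * ((deriv ^^ k) ((deriv ^^ (r - k)) B) 0 / fact k))) {0..1}"
    unfolding u_def
    by (intro has_integral_sum has_integral_mult_right circle_mean_power \<open>\<rho> > 0\<close> holomorphic_higher_deriv B) auto
  \<comment> \<open>The orders k and r - k always add up to r, so every summand contains the same
    \<open>(deriv ^^ r) B 0\<close>; the coefficients left over, with 1/k! from Cauchy's formula,
    are those of the Laguerre polynomial.\<close>
  moreover have "(\<Sum>k\<le>r. C k * ((deriv ^^ k) ((deriv ^^ (r - k)) B) 0 / fact k))
      = of_real (laguerre r (pi * \<rho>\<^sup>2) * exp (- pi * \<rho>\<^sup>2 / 2)) * true_poly r B 0"
  proof -
    have "(deriv ^^ k) ((deriv ^^ (r - k)) B) = (deriv ^^ r) B" if "k \<le> r" for k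
      using that funpow_add[of k "r - k" "deriv :: (complex \<Rightarrow> complex) \<Rightarrow> _"] by (simp add: o_def fun_eq_iff)
    then have "(\<Sum>k\<le>r. C k * ((deriv ^^ k) ((deriv ^^ (r - k)) B) 0 / fact k))
        = (\<Sum>k\<le>r. C k / fact k) * (deriv ^^ r) B 0"
      by (simp add: sum_distrib_right)
    also have "(\<Sum>k\<le>r. C k / fact k) = of_real (laguerre r (pi * \<rho>\<^sup>2) * exp (- pi * \<rho>\<^sup>2 / 2))"
    proof -
      have e: "exp (- cpi * of_real \<rho> ^ 2 / 2) = of_real (exp (- pi * \<rho>\<^sup>2 / 2))"
        by (simp flip: exp_of_real)
      have "C k / fact k = of_real (((-1) ^ k * real (r choose k) * ((pi * \<rho>\<^sup>2) ^ k / fact k)) * exp (- pi * \<rho>\<^sup>2 / 2))" for k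
        unfolding C_def e by (simp add: power_minus[of "cpi * _"] mult_ac)
      then show ?thesis
        unfolding laguerre_def sum_distrib_right of_real_sum by simp
    qed
    finally show ?thesis using true_poly_0[OF B] by simp
  qed
  ultimately have "((\<lambda>t. \<Sum>k\<le>r. C k * ((deriv ^^ (r - k)) B (u t) / u t ^ k)) has_integral
      of_real (laguerre r (pi * \<rho>\<^sup>2) * exp (- pi * \<rho>\<^sup>2 / 2)) * true_poly r B 0) {0..1}"
    by (simp only:)
  then have "((\<lambda>t. true_poly r B (u t)) has_integral
      of_real (laguerre r (pi * \<rho>\<^sup>2) * exp (- pi * \<rho>\<^sup>2 / 2)) * true_poly r B 0) {0..1}"
    by (simp only: eq)
  then show ?thesis unfolding u_def .
qed

text \<open>This is the translation of Fock space, the counterpart of a time-frequency shift: the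
  exponential factor in \<open>Bz\<close> recentres exp(-\<pi>|w|^2/2) at z, and all that is left
  over is the unimodular constant exp(i\<theta>).\<close>

lemma true_poly_shift:
  fixes z :: complex
  defines "Bz \<equiv> \<lambda>B v. exp (- cpi * norm z ^ 2 / 2 - cpi * cnj z * v) * B (z + v)"
  assumes B: "B holomorphic_on UNIV"
  shows "Bz B holomorphic_on UNIV"
    and "norm (true_poly r (Bz B) w) = norm (true_poly r B (z + w))"
proof -
  have shift: "(\<lambda>s. B (z + s)) holomorphic_on UNIV" for z
    by (intro entire_compose[OF B] holomorphic_intros)
  show "Bz B holomorphic_on UNIV"
    unfolding Bz_def by (intro holomorphic_intros shift) auto
  define \<theta> where "\<theta> = pi * Im (z * cnj w)"
  have ph: "(- cpi * norm w ^ 2 / 2 - cpi * cnj w * s) + (- cpi * norm z ^ 2 / 2 - cpi * cnj z * (w + s))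
      = \<i> * \<theta> + (- cpi * norm (z + w) ^ 2 / 2 - cpi * cnj (z + w) * s)" for s
  proof -
    have "of_real (norm x) ^ 2 = x * cnj x" for x
      by (metis complex_norm_square of_real_power)
    then have "of_real (norm (z + w)) ^ 2 = of_real (norm z) ^ 2 + of_real (norm w) ^ 2 + (z * cnj w + cnj z * w)"
      by (simp only: complex_cnj_add) (simp add: algebra_simps)
    moreover have "\<i> * of_real \<theta> = cpi * (z * cnj w - cnj z * w) / 2"
      by (simp add: \<theta>_def complex_eq_iff algebra_simps)
    ultimately show ?thesis by (simp add: field_simps)
  qed
  define G where "G = (\<lambda>s. exp (- cpi * norm (z + w) ^ 2 / 2 - cpi * cnj (z + w) * s) * B (z + w + s))"
  have G: "G holomorphic_on UNIV"
    unfolding G_def by (intro holomorphic_intros shift) auto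
  have "true_poly r (Bz B) w = (deriv ^^ r) (\<lambda>s. exp (\<i> * \<theta>) * G s) 0"
    unfolding true_poly_def Bz_def G_def mult.assoc[symmetric] exp_add[symmetric] ph
    by (simp only: add.assoc)
  also have "\<dots> = exp (\<i> * \<theta>) * (deriv ^^ r) G 0"
    by (rule higher_deriv_cmult[OF G]) auto
  finally show "norm (true_poly r (Bz B) w) = norm (true_poly r B (z + w))"
    by (simp add: G_def true_poly_def norm_mult)
qed

text \<open>A rotation leaves |w| and \<open>cnj w * s\<close> invariant, and each derivative in s
  contributes one factor u. It carries the mean value identity from circles starting on the positive
  axis to circles starting at an arbitrary point.\<close>

lemma true_poly_rotate:
  assumes B: "B holomorphic_on UNIV" and u: "norm u = 1"
  shows "true_poly r (\<lambda>v. B (u * v)) w = u ^ r * true_poly r B (u * w)"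
proof -
  define G where "G = (\<lambda>s. exp (- cpi * norm (u * w) ^ 2 / 2 - cpi * cnj (u * w) * s) * B (u * w + s))"
  have "(\<lambda>s. B (u * w + s)) holomorphic_on UNIV"
    by (intro entire_compose[OF B] holomorphic_intros)
  then have G: "G holomorphic_on UNIV"
    unfolding G_def by (intro holomorphic_intros) auto
  have "cnj u * u = 1"
    using u complex_norm_square[of u] by (simp add: mult.commute)
  then have key: "cnj u * (cnj w * (u * s)) = cnj w * s" for s
    by (metis (no_types, opaque_lifting) mult.assoc mult.left_commute mult_1)
  have "true_poly r (\<lambda>v. B (u * v)) w = (deriv ^^ r) (\<lambda>s. G (u * s)) 0"
    by (simp only: true_poly_def G_def norm_mult u mult_1_left complex_cnj_mult mult.assoc key distrib_left)
  also have "\<dots> = u ^ r * (deriv ^^ r) G (u * 0)"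
    by (rule higher_deriv_compose_linear[OF G open_UNIV open_UNIV]) auto
  finally show ?thesis by (simp add: G_def true_poly_def)
qed

lemma true_poly_circle:
  assumes B: "B holomorphic_on UNIV"
  shows "((\<lambda>t. true_poly r B (exp (2 * cpi * \<i> * of_real t) * w)) has_integral
    of_real (laguerre r (pi * (norm w)\<^sup>2) * exp (- pi * (norm w)\<^sup>2 / 2)) * true_poly r B 0) {0..1}"
proof (cases "w = 0")
  case True
  have "laguerre r 0 = 1"
    by (simp add: laguerre_def power_0_left if_distrib if_distribR cong: if_cong)
  then show ?thesis
    using True has_integral_const_real[of "true_poly r B 0" 0 1] by simp
next
  case False
  define u where "u = w / of_real (norm w)"
  have u: "norm u = 1" and w: "w = of_real (norm w) * u"
    using False by (auto simp: u_def norm_divide)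
  have "(\<lambda>v. B (u * v)) holomorphic_on UNIV"
    by (intro entire_compose[OF B] holomorphic_intros)
  note I = true_poly_circle_real[OF this, of "norm w" r, unfolded true_poly_rotate[OF B u]]
  have "u * (of_real (norm w) * E) = E * w" for E
    using False by (simp add: u_def)
  then have "((\<lambda>t. u ^ r * true_poly r B (exp (2 * cpi * \<i> * of_real t) * w)) has_integral
    of_real (laguerre r (pi * (norm w)\<^sup>2) * exp (- pi * (norm w)\<^sup>2 / 2)) * (u ^ r * true_poly r B 0)) {0..1}"
    using I False by (simp only: mult_zero_right zero_less_norm_iff simp_thms)
  note J = has_integral_mult_right[OF this, of "inverse (u ^ r)"]
  have "u \<noteq> 0" using u by auto
  then have "inverse (u ^ r) * (u ^ r * x) = x" "inverse (u ^ r) * (c * (u ^ r * x)) = c * x" for x c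
    by simp_all
  then show ?thesis using J by (simp only:)
qed

text \<open>The substitute for subharmonicity: recentre at z, use the exact identity around 0, and
  move the norm inside the integral. The translation changes \<open>true_poly\<close> by a phase
  only, so norms are unaffected.\<close>

lemma true_poly_circle_bound:
  assumes B: "B holomorphic_on UNIV"
  shows "\<bar>laguerre r (pi * (norm w)\<^sup>2)\<bar> * exp (- pi * (norm w)\<^sup>2 / 2) * norm (true_poly r B z)
    \<le> integral {0..1} (\<lambda>t. norm (true_poly r B (z + exp (2 * cpi * \<i> * of_real t) * w)))"
proof -
  define Bz where "Bz = (\<lambda>v. exp (- cpi * norm z ^ 2 / 2 - cpi * cnj z * v) * B (z + v))"
  have Bz: "Bz holomorphic_on UNIV"
    unfolding Bz_def by (rule true_poly_shift[OF B])
  have eq: "norm (true_poly r Bz w) = norm (true_poly r B (z + w))" for w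
    unfolding Bz_def by (rule true_poly_shift[OF B])
  note I = true_poly_circle[OF Bz, of r w]
  have "norm (of_real (laguerre r (pi * (norm w)\<^sup>2) * exp (- pi * (norm w)\<^sup>2 / 2)) * true_poly r Bz 0)
      = norm (integral {0..1} (\<lambda>t. true_poly r Bz (exp (2 * cpi * \<i> * of_real t) * w)))"
    using integral_unique[OF I] by simp
  also have "\<dots> \<le> integral {0..1} (\<lambda>t. norm (true_poly r Bz (exp (2 * cpi * \<i> * of_real t) * w)))"
  proof (rule integral_norm_bound_integral)
    show "(\<lambda>t. norm (true_poly r Bz (exp (2 * cpi * \<i> * of_real t) * w))) integrable_on {0..1}"
      by (intro integrable_continuous_interval continuous_on_norm
            continuous_on_compose2[OF true_poly_continuous[OF Bz]] continuous_intros) auto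
  qed (use I in auto)
  finally show ?thesis
    using eq[of 0] by (simp add: eq norm_mult abs_mult)
qed

section \<open>Rotations, discs and the concentration inequality\<close>

lemma nn_integral_shear_fst:
  fixes f :: "real \<times> real \<Rightarrow> ennreal"
  assumes [measurable]: "f \<in> borel_measurable borel"
  shows "(\<integral>\<^sup>+p. f (fst p + c * snd p, snd p) \<partial>lborel) = (\<integral>\<^sup>+p. f p \<partial>lborel)"
proof -
  have [measurable]: "f \<in> borel_measurable (borel \<Otimes>\<^sub>M borel)"
    by (simp add: borel_prod)
  have "(\<integral>\<^sup>+x. f (x + c * y, y) \<partial>lborel) = (\<integral>\<^sup>+x. f (x, y) \<partial>lborel)" for y
    using nn_integral_real_affine[of "\<lambda>x. f (x, y)" 1 "c * y"] by (simp add: add.commute)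
  then show ?thesis
    by (simp add: lborel_prod[symmetric] flip: lborel_pair.nn_integral_snd)
qed

lemma nn_integral_shear_snd:
  fixes f :: "real \<times> real \<Rightarrow> ennreal"
  assumes [measurable]: "f \<in> borel_measurable borel"
  shows "(\<integral>\<^sup>+p. f (fst p, snd p + c * fst p) \<partial>lborel) = (\<integral>\<^sup>+p. f p \<partial>lborel)"
proof -
  have [measurable]: "f \<in> borel_measurable (borel \<Otimes>\<^sub>M borel)"
    by (simp add: borel_prod)
  have "(\<integral>\<^sup>+y. f (x, y + c * x) \<partial>lborel) = (\<integral>\<^sup>+y. f (x, y) \<partial>lborel)" for x
    using nn_integral_real_affine[of "\<lambda>y. f (x, y)" 1 "c * x"] by (simp add: add.commute)
  then show ?thesis
    by (simp add: lborel_prod[symmetric] flip: lborel.nn_integral_fst)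
qed

definition rot :: "real \<Rightarrow> real \<times> real \<Rightarrow> real \<times> real" where
  "rot a p = (cos a * fst p - sin a * snd p, sin a * fst p + cos a * snd p)"

lemma rot_measurable [measurable]: "rot a \<in> borel_measurable borel"
  unfolding rot_def by (intro borel_measurable_continuous_onI continuous_intros)

lemma norm_rot [simp]: "norm (rot a p) = norm p"
proof -
  have "(cos a * x - sin a * y)\<^sup>2 + (sin a * x + cos a * y)\<^sup>2 = ((sin a)\<^sup>2 + (cos a)\<^sup>2) * (x\<^sup>2 + y\<^sup>2)" for x y :: real
    by algebra
  then show ?thesis by (simp add: rot_def norm_prod_def)
qed

text \<open>A rotation through an angle other than \<open>\<pi>\<close> is a product of three shears.\<close>

lemma nn_integral_rot:
  fixes f :: "real \<times> real \<Rightarrow> ennreal"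
  assumes [measurable]: "f \<in> borel_measurable borel"
  shows "(\<integral>\<^sup>+p. f (rot a p) \<partial>lborel) = (\<integral>\<^sup>+p. f p \<partial>lborel)"
proof -
  have *: "(\<integral>\<^sup>+p. f (rot a p) \<partial>lborel) = (\<integral>\<^sup>+p. f p \<partial>lborel)"
    if [measurable]: "f \<in> borel_measurable borel" and a: "cos (a / 2) \<noteq> 0" for f :: "real \<times> real \<Rightarrow> ennreal" and a
  proof -
    define s where "s = sin (a / 2)"
    define c where "c = cos (a / 2)"
    have sc: "s\<^sup>2 + c\<^sup>2 = 1" by (simp add: s_def c_def)
    have sin: "sin a = 2 * s * c" and cos: "cos a = c\<^sup>2 - s\<^sup>2"
      using sin_double[of "a / 2"] cos_double[of "a / 2"] by (simp_all add: s_def c_def)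
    \<comment> \<open>t = -tan(a/2); the rotation is the product of horizontal, vertical and
      horizontal shears by t, sin a and t.\<close>
    define t where "t = - s / c"
    define S where "S p = (fst p + t * snd p, snd p)" for p :: "real \<times> real"
    define V where "V p = (fst p, snd p + sin a * fst p)" for p :: "real \<times> real"
    have c0: "c \<noteq> 0" using a by (simp add: c_def)
    have [measurable]: "S \<in> borel_measurable borel" "V \<in> borel_measurable borel"
      unfolding S_def V_def by (intro borel_measurable_continuous_onI continuous_intros)+
    have shS: "(\<integral>\<^sup>+p. h (S p) \<partial>lborel) = (\<integral>\<^sup>+p. h p \<partial>lborel)"
      if "h \<in> borel_measurable borel" for h :: "real \<times> real \<Rightarrow> ennreal"
      unfolding S_def by (rule nn_integral_shear_fst[OF that])
    have shV: "(\<integral>\<^sup>+p. h (V p) \<partial>lborel) = (\<integral>\<^sup>+p. h p \<partial>lborel)"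
      if "h \<in> borel_measurable borel" for h :: "real \<times> real \<Rightarrow> ennreal"
      unfolding V_def by (rule nn_integral_shear_snd[OF that])
    have e1: "1 + sin a * t = cos a"
    proof -
      have "sin a * t = - 2 * s\<^sup>2" using c0 by (simp add: sin t_def power2_eq_square)
      then show ?thesis using sc by (simp add: cos)
    qed
    have e2: "t + t * cos a = - sin a"
    proof -
      have "t * (1 + cos a) = t * (2 * c\<^sup>2)" using sc by (simp add: cos)
      also have "\<dots> = - sin a" using c0 by (simp add: sin t_def power2_eq_square)
      finally show ?thesis by (simp add: distrib_left)
    qed
    have "rot a p = S (V (S p))" for p
    proof -
      have "snd (V (S p)) = sin a * fst p + (1 + sin a * t) * snd p"
        by (simp add: V_def S_def algebra_simps)
      moreover have "fst (S (V (S p))) = (1 + sin a * t) * fst p + (t + t * (1 + sin a * t)) * snd p"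
        by (simp add: V_def S_def algebra_simps)
      ultimately show ?thesis unfolding e1 e2 by (simp add: rot_def S_def prod_eq_iff)
    qed
    then have "(\<integral>\<^sup>+p. f (rot a p) \<partial>lborel) = (\<integral>\<^sup>+p. f (S (V (S p))) \<partial>lborel)" by simp
    also have "\<dots> = (\<integral>\<^sup>+p. f (S (V p)) \<partial>lborel)"
      by (intro shS) measurable
    also have "\<dots> = (\<integral>\<^sup>+p. f (S p) \<partial>lborel)"
      by (intro shV) measurable
    also have "\<dots> = (\<integral>\<^sup>+p. f p \<partial>lborel)"
      by (intro shS) measurable
    finally show ?thesis .
  qed
  show ?thesis
  proof (cases "cos (a / 2) = 0")
    \<comment> \<open>Here the shear parameter is undefined, so the rotation is done as two half
      rotations; cos(a/4) cannot vanish too, since that would force cos(a/2) = -1.\<close>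
    case True
    then have "cos (a / 2 / 2) \<noteq> 0"
      using cos_double_cos[of "a / 2 / 2"] by auto
    moreover have "rot a p = rot (a / 2) (rot (a / 2) p)" for p
    proof -
      have "sin a = sin (a / 2) * cos (a / 2) + cos (a / 2) * sin (a / 2)"
        "cos a = cos (a / 2) * cos (a / 2) - sin (a / 2) * sin (a / 2)"
        using sin_add[of "a / 2" "a / 2"] cos_add[of "a / 2" "a / 2"] by simp_all
      then show ?thesis
        by (simp only: rot_def fst_conv snd_conv) (simp add: algebra_simps)
    qed
    ultimately show ?thesis
      using *[of "\<lambda>p. f (rot (a / 2) p)" "a / 2"] *[of f "a / 2"] by simp
  qed (use * in auto)
qed

text \<open>The map p \<mapsto> \<pi>|p|^2 sends area on the disc to length on an interval, because
  the disc where its value is at most x has area x. Comparing the image measure with Lebesgue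
  measure on half-lines is enough.\<close>

lemma nn_integral_radial:
  fixes g :: "real \<Rightarrow> ennreal"
  assumes [measurable]: "g \<in> borel_measurable borel" and R: "R > 0"
  shows "(\<integral>\<^sup>+p\<in>ball (0 :: real \<times> real) R. g (pi * (norm p)\<^sup>2) \<partial>lborel) = (\<integral>\<^sup>+t\<in>{0..<pi * R\<^sup>2}. g t \<partial>lborel)"
proof -
  define q where "q p = pi * (norm p)\<^sup>2" for p :: "real \<times> real"
  have [measurable]: "q \<in> borel_measurable borel"
    unfolding q_def by measurable
  define M where "M = distr (density lborel (indicator (ball (0 :: real \<times> real) R))) borel q"
  define N where "N = density lborel (indicator {0..<pi * R\<^sup>2} :: real \<Rightarrow> ennreal)"
  have area: "emeasure lborel (ball (0 :: real \<times> real) R) = ennreal (pi * R\<^sup>2)"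
    using emeasure_ball[of R "0 :: real \<times> real"] R by (simp add: unit_ball_vol_2 power2_eq_square numeral_2_eq_2)
  have M: "emeasure M {x<..} = emeasure lborel (ball 0 R \<inter> {p. x < q p})" for x
  proof -
    have "emeasure M {x<..} = emeasure (density lborel (indicator (ball 0 R))) {p. x < q p}"
      unfolding M_def by (subst emeasure_distr) (auto intro!: arg_cong2[where f = emeasure])
    also have "\<dots> = (\<integral>\<^sup>+p. indicator (ball 0 R) p * indicator {p. x < q p} p \<partial>lborel)"
      by (subst emeasure_density) (auto intro!: borel_measurable_indicator)
    also have "\<dots> = (\<integral>\<^sup>+p. indicator (ball 0 R \<inter> {p. x < q p}) p \<partial>lborel)"
      by (simp add: indicator_inter_arith)
    also have "\<dots> = emeasure lborel (ball 0 R \<inter> {p. x < q p})"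
      by (rule nn_integral_indicator) auto
    finally show ?thesis .
  qed
  have N: "emeasure N {x<..} = emeasure lborel ({0..<pi * R\<^sup>2} \<inter> {x<..})" for x
  proof -
    have "emeasure N {x<..} = (\<integral>\<^sup>+t. indicator {0..<pi * R\<^sup>2} t * indicator {x<..} t \<partial>lborel)"
      unfolding N_def by (subst emeasure_density) (auto intro!: borel_measurable_indicator)
    also have "\<dots> = (\<integral>\<^sup>+t. indicator ({0..<pi * R\<^sup>2} \<inter> {x<..}) t \<partial>lborel)"
      by (simp add: indicator_inter_arith)
    also have "\<dots> = emeasure lborel ({0..<pi * R\<^sup>2} \<inter> {x<..})"
      by (rule nn_integral_indicator) auto
    finally show ?thesis .
  qed
  have "M = N"
  proof (rule measure_eqI_lessThan)
    fix x
    have "emeasure M {x<..} \<le> emeasure lborel (ball (0 :: real \<times> real) R)"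
      unfolding M by (intro emeasure_mono) auto
    then show "emeasure M {x<..} < \<infinity>" using area by (simp add: top.not_eq_extremum order_le_less_trans)
    consider "x < 0" | "0 \<le> x" "x < pi * R\<^sup>2" | "pi * R\<^sup>2 \<le> x" by linarith
    then show "emeasure M {x<..} = emeasure N {x<..}"
    proof cases
      case 1
      have "ball 0 R \<inter> {p. x < q p} = ball 0 R"
        using 1 by (auto simp: q_def intro: less_le_trans)
      moreover have "{0..<pi * R\<^sup>2} \<inter> {x<..} = {0..<pi * R\<^sup>2}" using 1 by auto
      ultimately show ?thesis unfolding M N by (simp add: area)
    next
      case 2
      \<comment> \<open>The radius of the disc of area x.\<close>
      define \<rho> where "\<rho> = sqrt (x / pi)"
      have \<rho>: "\<rho> \<ge> 0" "pi * \<rho>\<^sup>2 = x" using 2 by (auto simp: \<rho>_def)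
      have "\<rho>\<^sup>2 < R\<^sup>2" using 2 \<rho> by (metis mult_less_cancel_left_pos pi_gt_zero)
      then have "\<rho> < R" using R by (meson power_less_imp_less_base less_imp_le)
      have "ball 0 R \<inter> {p. x < q p} = ball 0 R - cball 0 \<rho>"
      proof -
        have "x < q p \<longleftrightarrow> \<rho> < norm p" for p
          unfolding q_def \<rho>(2)[symmetric] using power_mono_iff[OF norm_ge_zero \<rho>(1), of 2 p]
          by (metis mult_less_cancel_left_pos not_le pi_gt_zero pos2)
        then show ?thesis by auto
      qed
      then have "emeasure M {x<..} = emeasure lborel (ball (0 :: real \<times> real) R - cball 0 \<rho>)"
        unfolding M by simp
      also have "\<dots> = emeasure lborel (ball (0 :: real \<times> real) R) - emeasure lborel (cball (0 :: real \<times> real) \<rho>)"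
      proof (rule emeasure_Diff)
        show "emeasure lborel (cball (0 :: real \<times> real) \<rho>) \<noteq> \<infinity>"
          by (simp add: emeasure_cball \<rho>(1))
      qed (use \<open>\<rho> < R\<close> in auto)
      also have "emeasure lborel (cball (0 :: real \<times> real) \<rho>) = ennreal x"
        using emeasure_cball[OF \<rho>(1), of "0 :: real \<times> real"] \<rho>(2)
        by (simp add: unit_ball_vol_2 power2_eq_square)
      also note area
      also have "ennreal (pi * R\<^sup>2) - ennreal x = ennreal (pi * R\<^sup>2 - x)"
        using 2 by (intro ennreal_minus) auto
      finally have "emeasure M {x<..} = ennreal (pi * R\<^sup>2 - x)" .
      moreover have "{0..<pi * R\<^sup>2} \<inter> {x<..} = {x<..<pi * R\<^sup>2}" using 2 by auto
      ultimately show ?thesis unfolding N using 2 by simp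
    next
      case 3
      have "q p < pi * R\<^sup>2" if "p \<in> ball 0 R" for p
        using that by (auto simp: q_def intro!: power_strict_mono)
      then have "ball 0 R \<inter> {p. x < q p} = {}" using 3 by force
      moreover have "{0..<pi * R\<^sup>2} \<inter> {x<..} = {}" using 3 by auto
      ultimately show ?thesis unfolding M N by simp
    qed
  qed (auto simp: M_def N_def)
  have "(\<integral>\<^sup>+p\<in>ball (0 :: real \<times> real) R. g (q p) \<partial>lborel) = (\<integral>\<^sup>+t. g t \<partial>M)"
    unfolding M_def by (simp add: nn_integral_distr nn_integral_density mult.commute borel_measurable_indicator)
  also have "\<dots> = (\<integral>\<^sup>+t\<in>{0..<pi * R\<^sup>2}. g t \<partial>lborel)"
    unfolding \<open>M = N\<close> N_def by (simp add: nn_integral_density mult.commute borel_measurable_indicator)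
  finally show ?thesis by (simp add: q_def)
qed

text \<open>Both the integrand of \<open>A_quant\<close> and the modulus of the factor in the
  circular mean.\<close>

definition laguerre_kernel :: "nat \<Rightarrow> real \<times> real \<Rightarrow> real" where
  "laguerre_kernel r p = \<bar>laguerre r (pi * (norm p)\<^sup>2)\<bar> * exp (- pi * (norm p)\<^sup>2 / 2)"

lemma continuous_laguerre: "continuous_on A (laguerre r)"
  unfolding laguerre_def by (intro continuous_intros) auto

lemma laguerre_kernel_nonneg: "laguerre_kernel r p \<ge> 0"
  by (simp add: laguerre_kernel_def)

lemma laguerre_kernel_measurable [measurable]: "laguerre_kernel r \<in> borel_measurable borel"
  unfolding laguerre_kernel_def
  by (intro borel_measurable_continuous_onI continuous_intros continuous_on_compose2[OF continuous_laguerre[of UNIV]]) auto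

lemma nn_integral_laguerre_kernel_sq:
  assumes R: "R > 0"
  shows "(\<integral>\<^sup>+p\<in>ball 0 R. ennreal (laguerre_kernel r p * laguerre_kernel r p) \<partial>lborel) = ennreal (C_quant r R)"
proof -
  define h where "h t = (laguerre r t)\<^sup>2 * exp (- t)" for t
  have h: "continuous_on A h" for A
    unfolding h_def by (intro continuous_intros continuous_laguerre)
  have [measurable]: "h \<in> borel_measurable borel"
    by (intro borel_measurable_continuous_onI h)
  have "laguerre_kernel r p * laguerre_kernel r p = h (pi * (norm p)\<^sup>2)" for p
  proof -
    have "exp (- pi * (norm p)\<^sup>2 / 2) * exp (- pi * (norm p)\<^sup>2 / 2) = exp (- (pi * (norm p)\<^sup>2))"
      by (simp flip: exp_add)
    then show ?thesis
      unfolding laguerre_kernel_def h_def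
      by (metis (no_types, opaque_lifting) abs_mult_self_eq mult.assoc mult.left_commute power2_eq_square)
  qed
  then have "(\<integral>\<^sup>+p\<in>ball 0 R. ennreal (laguerre_kernel r p * laguerre_kernel r p) \<partial>lborel)
      = (\<integral>\<^sup>+p\<in>ball (0 :: real \<times> real) R. ennreal (h (pi * (norm p)\<^sup>2)) \<partial>lborel)"
    by simp
  also have "\<dots> = (\<integral>\<^sup>+t\<in>{0..<pi * R\<^sup>2}. ennreal (h t) \<partial>lborel)"
    by (rule nn_integral_radial[OF _ R]) measurable
  also have "\<dots> = (\<integral>\<^sup>+t\<in>{0..pi * R\<^sup>2}. ennreal (h t) \<partial>lborel)"
  proof (rule nn_integral_cong_AE)
    have "AE t in lborel. t \<noteq> pi * R\<^sup>2" by (rule AE_lborel_singleton)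
    then show "AE t in lborel. ennreal (h t) * indicator {0..<pi * R\<^sup>2} t = ennreal (h t) * indicator {0..pi * R\<^sup>2} t"
      by eventually_elim (auto simp: indicator_def)
  qed
  also have "\<dots> = ennreal (C_quant r R)"
  proof (rule nn_integral_has_integral_lebesgue')
    show "(h has_integral C_quant r R) {0..pi * R\<^sup>2}"
      unfolding C_quant_def h_def[symmetric]
      by (intro integrable_integral integrable_continuous_interval h)
  qed (simp add: h_def)
  finally show ?thesis .
qed

section \<open>The disc inequality and the concentration estimate\<close>

lemma nn_integral_shift:
  fixes f :: "real \<times> real \<Rightarrow> ennreal"
  assumes [measurable]: "f \<in> borel_measurable borel"
  shows "(\<integral>\<^sup>+p. f (z + p) \<partial>lborel) = (\<integral>\<^sup>+p. f p \<partial>lborel)"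
proof -
  have "(\<integral>\<^sup>+p. f p \<partial>lborel) = (\<integral>\<^sup>+p. f p \<partial>distr lborel borel ((+) z))"
    by (simp add: lborel_distr_plus)
  also have "\<dots> = (\<integral>\<^sup>+p. f (z + p) \<partial>lborel)"
    by (subst nn_integral_distr) auto
  finally show ?thesis by simp
qed

text \<open>The modulus of the transform up to \<open>hermite_const\<close>, with the point (x,
  \<xi>) of the time-frequency plane read as x - i\<xi>.\<close>

definition poly_abs :: "nat \<Rightarrow> (complex \<Rightarrow> complex) \<Rightarrow> real \<times> real \<Rightarrow> real" where
  "poly_abs r B p = norm (true_poly r B (Complex (fst p) (- snd p)))"

lemma poly_abs_nonneg: "poly_abs r B p \<ge> 0"
  by (simp add: poly_abs_def)

lemma poly_abs_continuous:
  assumes "B holomorphic_on UNIV"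
  shows "continuous_on UNIV (poly_abs r B)"
  unfolding poly_abs_def Complex_eq
  by (intro continuous_on_norm continuous_on_compose2[OF true_poly_continuous[OF assms]] continuous_intros) auto

lemma poly_abs_kernel_bound:
  assumes B: "B holomorphic_on UNIV"
  shows "ennreal (laguerre_kernel r w * poly_abs r B z)
    \<le> (\<integral>\<^sup>+t\<in>{0..1}. ennreal (poly_abs r B (z + rot (- (2 * pi * t)) w)) \<partial>lborel)"
proof -
  define Cx where "Cx p = Complex (fst p) (- snd p)" for p
  define I where "I = integral {0..1} (\<lambda>t. poly_abs r B (z + rot (- (2 * pi * t)) w))"
  \<comment> \<open>Since (x, \<xi>) is identified with x - i\<xi>, orientation is reversed:
    multiplication by exp(2\<pi>it) rotates the plane through -2\<pi>t.\<close>
  have rot_eq: "Cx z + exp (2 * cpi * \<i> * of_real t) * Cx w = Cx (z + rot (- (2 * pi * t)) w)" for t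
  proof -
    have "exp (2 * cpi * \<i> * of_real t) = cis (2 * pi * t)"
      by (simp add: cis_conv_exp mult_ac)
    then show ?thesis by (simp add: Cx_def rot_def complex_eq_iff)
  qed
  have "norm (Cx w) = norm w" by (simp add: Cx_def norm_prod_def cmod_def)
  then have le: "laguerre_kernel r w * poly_abs r B z \<le> I"
    using true_poly_circle_bound[OF B, of r "Cx w" "Cx z"]
    unfolding rot_eq I_def laguerre_kernel_def poly_abs_def Cx_def[symmetric] by simp
  have cont: "continuous_on {0..1} (\<lambda>t. poly_abs r B (z + rot (- (2 * pi * t)) w))"
    unfolding rot_def
    by (intro continuous_on_compose2[OF poly_abs_continuous[OF B]] continuous_intros) auto
  then have "((\<lambda>t. poly_abs r B (z + rot (- (2 * pi * t)) w)) has_integral I) {0..1}"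
    unfolding I_def by (intro integrable_integral integrable_continuous_interval)
  then have "(\<integral>\<^sup>+t\<in>{0..1}. ennreal (poly_abs r B (z + rot (- (2 * pi * t)) w)) \<partial>lborel) = ennreal I"
    by (intro nn_integral_has_integral_lebesgue') (simp_all add: poly_abs_nonneg)
  then show ?thesis using le by (simp add: ennreal_leI)
qed

lemma rot_measurable_pair [measurable (raw)]:
  assumes [measurable]: "f \<in> borel_measurable M" "g \<in> borel_measurable M"
  shows "(\<lambda>x. rot (f x) (g x)) \<in> borel_measurable M"
  by (rule borel_measurable_continuous_Pair[OF assms])
     (simp only: rot_def, intro continuous_intros)

lemma indicator_ball_measurable [measurable]:
  "(indicator (ball z R) :: 'a::metric_space \<Rightarrow> ennreal) \<in> borel_measurable borel"
  by (intro borel_measurable_indicator) auto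

text \<open>The circular bound is multiplied by the kernel and integrated over the disc. Kernel,
  disc and measure are all rotation invariant, so after Tonelli the inner integral does not depend
  on the angle and the mean over \<open>t\<close> disappears.\<close>

lemma poly_abs_disc_bound:
  assumes B: "B holomorphic_on UNIV" and R: "R > 0"
  shows "ennreal (C_quant r R) * ennreal (poly_abs r B z)
    \<le> (\<integral>\<^sup>+w\<in>ball z R. ennreal (laguerre_kernel r (z - w)) * ennreal (poly_abs r B w) \<partial>lborel)"
proof -
  have Q [measurable]: "poly_abs r B \<in> borel_measurable borel"
    by (intro borel_measurable_continuous_onI poly_abs_continuous B)
  define K where "K w = ennreal (laguerre_kernel r w) * indicator (ball 0 R) w" for w :: "real \<times> real"
  have K [measurable]: "K \<in> borel_measurable borel" unfolding K_def by measurable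
  have K_rot: "K (rot a w) = K w" for a w
    by (simp add: K_def laguerre_kernel_def indicator_def)
  define S where "S t = (\<integral>\<^sup>+w. K w * ennreal (poly_abs r B (z + rot (- (2 * pi * t)) w)) \<partial>lborel)" for t
  have S: "S t = (\<integral>\<^sup>+w. K w * ennreal (poly_abs r B (z + w)) \<partial>lborel)" for t
  proof -
    have "S t = (\<integral>\<^sup>+w. (\<lambda>p. K p * ennreal (poly_abs r B (z + p))) (rot (- (2 * pi * t)) w) \<partial>lborel)"
      by (simp add: S_def K_rot)
    also have "\<dots> = (\<integral>\<^sup>+w. K w * ennreal (poly_abs r B (z + w)) \<partial>lborel)"
      by (rule nn_integral_rot) measurable
    finally show ?thesis .
  qed
  \<comment> \<open>One kernel factor is the chosen weight, the other comes from the circular bound;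
    the integral of their product over the disc is \<open>C_quant r R\<close>.\<close>
  have "ennreal (C_quant r R) * ennreal (poly_abs r B z)
      = (\<integral>\<^sup>+w. K w * ennreal (laguerre_kernel r w * poly_abs r B z) \<partial>lborel)"
  proof -
    have "(\<integral>\<^sup>+w. K w * ennreal (laguerre_kernel r w * poly_abs r B z) \<partial>lborel)
      = (\<integral>\<^sup>+w. ennreal (laguerre_kernel r w * laguerre_kernel r w) * indicator (ball 0 R) w * ennreal (poly_abs r B z) \<partial>lborel)"
      by (intro nn_integral_cong)
         (simp add: K_def ennreal_mult laguerre_kernel_nonneg poly_abs_nonneg mult_ac)
    also have "\<dots> = ennreal (C_quant r R) * ennreal (poly_abs r B z)"
      by (subst nn_integral_multc) (simp_all add: nn_integral_laguerre_kernel_sq[OF R])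
    finally show ?thesis by simp
  qed
  also have "\<dots> \<le> (\<integral>\<^sup>+w. K w * (\<integral>\<^sup>+t. ennreal (poly_abs r B (z + rot (- (2 * pi * t)) w)) * indicator {0..1} t \<partial>lborel) \<partial>lborel)"
    by (intro nn_integral_mono mult_left_mono poly_abs_kernel_bound B) auto
  also have "\<dots> = (\<integral>\<^sup>+w. \<integral>\<^sup>+t. K w * (ennreal (poly_abs r B (z + rot (- (2 * pi * t)) w)) * indicator {0..1} t) \<partial>lborel \<partial>lborel)"
    by (subst nn_integral_cmult[symmetric]) (auto simp: case_prod_beta)
  also have "\<dots> = (\<integral>\<^sup>+t. \<integral>\<^sup>+w. K w * (ennreal (poly_abs r B (z + rot (- (2 * pi * t)) w)) * indicator {0..1} t) \<partial>lborel \<partial>lborel)"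
    by (rule lborel_pair.Fubini') measurable
  also have "\<dots> = (\<integral>\<^sup>+t. S t * indicator {0..1} t \<partial>lborel)"
    unfolding S_def by (subst nn_integral_multc[symmetric]) (auto simp: mult.assoc)
  also have "\<dots> = (\<integral>\<^sup>+w. K w * ennreal (poly_abs r B (z + w)) \<partial>lborel)"
    unfolding S by (simp add: nn_integral_cmult)
  also have "\<dots> = (\<integral>\<^sup>+w. K (z - (z + w)) * ennreal (poly_abs r B (z + w)) \<partial>lborel)"
    by (simp add: K_def laguerre_kernel_def indicator_def)
  also have "\<dots> = (\<integral>\<^sup>+w. K (z - w) * ennreal (poly_abs r B w) \<partial>lborel)"
    by (rule nn_integral_shift[where f = "\<lambda>w. K (z - w) * ennreal (poly_abs r B w)"]) measurable
  also have "\<dots> = (\<integral>\<^sup>+w\<in>ball z R. ennreal (laguerre_kernel r (z - w)) * ennreal (poly_abs r B w) \<partial>lborel)"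
    by (intro nn_integral_cong) (simp add: K_def indicator_def dist_norm norm_minus_commute mult_ac)
  finally show ?thesis .
qed

text \<open>A Schur test in L^1. Integrating the disc inequality over \<Delta> and exchanging the
  integrals recentres the symmetric kernel at the other variable, and the inner integral becomes one
  of those over which \<open>A_quant\<close> is the supremum.\<close>

lemma poly_abs_concentration:
  assumes B: "B holomorphic_on UNIV" and R: "R > 0" and \<Delta>: "\<Delta> \<in> sets lebesgue"
  shows "ennreal (C_quant r R) * (\<integral>\<^sup>+z\<in>\<Delta>. ennreal (poly_abs r B z) \<partial>lebesgue)
    \<le> A_quant r \<Delta> R * (\<integral>\<^sup>+z. ennreal (poly_abs r B z) \<partial>lebesgue)"
proof -
  have Q [measurable]: "poly_abs r B \<in> borel_measurable borel"
    by (intro borel_measurable_continuous_onI poly_abs_continuous B)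
  \<comment> \<open>A Borel set that agrees with \<Delta> almost everywhere, so that the Borel form
    of Tonelli's theorem applies.\<close>
  define \<Delta>' where "\<Delta>' = main_part lborel \<Delta>"
  have \<Delta>' [measurable]: "\<Delta>' \<in> sets borel"
    using main_part_sets[OF \<Delta>] by (simp add: \<Delta>'_def)
  have AE: "AE x in lborel. x \<in> \<Delta>' \<longleftrightarrow> x \<in> \<Delta>"
    unfolding \<Delta>'_def by (rule AE_in_main_part[OF \<Delta>])
  define k where "k z w = ennreal (laguerre_kernel r (z - w)) * indicator (ball z R) w" for z w :: "real \<times> real"
  have k_sym: "k z w = k w z" for z w
    unfolding k_def laguerre_kernel_def indicator_def mem_ball dist_norm
    by (simp only: norm_minus_commute)
  have "case_prod k = (\<lambda>p. ennreal (laguerre_kernel r (fst p - snd p)) * indicator (ball 0 R) (fst p - snd p))"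
    by (simp add: fun_eq_iff k_def indicator_def dist_norm norm_minus_commute)
  then have k [measurable]: "case_prod k \<in> borel_measurable (borel \<Otimes>\<^sub>M borel)"
    by simp
  have A: "(\<integral>\<^sup>+z. k w z * indicator \<Delta>' z \<partial>lborel) \<le> A_quant r \<Delta> R" for w
  proof -
    have "(\<integral>\<^sup>+z. k w z * indicator \<Delta>' z \<partial>lborel)
        = (\<integral>\<^sup>+z\<in>\<Delta> \<inter> ball w R. ennreal (laguerre_kernel r (w - z)) \<partial>lborel)"
      by (rule nn_integral_cong_AE) (use AE in eventually_elim, auto simp: k_def indicator_def)
    also have "\<dots> \<le> A_quant r \<Delta> R"
      unfolding A_quant_def laguerre_kernel_def nn_integral_completion by (rule SUP_upper) simp
    finally show ?thesis .
  qed
  have "ennreal (C_quant r R) * (\<integral>\<^sup>+z\<in>\<Delta>. ennreal (poly_abs r B z) \<partial>lebesgue)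
      = ennreal (C_quant r R) * (\<integral>\<^sup>+z\<in>\<Delta>'. ennreal (poly_abs r B z) \<partial>lborel)"
    unfolding nn_integral_completion
    by (intro arg_cong2[where f = "(*)"] refl nn_integral_cong_AE) (use AE in eventually_elim, auto simp: indicator_def)
  also have "\<dots> = (\<integral>\<^sup>+z. ennreal (C_quant r R) * ennreal (poly_abs r B z) * indicator \<Delta>' z \<partial>lborel)"
    by (subst nn_integral_cmult[symmetric]) (auto simp: mult.assoc)
  also have "\<dots> \<le> (\<integral>\<^sup>+z. (\<integral>\<^sup>+w. k z w * ennreal (poly_abs r B w) \<partial>lborel) * indicator \<Delta>' z \<partial>lborel)"
  proof (intro nn_integral_mono mult_right_mono)
    fix z
    show "ennreal (C_quant r R) * ennreal (poly_abs r B z) \<le> (\<integral>\<^sup>+w. k z w * ennreal (poly_abs r B w) \<partial>lborel)"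
      using poly_abs_disc_bound[OF B R, of r z] by (simp add: k_def mult_ac)
  qed auto
  also have "\<dots> = (\<integral>\<^sup>+z. \<integral>\<^sup>+w. k z w * ennreal (poly_abs r B w) * indicator \<Delta>' z \<partial>lborel \<partial>lborel)"
    by (subst nn_integral_multc[symmetric]) auto
  also have "\<dots> = (\<integral>\<^sup>+w. \<integral>\<^sup>+z. k z w * ennreal (poly_abs r B w) * indicator \<Delta>' z \<partial>lborel \<partial>lborel)"
    by (rule lborel_pair.Fubini') measurable
  also have "\<dots> = (\<integral>\<^sup>+w. \<integral>\<^sup>+z. (k w z * indicator \<Delta>' z) * ennreal (poly_abs r B w) \<partial>lborel \<partial>lborel)"
    by (simp add: k_sym mult_ac)
  also have "\<dots> = (\<integral>\<^sup>+w. (\<integral>\<^sup>+z. k w z * indicator \<Delta>' z \<partial>lborel) * ennreal (poly_abs r B w) \<partial>lborel)"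
    by (subst nn_integral_multc) auto
  also have "\<dots> \<le> (\<integral>\<^sup>+w. A_quant r \<Delta> R * ennreal (poly_abs r B w) \<partial>lborel)"
    by (intro nn_integral_mono mult_right_mono A) auto
  also have "\<dots> = A_quant r \<Delta> R * (\<integral>\<^sup>+z. ennreal (poly_abs r B z) \<partial>lebesgue)"
    unfolding nn_integral_completion by (rule nn_integral_cmult) auto
  finally show ?thesis .
qed

section \<open>Injectivity of the short-time Fourier transform\<close>

text \<open>On \<open>|v| = \<rho>\<close> one has \<open>v\<^sup>r cnj(v)\<^sup>k = \<rho>\<^sup>2\<^sup>k v\<^sup>r\<^sup>-\<^sup>k\<close>, which turns the polyanalytic function into a
  holomorphic one; the maximum principle kills the latter inside the disc, and varying \<open>\<rho>\<close>
  separates the coefficients.\<close>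

lemma true_poly_eq_0_imp:
  assumes B: "B holomorphic_on UNIV" and zero: "\<And>w. true_poly r B w = 0"
  shows "B w = 0"
proof -
  define c where "c k v = of_nat (r choose k) * (- cpi) ^ k * v ^ (r - k) * (deriv ^^ (r - k)) B v" for k v
  define H where "H \<rho> v = (\<Sum>k\<le>r. c k v * (of_real (\<rho>\<^sup>2)) ^ k)" for \<rho> v
  have H_hol: "H \<rho> holomorphic_on UNIV" for \<rho>
    unfolding H_def c_def by (intro holomorphic_intros holomorphic_higher_deriv B open_UNIV)
  have H_sphere: "H \<rho> v = 0" if "norm v = \<rho>" for \<rho> v
  proof -
    have "of_real (\<rho>\<^sup>2) = v * cnj v" using that complex_norm_square[of v] by simp
    then have "c k v * of_real (\<rho>\<^sup>2) ^ k
        = v ^ r * (of_nat (r choose k) * (- cpi * cnj v) ^ k * (deriv ^^ (r - k)) B v)" if "k \<le> r" for k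
      using that power_add[of v k "r - k"] unfolding c_def
      by (simp only: power_mult_distrib le_add_diff_inverse) (simp only: mult_ac)
    then have "H \<rho> v = v ^ r * (\<Sum>k\<le>r. of_nat (r choose k) * (- cpi * cnj v) ^ k * (deriv ^^ (r - k)) B v)"
      unfolding H_def sum_distrib_left by (intro sum.cong) auto
    moreover have "(\<Sum>k\<le>r. of_nat (r choose k) * (- cpi * cnj v) ^ k * (deriv ^^ (r - k)) B v) = 0"
      using zero[of v] unfolding true_poly_eq[OF B] by simp
    ultimately show ?thesis by simp
  qed
  have H_zero: "H \<rho> w = 0" if "norm w < \<rho>" for \<rho>
  proof -
    have "norm (H \<rho> w) \<le> 0"
    proof (rule maximum_modulus_frontier[where S = "cball 0 \<rho>" and f = "H \<rho>"])
      show "H \<rho> holomorphic_on interior (cball 0 \<rho>)" using H_hol holomorphic_on_subset by blast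
      show "continuous_on (closure (cball 0 \<rho>)) (H \<rho>)"
        using H_hol holomorphic_on_imp_continuous_on continuous_on_subset by blast
      fix z assume "z \<in> frontier (cball (0 :: complex) \<rho>)"
      then show "norm (H \<rho> z) \<le> 0" using H_sphere[of z \<rho>] by auto
    qed (use that in auto)
    then show ?thesis by simp
  qed
  have "infinite {x. (\<Sum>k\<le>r. c k w * x ^ k) = 0}"
  proof
    assume fin: "finite {x. (\<Sum>k\<le>r. c k w * x ^ k) = 0}"
    have "inj_on (\<lambda>\<rho>::real. complex_of_real (\<rho>\<^sup>2)) {norm w<..}"
    proof (rule inj_onI)
      fix x y assume "x \<in> {norm w<..}" "y \<in> {norm w<..}" "complex_of_real (x\<^sup>2) = complex_of_real (y\<^sup>2)"
      then have "x\<^sup>2 = y\<^sup>2" "x \<ge> 0" "y \<ge> 0"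
        using norm_ge_zero[of w] by (simp_all only: of_real_eq_iff greaterThan_iff)
      then show "x = y" by (simp add: power2_eq_iff_nonneg)
    qed
    moreover have "(\<lambda>\<rho>::real. complex_of_real (\<rho>\<^sup>2)) ` {norm w<..} \<subseteq> {x. (\<Sum>k\<le>r. c k w * x ^ k) = 0}"
      using H_zero by (auto simp: H_def)
    ultimately have "finite {norm w<..}"
      using fin by (blast dest: finite_subset finite_imageD)
    then show False using infinite_Ioi by blast
  qed
  \<comment> \<open>The coefficient for k = r is (-\<pi>)^r B(w): the power of w in it and the order
    of its derivative are both 0.\<close>
  then have "c r w = 0" using polyfun_finite_roots[of "\<lambda>k. c k w" r] by blast
  then show ?thesis by (simp add: c_def)
qed

text \<open>Vanishing at the width \<open>- cpi\<close> for all \<open>b\<close> gives, by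
  differentiation in \<open>b\<close>, vanishing against all powers t^k. The even powers are the
  derivatives in \<open>a\<close> at \<open>- cpi\<close>, because d/da multiplies by t^2, so the
  identity theorem on the half-plane Re a < 0 reaches every width.\<close>

lemma bargmann_eq_0_imp:
  assumes T: "T \<in> tempered_distributions" and zero: "\<And>w. bargmann T w = 0" and a: "Re a < 0"
  shows "T (gauss a b 0) = 0"
proof -
  have base: "T (gauss (- cpi) b k) = 0" for b k
  proof (induction k arbitrary: b)
    case 0
    show ?case using zero[of "b / (2 * cpi)"] unfolding bargmann_def by simp
  next
    case (Suc k)
    have "((\<lambda>b. T (gauss (- cpi) b k)) has_field_derivative T (gauss (- cpi) b (k + 1))) (at b)"
      by (rule tempered_gauss_DERIV_lin[OF T]) simp
    then have "((\<lambda>b. 0) has_field_derivative T (gauss (- cpi) b (k + 1))) (at b)"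
      unfolding Suc .
    then show ?case using DERIV_unique[OF DERIV_const] by (metis Suc_eq_plus1)
  qed
  define S where "S = {a :: complex. Re a < 0}"
  define F where "F = (\<lambda>a. T (gauss a b 0))"
  have S: "open S" "connected S"
    unfolding S_def by (simp_all add: open_halfspace_Re_lt convex_connected convex_halfspace_Re_lt)
  have D: "((\<lambda>a. T (gauss a b k)) has_field_derivative T (gauss a b (k + 2))) (at a)" if "a \<in> S" for a k
    using tempered_gauss_DERIV_quad[OF T] that by (simp add: S_def)
  have hd: "\<forall>a\<in>S. (deriv ^^ n) F a = T (gauss a b (2 * n))" for n
  proof (induction n)
    case (Suc n)
    show ?case
    proof
      fix a assume a: "a \<in> S"
      have "(deriv ^^ Suc n) F a = deriv (\<lambda>a. T (gauss a b (2 * n))) a"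
        unfolding funpow.simps o_def
        by (rule deriv_cong_ev[OF _ refl]) (use Suc eventually_nhds_in_open[OF S(1) a] in \<open>auto elim: eventually_mono\<close>)
      also have "\<dots> = T (gauss a b (2 * n + 2))" by (rule DERIV_imp_deriv[OF D[OF a]])
      finally show "(deriv ^^ Suc n) F a = T (gauss a b (2 * Suc n))" by simp
    qed
  qed (simp add: F_def)
  have "F a = 0"
  proof (rule holomorphic_fun_eq_0_on_connected[where f = F and z = "- cpi", OF _ S])
    show "F holomorphic_on S"
      unfolding F_def holomorphic_on_open[OF S(1)] using D by blast
    show "(deriv ^^ n) F (- cpi) = 0" for n
      using hd[of n] base by (simp add: S_def)
  qed (use a in \<open>auto simp: S_def\<close>)
  then show ?thesis by (simp add: F_def)
qed

text \<open>A Peetre type inequality. It motivates replacing |t|^i by the weight (1 + |t|)^i from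
  here on: this weight is submultiplicative under translation.\<close>

lemma weight_le:
  fixes t s :: real
  assumes "\<bar>y - t\<bar> \<le> \<bar>s\<bar>"
  shows "(1 + \<bar>t\<bar>) ^ i \<le> (1 + \<bar>s\<bar>) ^ i * (1 + \<bar>y\<bar>) ^ i"
proof -
  have "1 + \<bar>t\<bar> \<le> 1 + \<bar>s\<bar> + \<bar>y\<bar>" using assms by linarith
  also have "\<dots> \<le> (1 + \<bar>s\<bar>) * (1 + \<bar>y\<bar>)" by (simp add: algebra_simps)
  finally show ?thesis
    by (metis abs_ge_zero add_nonneg_nonneg power_mono power_mult_distrib zero_le_one)
qed

lemma schwartz_weighted_bound:
  assumes "\<phi> \<in> schwartz"
  shows "\<exists>M\<ge>0. \<forall>t. (1 + \<bar>t\<bar>) ^ i * norm (nth_vderiv j \<phi> t) \<le> M"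
proof -
  obtain M0 where M0: "M0 \<ge> 0" "\<And>t. \<bar>t\<bar> ^ 0 * norm (nth_vderiv j \<phi> t) \<le> M0"
    using schwartz_bounded[OF assms, of 0 j] by blast
  obtain M1 where M1: "M1 \<ge> 0" "\<And>t. \<bar>t\<bar> ^ i * norm (nth_vderiv j \<phi> t) \<le> M1"
    using schwartz_bounded[OF assms, of i j] by blast
  have "(1 + \<bar>t\<bar>) ^ i * norm (nth_vderiv j \<phi> t) \<le> 2 ^ i * (M0 + M1)" for t
  proof -
    have "(1 + \<bar>t\<bar>) ^ i \<le> (2 * max 1 \<bar>t\<bar>) ^ i" by (intro power_mono) auto
    also have "\<dots> \<le> 2 ^ i * (1 + \<bar>t\<bar> ^ i)"
      by (simp add: power_mult_distrib max_def)
    finally have "(1 + \<bar>t\<bar>) ^ i * norm (nth_vderiv j \<phi> t) \<le> 2 ^ i * (1 + \<bar>t\<bar> ^ i) * norm (nth_vderiv j \<phi> t)"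
      by (rule mult_right_mono) simp
    also have "\<dots> = 2 ^ i * (\<bar>t\<bar> ^ 0 * norm (nth_vderiv j \<phi> t) + \<bar>t\<bar> ^ i * norm (nth_vderiv j \<phi> t))"
      by (simp add: algebra_simps)
    also have "\<dots> \<le> 2 ^ i * (M0 + M1)"
      by (intro mult_left_mono add_mono M0 M1) auto
    finally show ?thesis .
  qed
  then show ?thesis using M0 M1 by (intro exI[of _ "2 ^ i * (M0 + M1)"]) auto
qed

lemma schwartz_weighted_bound_uniform:
  assumes "\<phi> \<in> schwartz"
  shows "\<exists>M\<ge>0. \<forall>j\<le>n. \<forall>t. (1 + \<bar>t\<bar>) ^ i * norm (nth_vderiv j \<phi> t) \<le> M"
proof -
  obtain M where M: "\<And>j. M j \<ge> 0" "\<And>j t. (1 + \<bar>t\<bar>) ^ i * norm (nth_vderiv j \<phi> t) \<le> M j"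
    using schwartz_weighted_bound[OF assms, of i] by metis
  have "M j \<le> sum M {..n}" if "j \<le> n" for j
    using that M(1) by (intro member_le_sum) auto
  then have "\<forall>j\<le>n. \<forall>t. (1 + \<bar>t\<bar>) ^ i * norm (nth_vderiv j \<phi> t) \<le> sum M {..n}"
    using M(2) by (meson order_trans)
  moreover have "sum M {..n} \<ge> 0" using M(1) by (simp add: sum_nonneg)
  ultimately show ?thesis by blast
qed

lemma tempered_weighted_bound:
  assumes "T \<in> tempered_distributions"
  obtains C n where "C \<ge> 0"
    "\<And>\<phi> M. \<phi> \<in> schwartz \<Longrightarrow>
      (\<And>j t. j \<le> n \<Longrightarrow> (1 + \<bar>t\<bar>) ^ n * norm (nth_vderiv j \<phi> t) \<le> M) \<Longrightarrow> norm (T \<phi>) \<le> C * M"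
proof -
  obtain C n where C: "C \<ge> 0" "\<And>\<phi> M. \<phi> \<in> schwartz \<Longrightarrow>
      (\<And>i j t. i \<le> n \<Longrightarrow> j \<le> n \<Longrightarrow> \<bar>t\<bar> ^ i * norm (nth_vderiv j \<phi> t) \<le> M) \<Longrightarrow> norm (T \<phi>) \<le> C * M"
    using tempered_bound[OF assms] by metis
  show ?thesis
  proof (rule that[of C n])
    fix \<phi> M assume \<phi>: "\<phi> \<in> schwartz"
      and M: "\<And>j t. j \<le> n \<Longrightarrow> (1 + \<bar>t\<bar>) ^ n * norm (nth_vderiv j \<phi> t) \<le> M"
    show "norm (T \<phi>) \<le> C * M"
    proof (rule C(2)[OF \<phi>])
      fix i j :: nat and t :: real assume ij: "i \<le> n" "j \<le> n"
      have "\<bar>t\<bar> ^ i \<le> (1 + \<bar>t\<bar>) ^ i" by (intro power_mono) auto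
      also have "\<dots> \<le> (1 + \<bar>t\<bar>) ^ n" using ij by (intro power_increasing) auto
      finally have "\<bar>t\<bar> ^ i * norm (nth_vderiv j \<phi> t) \<le> (1 + \<bar>t\<bar>) ^ n * norm (nth_vderiv j \<phi> t)"
        by (rule mult_right_mono) simp
      then show "\<bar>t\<bar> ^ i * norm (nth_vderiv j \<phi> t) \<le> M" using M[OF ij(2)] by (rule order_trans)
    qed
  qed (rule C)
qed

section \<open>Convolution with rapidly decaying functions\<close>

lemma vector_derivative_bound:
  fixes g :: "real \<Rightarrow> complex"
  assumes "\<And>x. (g has_vector_derivative g' x) (at x)"
    and "\<And>x. x \<in> closed_segment a b \<Longrightarrow> norm (g' x) \<le> M"
  shows "norm (g b - g a) \<le> M * \<bar>b - a\<bar>"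
proof -
  have "norm (g b - g a) \<le> M * norm (b - a)"
  proof (rule differentiable_bound[where S = "closed_segment a b"])
    show "(g has_derivative (\<lambda>h. h *\<^sub>R g' x)) (at x within closed_segment a b)" for x
      using assms(1)[of x] unfolding has_vector_derivative_def by (rule has_derivative_at_withinI)
    show "onorm (\<lambda>h. h *\<^sub>R g' x) \<le> M" if "x \<in> closed_segment a b" for x
      using assms(2)[OF that] by (intro onorm_le) (auto simp: mult.commute[of M] intro: mult_left_mono)
  qed auto
  then show ?thesis by simp
qed

lemma schwartz_vderiv_continuous: "\<phi> \<in> schwartz \<Longrightarrow> continuous_on A (nth_vderiv j \<phi>)"
  by (meson continuous_at_imp_continuous_on has_vector_derivative_continuous schwartz_has_vderiv)

lemma schwartz_vderiv_measurable: "\<phi> \<in> schwartz \<Longrightarrow> nth_vderiv j \<phi> \<in> borel_measurable borel"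
  by (intro borel_measurable_continuous_onI schwartz_vderiv_continuous)

lemma schwartz_measurable: "\<phi> \<in> schwartz \<Longrightarrow> \<phi> \<in> borel_measurable borel"
  using schwartz_vderiv_measurable[of \<phi> 0] by simp

lemma integrable_inverse_1_plus_square: "integrable lborel (\<lambda>x::real. 1 / (1 + x\<^sup>2))"
proof -
  define f where "f x = 1 / (1 + x\<^sup>2)" for x :: real
  have f0: "f x \<ge> 0" for x by (simp add: f_def)
  have [measurable]: "f \<in> borel_measurable borel" unfolding f_def by measurable
  have pos: "(\<integral>\<^sup>+x. ennreal (f x) * indicator {0..} x \<partial>lborel) = ennreal (pi / 2)"
  proof -
    have "(arctan has_real_derivative f x) (at x)" for x
      using DERIV_arctan[of x] by (simp add: f_def inverse_eq_divide)
    then show ?thesis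
      using nn_integral_FTC_atLeast[of f 0 arctan "pi / 2"] tendsto_arctan_at_top f0 by simp
  qed
  have neg: "(\<integral>\<^sup>+x. ennreal (f x) * indicator {..0} x \<partial>lborel) = ennreal (pi / 2)"
    unfolding pos[symmetric]
    by (subst nn_integral_real_affine[where c = "-1" and t = 0]) (auto simp: f_def indicator_def)
  have "(\<integral>\<^sup>+x. ennreal (f x) \<partial>lborel)
      \<le> (\<integral>\<^sup>+x. ennreal (f x) * indicator {0..} x + ennreal (f x) * indicator {..0} x \<partial>lborel)"
    by (intro nn_integral_mono) (auto simp: indicator_def)
  also have "\<dots> = ennreal (pi / 2) + ennreal (pi / 2)"
    by (subst nn_integral_add) (auto simp: pos neg)
  also have "\<dots> < \<infinity>" by simp
  finally have "(\<integral>\<^sup>+x. ennreal (norm (f x)) \<partial>lborel) < \<infinity>" using f0 by simp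
  then show ?thesis unfolding f_def[symmetric] by (intro integrableI_bounded) auto
qed

text \<open>Decay in the mean without smoothness. Schwartz functions cut off by an indicator still
  belong to this class, and such truncations are what the averaging arguments below need.\<close>

definition rapid :: "(real \<Rightarrow> complex) \<Rightarrow> bool" where
  "rapid f \<longleftrightarrow> f \<in> borel_measurable borel \<and> (\<forall>i. integrable lborel (\<lambda>s. (1 + \<bar>s\<bar>) ^ i * norm (f s)))"

lemma rapid_integrable:
  assumes "rapid f"
  shows "integrable lborel f"
proof -
  have "f \<in> borel_measurable lborel" "integrable lborel (\<lambda>s. (1 + \<bar>s\<bar>) ^ 0 * norm (f s))"
    using assms unfolding rapid_def by (auto simp del: power_0)
  then show ?thesis by (simp add: integrable_norm_iff)
qed

lemma schwartz_rapid:
  assumes \<phi>: "\<phi> \<in> schwartz"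
  shows "rapid \<phi>"
  unfolding rapid_def
proof (intro conjI allI)
  show [measurable]: "\<phi> \<in> borel_measurable borel" by (rule schwartz_measurable[OF \<phi>])
  fix i
  \<comment> \<open>The two extra powers of the weight leave an integrable majorant 1/(1 +
    s^2).\<close>
  obtain M where M: "M \<ge> 0" "\<And>t. (1 + \<bar>t\<bar>) ^ (i + 2) * norm (nth_vderiv 0 \<phi> t) \<le> M"
    using schwartz_weighted_bound[OF \<phi>] by blast
  show "integrable lborel (\<lambda>s. (1 + \<bar>s\<bar>) ^ i * norm (\<phi> s))"
  proof (rule Bochner_Integration.integrable_bound)
    show "integrable lborel (\<lambda>s. M * (1 / (1 + s\<^sup>2)))"
      by (intro integrable_mult_right integrable_inverse_1_plus_square)
    show "AE s in lborel. norm ((1 + \<bar>s\<bar>) ^ i * norm (\<phi> s)) \<le> norm (M * (1 / (1 + s\<^sup>2)))"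
    proof (rule AE_I2)
      fix s :: real
      have "(1 + s\<^sup>2) * ((1 + \<bar>s\<bar>) ^ i * norm (\<phi> s)) \<le> (1 + \<bar>s\<bar>)\<^sup>2 * ((1 + \<bar>s\<bar>) ^ i * norm (\<phi> s))"
        by (intro mult_right_mono) (auto simp: power2_sum)
      also have "\<dots> \<le> M" using M(2)[of s] unfolding power_add nth_vderiv_0 by (simp only: mult_ac)
      finally have "(1 + \<bar>s\<bar>) ^ i * norm (\<phi> s) \<le> M / (1 + s\<^sup>2)"
        by (simp add: pos_le_divide_eq add_pos_nonneg mult.commute)
      then show "norm ((1 + \<bar>s\<bar>) ^ i * norm (\<phi> s)) \<le> norm (M * (1 / (1 + s\<^sup>2)))"
        using M(1) by (simp add: abs_mult)
    qed
  qed measurable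
qed

lemma rapid_indicator:
  assumes "rapid f" and [measurable]: "A \<in> sets borel"
  shows "rapid (\<lambda>s. f s * indicator A s)"
  unfolding rapid_def
proof (intro conjI allI)
  have [measurable]: "f \<in> borel_measurable borel" using assms by (simp add: rapid_def)
  show "(\<lambda>s. f s * indicator A s) \<in> borel_measurable borel" by measurable
  show "integrable lborel (\<lambda>s. (1 + \<bar>s\<bar>) ^ i * norm (f s * indicator A s))" for i
    by (rule Bochner_Integration.integrable_bound[of _ "\<lambda>s. (1 + \<bar>s\<bar>) ^ i * norm (f s)"])
       (use assms in \<open>auto simp: rapid_def indicator_def\<close>)
qed

text \<open>For h = 1 this is the convolution of \<open>f\<close> and \<open>g\<close>; for h
  tending to 0 it is a mollification of \<open>g\<close> at scale h. One definition serves both,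
  because a substitution exchanges the two readings.\<close>

definition smear :: "real \<Rightarrow> (real \<Rightarrow> complex) \<Rightarrow> (real \<Rightarrow> complex) \<Rightarrow> real \<Rightarrow> complex" where
  "smear h f g t = (\<integral>u. f u * g (t - h * u) \<partial>lborel)"

lemma smear_integrable:
  fixes f g :: "real \<Rightarrow> complex"
  assumes f: "integrable lborel f" and g: "g \<in> borel_measurable borel" "\<And>x. norm (g x) \<le> M"
  shows "integrable lborel (\<lambda>u. f u * g (t - h * u))"
proof (rule Bochner_Integration.integrable_bound)
  show "integrable lborel (\<lambda>u. M * norm (f u))" using f by simp
  note [measurable] = g(1)
  show "(\<lambda>u. f u * g (t - h * u)) \<in> borel_measurable lborel" using f by measurable
  have "norm (f u * g (t - h * u)) \<le> M * norm (f u)" for u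
    using mult_left_mono[OF g(2), of "norm (f u)"] by (simp add: norm_mult mult.commute)
  then show "AE u in lborel. norm (f u * g (t - h * u)) \<le> norm (M * norm (f u))"
    by (intro AE_I2) (metis abs_ge_self order_trans real_norm_def)
qed

text \<open>The increment \<open>y - t\<close> of the argument of \<open>g\<close> is the same for
  every \<open>u\<close>, so the quadratic Taylor remainder of \<open>g\<close> has one bound and
  integrates against |f|. Smoothness is asked of \<open>g\<close> alone.\<close>

lemma smear_has_vector_derivative:
  assumes f: "integrable lborel f"
    and g: "\<And>x. (g has_vector_derivative g1 x) (at x)" "\<And>x. (g1 has_vector_derivative g2 x) (at x)"
    and M: "\<And>x. norm (g x) \<le> M" "\<And>x. norm (g1 x) \<le> M" "\<And>x. norm (g2 x) \<le> M"
  shows "(smear h f g has_vector_derivative smear h f g1 t) (at t)"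
proof -
  have meas: "g \<in> borel_measurable borel" "g1 \<in> borel_measurable borel"
    using g by (meson borel_measurable_continuous_onI continuous_at_imp_continuous_on has_vector_derivative_continuous)+
  note int = smear_integrable[OF f meas(1) M(1)] smear_integrable[OF f meas(2) M(2)]
  define W where "W = (\<integral>u. norm (f u) \<partial>lborel)"
  have rem: "norm (g b - g a - (b - a) *\<^sub>R g1 a) \<le> M * \<bar>b - a\<bar>\<^sup>2" for a b
  proof -
    have "norm (g b - g a - (b - a) *\<^sub>R g1 a) \<le> norm (b - a) * (M * \<bar>b - a\<bar>)"
    proof (rule vector_differentiable_bound_linearization[where S = "closed_segment a b"])
      fix x assume "x \<in> closed_segment a b"
      then have "\<bar>x - a\<bar> \<le> \<bar>b - a\<bar>" by (auto simp: closed_segment_eq_real_ivl split: if_splits)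
      moreover have "norm (g1 x - g1 a) \<le> M * \<bar>x - a\<bar>"
        by (rule vector_derivative_bound[OF g(2) M(3)])
      moreover have "M \<ge> 0" using M(1)[of 0] norm_ge_zero order_trans by blast
      ultimately show "norm (g1 x - g1 a) \<le> M * \<bar>b - a\<bar>"
        by (meson mult_left_mono order_trans)
    qed (auto intro: has_vector_derivative_at_within g)
    then show ?thesis by (simp add: power2_eq_square mult_ac)
  qed
  have bnd: "norm (smear h f g y - smear h f g t - (y - t) *\<^sub>R smear h f g1 t) \<le> M * W * \<bar>y - t\<bar>\<^sup>2" for y
  proof -
    have "smear h f g y - smear h f g t - (y - t) *\<^sub>R smear h f g1 t
      = (\<integral>u. f u * (g (y - h * u) - g (t - h * u) - (y - t) *\<^sub>R g1 (t - h * u)) \<partial>lborel)"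
      unfolding smear_def
      by (simp add: right_diff_distrib Bochner_Integration.integral_diff int)
    also have "norm \<dots> \<le> (\<integral>u. norm (f u) * (M * \<bar>y - t\<bar>\<^sup>2) \<partial>lborel)"
    proof (rule Bochner_Integration.integral_norm_bound_integral)
      show "integrable lborel (\<lambda>u. f u * (g (y - h * u) - g (t - h * u) - (y - t) *\<^sub>R g1 (t - h * u)))"
        by (simp add: right_diff_distrib int)
      show "integrable lborel (\<lambda>u. norm (f u) * (M * \<bar>y - t\<bar>\<^sup>2))" using f by simp
      show "norm (f u * (g (y - h * u) - g (t - h * u) - (y - t) *\<^sub>R g1 (t - h * u)))
          \<le> norm (f u) * (M * \<bar>y - t\<bar>\<^sup>2)" for u
        using rem[of "y - h * u" "t - h * u"] by (simp add: norm_mult mult_left_mono)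
    qed
    also have "\<dots> = M * W * \<bar>y - t\<bar>\<^sup>2" by (simp add: W_def)
    finally show ?thesis .
  qed
  show ?thesis
    unfolding has_vector_derivative_def
  proof (rule has_derivativeI_sandwich[where e = 1 and H = "\<lambda>y. M * W * \<bar>y - t\<bar>"])
    show "bounded_linear (\<lambda>x. x *\<^sub>R smear h f g1 t)" by (rule bounded_linear_scaleR_left)
    show "norm (smear h f g y - smear h f g t - (y - t) *\<^sub>R smear h f g1 t) / norm (y - t) \<le> M * W * \<bar>y - t\<bar>"
      if "y \<noteq> t" for y
      using bnd[of y] that by (simp add: divide_simps power2_eq_square mult_ac)
    have "((\<lambda>y. M * W * \<bar>y - t\<bar>) \<longlongrightarrow> M * W * \<bar>t - t\<bar>) (at t)"
      by (intro tendsto_intros)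
    then show "((\<lambda>y. M * W * \<bar>y - t\<bar>) \<longlongrightarrow> 0) (at t)" by simp
  qed auto
qed

text \<open>The weight at t is split by \<open>weight_le\<close> between u and t - hu; \<bar>h\<bar>
  \<le> 1 allows the first part to be charged to \<open>f\<close> independently of h.\<close>

lemma smear_weighted_bound:
  assumes f: "rapid f" and h: "\<bar>h\<bar> \<le> 1" and g: "g \<in> borel_measurable borel"
    and M: "\<And>x. (1 + \<bar>x\<bar>) ^ i * norm (g x) \<le> M"
  shows "(1 + \<bar>t\<bar>) ^ i * norm (smear h f g t) \<le> M * (\<integral>s. (1 + \<bar>s\<bar>) ^ i * norm (f s) \<partial>lborel)"
proof -
  have "norm (g x) \<le> M" for x
  proof -
    have "1 * norm (g x) \<le> (1 + \<bar>x\<bar>) ^ i * norm (g x)"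
      by (intro mult_right_mono one_le_power) auto
    with M[of x] show ?thesis by simp
  qed
  note int = smear_integrable[OF rapid_integrable[OF f] g this]
  have "of_real ((1 + \<bar>t\<bar>) ^ i) * smear h f g t = (\<integral>u. of_real ((1 + \<bar>t\<bar>) ^ i) * (f u * g (t - h * u)) \<partial>lborel)"
    unfolding smear_def by simp
  also have "norm \<dots> \<le> (\<integral>u. M * ((1 + \<bar>u\<bar>) ^ i * norm (f u)) \<partial>lborel)"
  proof (rule Bochner_Integration.integral_norm_bound_integral)
    show "integrable lborel (\<lambda>u. of_real ((1 + \<bar>t\<bar>) ^ i) * (f u * g (t - h * u)))"
      using int by simp
    show "integrable lborel (\<lambda>u. M * ((1 + \<bar>u\<bar>) ^ i * norm (f u)))"
      using f by (simp add: rapid_def)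
    fix u
    have "\<bar>h\<bar> * \<bar>u\<bar> \<le> 1 * \<bar>u\<bar>" using h by (intro mult_right_mono) auto
    then have "(1 + \<bar>t\<bar>) ^ i \<le> (1 + \<bar>u\<bar>) ^ i * (1 + \<bar>t - h * u\<bar>) ^ i"
      by (intro weight_le) (simp add: abs_mult)
    then have "(1 + \<bar>t\<bar>) ^ i * norm (g (t - h * u)) \<le> (1 + \<bar>u\<bar>) ^ i * (1 + \<bar>t - h * u\<bar>) ^ i * norm (g (t - h * u))"
      by (rule mult_right_mono) simp
    also have "\<dots> \<le> (1 + \<bar>u\<bar>) ^ i * M"
      using M[of "t - h * u"] by (simp add: mult.assoc mult_left_mono)
    finally have "norm (f u) * ((1 + \<bar>t\<bar>) ^ i * norm (g (t - h * u))) \<le> norm (f u) * ((1 + \<bar>u\<bar>) ^ i * M)"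
      by (rule mult_left_mono) simp
    then show "norm (of_real ((1 + \<bar>t\<bar>) ^ i) * (f u * g (t - h * u))) \<le> M * ((1 + \<bar>u\<bar>) ^ i * norm (f u))"
      unfolding norm_mult norm_of_real by (simp add: mult_ac)
  qed
  finally show ?thesis unfolding norm_mult norm_of_real by simp
qed

text \<open>All derivatives fall on \<open>g\<close>, so the result is smooth even when
  \<open>f\<close> jumps.\<close>

lemma smear_schwartz:
  assumes f: "rapid f" and h: "\<bar>h\<bar> \<le> 1" and g: "g \<in> schwartz"
  shows "smear h f g \<in> schwartz" "nth_vderiv j (smear h f g) = smear h f (nth_vderiv j g)"
proof -
  define D where "D = (\<lambda>j. smear h f (nth_vderiv j g))"
  have D0: "D 0 = smear h f g" by (simp add: D_def)
  have D: "(D j has_vector_derivative D (Suc j) t) (at t)" for j t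
  proof -
    \<comment> \<open>Orders j, j + 1 and j + 2 must be bounded together, the last one for the
      quadratic remainder.\<close>
    obtain M where M: "\<And>k t. k \<le> j + 2 \<Longrightarrow> (1 + \<bar>t\<bar>) ^ 0 * norm (nth_vderiv k g t) \<le> M"
      using schwartz_weighted_bound_uniform[OF g, of "j + 2" 0] by blast
    show ?thesis unfolding D_def
      by (rule smear_has_vector_derivative[OF rapid_integrable[OF f] schwartz_has_vderiv[OF g] schwartz_has_vderiv[OF g], of _ M])
         (use M in auto)
  qed
  have bd: "\<exists>M. \<forall>t. \<bar>t\<bar> ^ i * norm (D j t) \<le> M" for i j
  proof -
    obtain M where M: "\<And>t. (1 + \<bar>t\<bar>) ^ i * norm (nth_vderiv j g t) \<le> M"
      using schwartz_weighted_bound[OF g] by blast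
    have "\<bar>t\<bar> ^ i * norm (D j t) \<le> M * (\<integral>s. (1 + \<bar>s\<bar>) ^ i * norm (f s) \<partial>lborel)" for t
    proof -
      have "\<bar>t\<bar> ^ i * norm (D j t) \<le> (1 + \<bar>t\<bar>) ^ i * norm (D j t)"
        by (intro mult_right_mono power_mono) auto
      also have "\<dots> \<le> M * (\<integral>s. (1 + \<bar>s\<bar>) ^ i * norm (f s) \<partial>lborel)"
        unfolding D_def by (rule smear_weighted_bound[OF f h schwartz_vderiv_measurable[OF g] M])
      finally show ?thesis .
    qed
    then show ?thesis by blast
  qed
  show "smear h f g \<in> schwartz" by (rule schwartzI[OF D0 D bd])
  show "nth_vderiv j (smear h f g) = smear h f (nth_vderiv j g)"
    using nth_vderiv_eqI[OF D0 D] by (simp add: D_def)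
qed

lemma schwartz_translate:
  assumes \<phi>: "\<phi> \<in> schwartz"
  shows "(\<lambda>t. \<phi> (t - s)) \<in> schwartz" "nth_vderiv j (\<lambda>t. \<phi> (t - s)) = (\<lambda>t. nth_vderiv j \<phi> (t - s))"
proof -
  define D where "D = (\<lambda>j t. nth_vderiv j \<phi> (t - s))"
  have D0: "D 0 = (\<lambda>t. \<phi> (t - s))" by (simp add: D_def)
  have D: "(D j has_vector_derivative D (Suc j) t) (at t)" for j t
  proof -
    have "((nth_vderiv j \<phi> \<circ> (\<lambda>t. t - s)) has_vector_derivative 1 *\<^sub>R nth_vderiv (Suc j) \<phi> (t - s)) (at t)"
      by (rule vector_diff_chain_at[OF _ schwartz_has_vderiv[OF \<phi>]])
         (auto intro!: derivative_eq_intros)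
    then show ?thesis by (simp add: D_def o_def)
  qed
  have bd: "\<exists>M. \<forall>t. \<bar>t\<bar> ^ i * norm (D j t) \<le> M" for i j
  proof -
    obtain M where M: "\<And>t. (1 + \<bar>t\<bar>) ^ i * norm (nth_vderiv j \<phi> t) \<le> M"
      using schwartz_weighted_bound[OF \<phi>] by blast
    have "\<bar>t\<bar> ^ i * norm (D j t) \<le> (1 + \<bar>s\<bar>) ^ i * M" for t
    proof -
      have "\<bar>t\<bar> ^ i \<le> (1 + \<bar>t\<bar>) ^ i" by (intro power_mono) auto
      also have "\<dots> \<le> (1 + \<bar>s\<bar>) ^ i * (1 + \<bar>t - s\<bar>) ^ i" by (rule weight_le) simp
      finally have "\<bar>t\<bar> ^ i * norm (D j t) \<le> (1 + \<bar>s\<bar>) ^ i * (1 + \<bar>t - s\<bar>) ^ i * norm (D j t)"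
        by (rule mult_right_mono) simp
      also have "\<dots> \<le> (1 + \<bar>s\<bar>) ^ i * M"
        using M[of "t - s"] by (simp add: D_def mult.assoc mult_left_mono)
      finally show ?thesis .
    qed
    then show ?thesis by blast
  qed
  show "(\<lambda>t. \<phi> (t - s)) \<in> schwartz" by (rule schwartzI[OF D0 D bd])
  show "nth_vderiv j (\<lambda>t. \<phi> (t - s)) = (\<lambda>t. nth_vderiv j \<phi> (t - s))"
    using nth_vderiv_eqI[OF D0 D] by (simp add: D_def)
qed

text \<open>Subtracting the translate of \<open>g\<close>, which \<open>T\<close> annihilates, makes the increment of
  \<open>s \<mapsto> T (smear 1 (\<phi> \<chi>\<^bsub>(p,s]\<^esub>) g)\<close> quadratically small, so that this function is constant.\<close>

lemma tempered_smear_interval_eq_0: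
  assumes T: "T \<in> tempered_distributions" and \<phi>: "\<phi> \<in> schwartz" and g: "g \<in> schwartz"
    and zero: "\<And>s. T (\<lambda>t. g (t - s)) = 0" and pq: "p \<le> q"
  shows "T (smear 1 (\<lambda>u. \<phi> u * indicator {p<..q} u) g) = 0"
proof -
  obtain C n where C: "C \<ge> 0" "\<And>\<phi> M. \<phi> \<in> schwartz \<Longrightarrow>
      (\<And>j t. j \<le> n \<Longrightarrow> (1 + \<bar>t\<bar>) ^ n * norm (nth_vderiv j \<phi> t) \<le> M) \<Longrightarrow> norm (T \<phi>) \<le> C * M"
    using tempered_weighted_bound[OF T] by metis
  \<comment> \<open>One derivative more than \<open>T\<close> sees, because derivatives up to order
    n must be Lipschitz.\<close>
  obtain K where K: "K \<ge> 0" "\<And>j t. j \<le> Suc n \<Longrightarrow> (1 + \<bar>t\<bar>) ^ n * norm (nth_vderiv j g t) \<le> K"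
    using schwartz_weighted_bound_uniform[OF g, of "Suc n" n] by blast
  obtain M\<phi> where M\<phi>: "M\<phi> \<ge> 0" "\<And>t. norm (\<phi> t) \<le> M\<phi>"
    using schwartz_weighted_bound[OF \<phi>, of 0 0] by auto
  \<comment> \<open>\<open>P\<close> bounds every translation by a point of [p, q] and so governs
    the loss of weight; \<open>L\<close> is the bound for \<phi> times the resulting weighted
    Lipschitz constant.\<close>
  define P where "P = \<bar>p\<bar> + \<bar>q\<bar>"
  define L where "L = M\<phi> * ((1 + P) ^ n * K)"
  define cut where "cut a b = (\<lambda>u. \<phi> u * indicator {a<..b} u)" for a b :: real
  define D where "D s = T (smear 1 (cut p s) g)" for s
  have cut_rapid: "rapid (cut a b)" for a b
    unfolding cut_def by (intro rapid_indicator schwartz_rapid \<phi>) simp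
  have int: "integrable lborel (\<lambda>u. cut a b u * nth_vderiv j g (t - u))" for a b j t
  proof -
    obtain M where M: "\<And>x. norm (nth_vderiv j g x) \<le> M"
      using schwartz_weighted_bound[OF g, of 0 j] by auto
    show ?thesis
      using smear_integrable[OF rapid_integrable[OF cut_rapid] schwartz_vderiv_measurable[OF g] M, of a b t 1]
      by simp
  qed
  have g_lip: "(1 + \<bar>t\<bar>) ^ n * norm (nth_vderiv j g (t - u) - nth_vderiv j g (t - s)) \<le> (1 + P) ^ n * K * \<bar>u - s\<bar>"
    if su: "s \<in> {p..q}" "u \<in> {p..q}" and j: "j \<le> n" for s u t j
  proof -
    have "norm (of_real ((1 + \<bar>t\<bar>) ^ n) * nth_vderiv j g (t - u) - of_real ((1 + \<bar>t\<bar>) ^ n) * nth_vderiv j g (t - s))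
        \<le> ((1 + P) ^ n * K) * \<bar>(t - u) - (t - s)\<bar>"
    proof (rule vector_derivative_bound)
      show "((\<lambda>y. of_real ((1 + \<bar>t\<bar>) ^ n) * nth_vderiv j g y) has_vector_derivative
          of_real ((1 + \<bar>t\<bar>) ^ n) * nth_vderiv (Suc j) g y) (at y)" for y
        by (intro has_vector_derivative_mult_right schwartz_has_vderiv g)
      fix y assume "y \<in> closed_segment (t - s) (t - u)"
      then have "\<bar>y - t\<bar> \<le> \<bar>P\<bar>"
        using su by (auto simp: closed_segment_eq_real_ivl P_def split: if_splits)
      then have "(1 + \<bar>t\<bar>) ^ n \<le> (1 + P) ^ n * (1 + \<bar>y\<bar>) ^ n"
        using weight_le[of y t P n] by (simp add: P_def)
      then have "(1 + \<bar>t\<bar>) ^ n * norm (nth_vderiv (Suc j) g y)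
          \<le> (1 + P) ^ n * (1 + \<bar>y\<bar>) ^ n * norm (nth_vderiv (Suc j) g y)"
        by (rule mult_right_mono) simp
      also have "\<dots> \<le> (1 + P) ^ n * K"
        using K(2)[of "Suc j" y] j by (simp add: mult.assoc mult_left_mono P_def)
      finally show "norm (of_real ((1 + \<bar>t\<bar>) ^ n) * nth_vderiv (Suc j) g y) \<le> (1 + P) ^ n * K"
        unfolding norm_mult norm_of_real by simp
    qed
    then show ?thesis
      unfolding right_diff_distrib[symmetric] norm_mult norm_of_real by (simp add: abs_minus_commute)
  qed
  have incr: "norm (T (smear 1 (cut s s') g)) \<le> C * L * (s' - s)\<^sup>2"
    if s: "p \<le> s" "s \<le> s'" "s' \<le> q" for s s'
  proof -
    define I where "I = (\<integral>u. cut s s' u \<partial>lborel)"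
    define Rm where "Rm = (\<lambda>t. 1 * smear 1 (cut s s') g t + (- I) * g (t - s))"
    note S1 = smear_schwartz[OF cut_rapid[of s s'], of 1 g, simplified, OF g]
    note S2 = schwartz_translate[OF g, where s = s]
    have RmS: "Rm \<in> schwartz" unfolding Rm_def by (intro schwartz_lincomb S1 S2)
    have RmT: "T Rm = 1 * T (smear 1 (cut s s') g) + (- I) * T (\<lambda>t. g (t - s))"
      unfolding Rm_def by (intro tempered_lincomb T S1 S2)
    have RmD: "nth_vderiv j Rm t = (\<integral>u. cut s s' u * (nth_vderiv j g (t - u) - nth_vderiv j g (t - s)) \<partial>lborel)" for j t
    proof -
      have "nth_vderiv j Rm = (\<lambda>t. 1 * nth_vderiv j (smear 1 (cut s s') g) t + (- I) * nth_vderiv j (\<lambda>t. g (t - s)) t)"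
        unfolding Rm_def by (intro schwartz_lincomb S1 S2)
      then have "nth_vderiv j Rm t = smear 1 (cut s s') (nth_vderiv j g) t - I * nth_vderiv j g (t - s)"
        by (simp add: S1 S2)
      also have "\<dots> = (\<integral>u. cut s s' u * nth_vderiv j g (t - u) - cut s s' u * nth_vderiv j g (t - s) \<partial>lborel)"
        unfolding smear_def I_def using int rapid_integrable[OF cut_rapid]
        by (simp add: Bochner_Integration.integral_diff)
      finally show ?thesis by (simp add: right_diff_distrib)
    qed
    have "norm (T Rm) \<le> C * (L * (s' - s)\<^sup>2)"
    proof (rule C(2)[OF RmS])
      fix j :: nat and t :: real assume j: "j \<le> n"
      have "of_real ((1 + \<bar>t\<bar>) ^ n) * nth_vderiv j Rm t
          = (\<integral>u. of_real ((1 + \<bar>t\<bar>) ^ n) * (cut s s' u * (nth_vderiv j g (t - u) - nth_vderiv j g (t - s))) \<partial>lborel)"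
        unfolding RmD by simp
      also have "norm \<dots> \<le> (\<integral>u. (L * (s' - s)) * indicator {s<..s'} u \<partial>lborel)"
      proof (rule Bochner_Integration.integral_norm_bound_integral)
        show "integrable lborel (\<lambda>u. of_real ((1 + \<bar>t\<bar>) ^ n) * (cut s s' u * (nth_vderiv j g (t - u) - nth_vderiv j g (t - s))))"
          using int rapid_integrable[OF cut_rapid] by (intro integrable_mult_right) (simp add: right_diff_distrib)
        show "integrable lborel (\<lambda>u. (L * (s' - s)) * indicator {s<..s'} u)"
          using s by (intro integrable_mult_right) (auto simp: integrable_indicator_iff)
        fix u
        show "norm (of_real ((1 + \<bar>t\<bar>) ^ n) * (cut s s' u * (nth_vderiv j g (t - u) - nth_vderiv j g (t - s))))
            \<le> (L * (s' - s)) * indicator {s<..s'} u"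
        proof (cases "u \<in> {s<..s'}")
          case True
          have "(1 + \<bar>t\<bar>) ^ n * norm (nth_vderiv j g (t - u) - nth_vderiv j g (t - s)) \<le> (1 + P) ^ n * K * \<bar>u - s\<bar>"
            using True s j by (intro g_lip) auto
          also have "\<dots> \<le> (1 + P) ^ n * K * (s' - s)"
            using True K(1) by (intro mult_left_mono) (auto simp: P_def)
          finally have "norm (\<phi> u) * ((1 + \<bar>t\<bar>) ^ n * norm (nth_vderiv j g (t - u) - nth_vderiv j g (t - s)))
              \<le> M\<phi> * ((1 + P) ^ n * K * (s' - s))"
            by (rule mult_mono[OF M\<phi>(2) _ M\<phi>(1)]) simp
          then show ?thesis
            using True unfolding norm_mult norm_of_real cut_def L_def by (simp add: mult_ac)
        qed (simp add: cut_def)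
      qed
      also have "\<dots> = L * (s' - s)\<^sup>2"
        using s by (simp add: power2_eq_square)
      finally show "(1 + \<bar>t\<bar>) ^ n * norm (nth_vderiv j Rm t) \<le> L * (s' - s)\<^sup>2"
        unfolding norm_mult norm_of_real by simp
    qed
    then show ?thesis using RmT zero[of s] by (simp add: mult.assoc)
  qed
  have D_diff: "D s' - D s = T (smear 1 (cut s s') g)" if s: "p \<le> s" "s \<le> s'" for s s'
  proof -
    have split: "cut p s' u = cut p s u + cut s s' u" for u
      using s by (auto simp: cut_def indicator_def)
    have "smear 1 (cut p s') g t = smear 1 (cut p s) g t + smear 1 (cut s s') g t" for t
      unfolding smear_def split using int[of _ _ 0] by (simp add: distrib_right)
    then have eq: "smear 1 (cut p s') g = (\<lambda>t. 1 * smear 1 (cut p s) g t + 1 * smear 1 (cut s s') g t)"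
      by (simp add: fun_eq_iff)
    have "D s' = 1 * D s + 1 * T (smear 1 (cut s s') g)"
      unfolding D_def eq by (intro tempered_lincomb T smear_schwartz(1) cut_rapid g) simp_all
    then show ?thesis by simp
  qed
  have D_bound: "norm (D x - D y) \<le> C * L * \<bar>x - y\<bar>\<^sup>2" if "x \<in> {p..q}" "y \<in> {p..q}" for x y
  proof (cases "x \<le> y")
    case True
    then show ?thesis
      using that incr[of x y] D_diff[of x y] by (simp add: norm_minus_commute[of "D x"] power2_commute)
  next
    case False
    then show ?thesis using that incr[of y x] D_diff[of y x] by simp
  qed
  have "\<exists>c. \<forall>x\<in>{p..q}. D x = c"
  proof (rule has_derivative_zero_constant)
    fix x assume x: "x \<in> {p..q}"
    show "(D has_derivative (\<lambda>h. 0)) (at x within {p..q})"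
    proof (rule has_derivativeI_sandwich[where e = 1 and H = "\<lambda>y. C * L * \<bar>y - x\<bar>"])
      show "norm (D y - D x - 0) / norm (y - x) \<le> C * L * \<bar>y - x\<bar>" if "y \<in> {p..q}" "y \<noteq> x" for y
        using D_bound[OF that(1) x] that(2) by (simp add: divide_simps power2_eq_square mult_ac)
      have "((\<lambda>y. C * L * \<bar>y - x\<bar>) \<longlongrightarrow> C * L * \<bar>x - x\<bar>) (at x within {p..q})"
        by (intro tendsto_intros)
      then show "((\<lambda>y. C * L * \<bar>y - x\<bar>) \<longlongrightarrow> 0) (at x within {p..q})" by simp
    qed auto
  qed simp
  then have "D q = D p" using pq by force
  moreover have "D p = 0"
    using tempered_zero[OF T] by (simp add: D_def cut_def smear_def[abs_def])
  ultimately show ?thesis by (simp add: D_def cut_def)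
qed

text \<open>Bounded intervals contribute nothing, so only the tail of \<phi> matters. Its
  convolution with \<open>g\<close> is bounded in the seminorms that control \<open>T\<close> by a
  weighted L^1 norm of the tail, which tends to 0 by dominated convergence.\<close>

lemma tempered_smear_eq_0:
  assumes T: "T \<in> tempered_distributions" and \<phi>: "\<phi> \<in> schwartz" and g: "g \<in> schwartz"
    and zero: "\<And>s. T (\<lambda>t. g (t - s)) = 0"
  shows "T (smear 1 \<phi> g) = 0"
proof -
  obtain C n where C: "C \<ge> 0" "\<And>\<phi> M. \<phi> \<in> schwartz \<Longrightarrow>
      (\<And>j t. j \<le> n \<Longrightarrow> (1 + \<bar>t\<bar>) ^ n * norm (nth_vderiv j \<phi> t) \<le> M) \<Longrightarrow> norm (T \<phi>) \<le> C * M"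
    using tempered_weighted_bound[OF T] by metis
  obtain K where K: "K \<ge> 0" "\<And>j t. j \<le> n \<Longrightarrow> (1 + \<bar>t\<bar>) ^ n * norm (nth_vderiv j g t) \<le> K"
    using schwartz_weighted_bound_uniform[OF g, of n n] by blast
  define ins where "ins k = (\<lambda>u. \<phi> u * indicator {- real k<..real k} u)" for k :: nat
  define out where "out k = (\<lambda>u. \<phi> u * indicator (- {- real k<..real k}) u)" for k :: nat
  have rapid: "rapid (ins k)" "rapid (out k)" for k
    unfolding ins_def out_def by (intro rapid_indicator schwartz_rapid \<phi>; simp)+
  have [measurable]: "\<phi> \<in> borel_measurable borel" by (rule schwartz_measurable[OF \<phi>])
  obtain Mg where Mg: "\<And>x. norm (nth_vderiv 0 g x) \<le> Mg"
    using schwartz_weighted_bound[OF g, of 0 0] by auto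
  note int = smear_integrable[OF rapid_integrable[OF rapid(1)] schwartz_vderiv_measurable[OF g] Mg]
    smear_integrable[OF rapid_integrable[OF rapid(2)] schwartz_vderiv_measurable[OF g] Mg]
  define W where "W k = (\<integral>s. (1 + \<bar>s\<bar>) ^ n * norm (out k s) \<partial>lborel)" for k
  have "norm (T (smear 1 \<phi> g)) \<le> C * K * W k" for k
  proof -
    have split: "\<phi> u = ins k u + out k u" for u
      by (auto simp: ins_def out_def indicator_def)
    have "smear 1 \<phi> g t = smear 1 (ins k) g t + smear 1 (out k) g t" for t
      unfolding smear_def split[of _] using int(1)[of k t 1] int(2)[of k t 1] by (simp add: distrib_right)
    then have eq: "smear 1 \<phi> g = (\<lambda>t. 1 * smear 1 (ins k) g t + 1 * smear 1 (out k) g t)"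
      by (simp add: fun_eq_iff)
    have "T (smear 1 \<phi> g) = 1 * T (smear 1 (ins k) g) + 1 * T (smear 1 (out k) g)"
      unfolding eq by (intro tempered_lincomb T smear_schwartz(1) rapid g) simp_all
    also have "T (smear 1 (ins k) g) = 0"
      unfolding ins_def by (rule tempered_smear_interval_eq_0[OF T \<phi> g zero]) simp
    finally have "T (smear 1 \<phi> g) = T (smear 1 (out k) g)" by simp
    moreover have "norm (T (smear 1 (out k) g)) \<le> C * (K * W k)"
    proof (rule C(2))
      show "smear 1 (out k) g \<in> schwartz" by (rule smear_schwartz(1)[OF rapid(2) _ g]) simp
      fix j :: nat and t :: real assume "j \<le> n"
      then have "(1 + \<bar>t\<bar>) ^ n * norm (smear 1 (out k) (nth_vderiv j g) t) \<le> K * W k"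
        unfolding W_def by (intro smear_weighted_bound rapid schwartz_vderiv_measurable g K(2)) auto
      then show "(1 + \<bar>t\<bar>) ^ n * norm (nth_vderiv j (smear 1 (out k) g) t) \<le> K * W k"
        by (simp add: smear_schwartz(2)[OF rapid(2) _ g])
    qed
    ultimately show ?thesis by (simp add: mult.assoc)
  qed
  moreover have "W \<longlonglongrightarrow> integral\<^sup>L lborel (\<lambda>s :: real. 0 :: real)"
    unfolding W_def
  proof (rule integral_dominated_convergence)
    show "integrable lborel (\<lambda>s. (1 + \<bar>s\<bar>) ^ n * norm (\<phi> s))"
      using schwartz_rapid[OF \<phi>] by (simp add: rapid_def)
    show "AE s in lborel. (\<lambda>k. (1 + \<bar>s\<bar>) ^ n * norm (out k s)) \<longlonglongrightarrow> 0"
    proof (rule AE_I2)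
      fix s :: real
      obtain k0 :: nat where k0: "\<bar>s\<bar> < real k0" using reals_Archimedean2 by blast
      have "out k s = 0" if "k \<ge> k0" for k
      proof -
        have "\<bar>s\<bar> < real k" using k0 that by linarith
        then show ?thesis by (auto simp: out_def indicator_def)
      qed
      then show "(\<lambda>k. (1 + \<bar>s\<bar>) ^ n * norm (out k s)) \<longlonglongrightarrow> 0"
        by (intro tendsto_eventually eventually_sequentiallyI[of k0]) simp
    qed
    show "AE s in lborel. norm ((1 + \<bar>s\<bar>) ^ n * norm (out k s)) \<le> (1 + \<bar>s\<bar>) ^ n * norm (\<phi> s)" for k
      by (rule AE_I2) (auto simp: out_def indicator_def)
    show "(\<lambda>s. (1 + \<bar>s\<bar>) ^ n * norm (out k s)) \<in> borel_measurable lborel" for k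
      using rapid(2)[of k] unfolding rapid_def by (meson borel_measurable_integrable)
  qed auto
  then have "(\<lambda>k. C * K * W k) \<longlonglongrightarrow> C * K * 0"
    by (intro tendsto_intros) simp
  ultimately have "norm (T (smear 1 \<phi> g)) \<le> C * K * 0"
    by (intro LIMSEQ_le_const) auto
  then show ?thesis by simp
qed

text \<open>Mollification: \<open>smear h E \<phi> \<rightarrow> (\<integral>E) \<phi>\<close> in every seminorm, at rate \<open>h\<close>.\<close>

lemma tempered_eq_0:
  assumes T: "T \<in> tempered_distributions"
    and zero: "\<And>a b. Re a < 0 \<Longrightarrow> T (gauss a b 0) = 0"
  shows "T = (\<lambda>_. 0)"
proof
  fix \<phi>
  show "T \<phi> = 0"
  proof (cases "\<phi> \<in> schwartz")
    case False
    then show ?thesis using T by (simp add: tempered_distributions_def)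
  next
    case \<phi>: True
    define E where "E = gauss (- 1) 0 0"
    have E: "E \<in> schwartz" unfolding E_def by (rule gauss_schwartz) simp
    have E_eq: "E u = of_real (exp (- u\<^sup>2))" for u by (simp add: E_def flip: exp_of_real)
    define \<kappa> where "\<kappa> = (\<integral>u. E u \<partial>lborel)"
    have "\<kappa> \<noteq> 0"
    proof
      assume "\<kappa> = 0"
      then have "(\<integral>u. exp (- u\<^sup>2) \<partial>lborel) = (0::real)"
        unfolding \<kappa>_def E_eq by simp
      moreover have "integrable lborel (\<lambda>u::real. exp (- u\<^sup>2))"
        using integrable_norm[OF rapid_integrable[OF schwartz_rapid[OF E]]] by (simp add: E_eq)
      ultimately have "AE u::real in lborel. exp (- u\<^sup>2) = 0"
        by (subst (asm) integral_nonneg_eq_0_iff_AE) auto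
      then have "AE u::real in lborel. False" by simp
      then show False using AE_iff_null_sets[of UNIV "lborel :: real measure"] by (auto dest!: null_setsD1)
    qed
    have smear0: "T (smear h E \<phi>) = 0" if h: "0 < h" "h \<le> 1" for h
    proof -
      \<comment> \<open>The width for which the Gaussian is \<open>E\<close> dilated by h, as
        \<open>gauss a 0 0 (h * x) = E x\<close>.\<close>
      define a where "a = complex_of_real (- 1 / h\<^sup>2)"
      have a: "Re a < 0" using h by (simp add: a_def)
      have g: "gauss a 0 0 \<in> schwartz" by (rule gauss_schwartz[OF a])
      \<comment> \<open>Translating a Gaussian only adds a linear term to the exponent and a
        constant factor; this is why the hypothesis is needed for all \<open>b\<close> and not just
        for 0.\<close>
      have "T (\<lambda>t. gauss a 0 0 (t - s)) = 0" for s
      proof -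
        have "gauss a 0 0 (t - s) = exp (a * of_real s ^ 2) * gauss a (- 2 * a * of_real s) 0 t" for t
          by (simp add: power2_diff algebra_simps flip: exp_add)
        then show ?thesis
          using tempered_cmult[OF T gauss_schwartz(1)[OF a]] zero[OF a] by (simp del: gauss_deriv.simps)
      qed
      then have "T (smear 1 \<phi> (gauss a 0 0)) = 0" by (rule tempered_smear_eq_0[OF T \<phi> g])
      also have "smear 1 \<phi> (gauss a 0 0) = (\<lambda>t. of_real h * smear h E \<phi> t)"
      proof
        fix t
        have eq: "gauss a 0 0 (h * x) = E x" for x using h by (simp add: a_def E_def power_mult_distrib)
        \<comment> \<open>The substitution u = t - hx swaps the roles: averaging Gaussians against
          \<phi> becomes averaging \<phi> against a Gaussian, with Jacobian h.\<close>
        have "smear 1 \<phi> (gauss a 0 0) t = \<bar>- h\<bar> *\<^sub>R (\<integral>x. \<phi> (t + (- h) * x) * gauss a 0 0 (t - 1 * (t + (- h) * x)) \<partial>lborel)"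
          unfolding smear_def using h by (intro lborel_integral_real_affine) auto
        also have "\<dots> = of_real h * smear h E \<phi> t"
          using h eq by (simp add: smear_def scaleR_conv_of_real mult.commute del: gauss_deriv.simps)
        finally show "smear 1 \<phi> (gauss a 0 0) t = of_real h * smear h E \<phi> t" .
      qed
      also have "T (\<lambda>t. of_real h * smear h E \<phi> t) = of_real h * T (smear h E \<phi>)"
        using h by (intro tempered_cmult T smear_schwartz schwartz_rapid E \<phi>) auto
      finally show ?thesis using h by simp
    qed
    obtain C n where C: "C \<ge> 0" "\<And>\<phi> M. \<phi> \<in> schwartz \<Longrightarrow>
        (\<And>j t. j \<le> n \<Longrightarrow> (1 + \<bar>t\<bar>) ^ n * norm (nth_vderiv j \<phi> t) \<le> M) \<Longrightarrow> norm (T \<phi>) \<le> C * M"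
      using tempered_weighted_bound[OF T] by metis
    obtain K where K: "K \<ge> 0" "\<And>j t. j \<le> Suc n \<Longrightarrow> (1 + \<bar>t\<bar>) ^ n * norm (nth_vderiv j \<phi> t) \<le> K"
      using schwartz_weighted_bound_uniform[OF \<phi>, of "Suc n" n] by blast
    \<comment> \<open>Of the \<open>Suc n\<close> powers of the weight, n pay for the translation by
      hu and one for the factor |u| in the Lipschitz estimate.\<close>
    define W where "W = (\<integral>u. (1 + \<bar>u\<bar>) ^ Suc n * norm (E u) \<partial>lborel)"
    have Er: "rapid E" by (rule schwartz_rapid[OF E])
    have bound: "norm (\<kappa> * T \<phi>) \<le> C * (h * K * W)" if h: "0 < h" "h \<le> 1" for h
    proof -
      \<comment> \<open>Since \<open>T\<close> kills the mollified function, \<open>T Rm\<close> is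
        -\<kappa> times \<open>T \<phi>\<close>, a quantity independent of h.\<close>
      define Rm where "Rm = (\<lambda>t. 1 * smear h E \<phi> t + (- \<kappa>) * \<phi> t)"
      have h': "\<bar>h\<bar> \<le> 1" using h by simp
      note S1 = smear_schwartz[OF Er h' \<phi>]
      have RmS: "Rm \<in> schwartz" unfolding Rm_def by (intro schwartz_lincomb S1 \<phi>)
      have RmT: "T Rm = 1 * T (smear h E \<phi>) + (- \<kappa>) * T \<phi>"
        unfolding Rm_def by (intro tempered_lincomb T S1 \<phi>)
      have int: "integrable lborel (\<lambda>u. E u * nth_vderiv j \<phi> (t - h * u))" "integrable lborel (\<lambda>u. E u * nth_vderiv j \<phi> t)" for j t
      proof -
        obtain M where M: "\<And>x. norm (nth_vderiv j \<phi> x) \<le> M"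
          using schwartz_weighted_bound[OF \<phi>, of 0 j] by auto
        show "integrable lborel (\<lambda>u. E u * nth_vderiv j \<phi> (t - h * u))"
          by (rule smear_integrable[OF rapid_integrable[OF Er] schwartz_vderiv_measurable[OF \<phi>] M])
        show "integrable lborel (\<lambda>u. E u * nth_vderiv j \<phi> t)"
          using rapid_integrable[OF Er] by simp
      qed
      have RmD: "nth_vderiv j Rm t = (\<integral>u. E u * (nth_vderiv j \<phi> (t - h * u) - nth_vderiv j \<phi> t) \<partial>lborel)" for j t
      proof -
        have "nth_vderiv j Rm = (\<lambda>t. 1 * nth_vderiv j (smear h E \<phi>) t + (- \<kappa>) * nth_vderiv j \<phi> t)"
          unfolding Rm_def by (intro schwartz_lincomb S1 \<phi>)
        then have "nth_vderiv j Rm t = smear h E (nth_vderiv j \<phi>) t - \<kappa> * nth_vderiv j \<phi> t"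
          by (simp add: S1)
        also have "\<dots> = (\<integral>u. E u * nth_vderiv j \<phi> (t - h * u) - E u * nth_vderiv j \<phi> t \<partial>lborel)"
          unfolding smear_def \<kappa>_def using int rapid_integrable[OF Er]
          by (simp add: Bochner_Integration.integral_diff)
        finally show ?thesis by (simp add: right_diff_distrib)
      qed
      have "norm (T Rm) \<le> C * (h * K * W)"
      proof (rule C(2)[OF RmS])
        fix j :: nat and t :: real assume j: "j \<le> n"
        have "of_real ((1 + \<bar>t\<bar>) ^ n) * nth_vderiv j Rm t
            = (\<integral>u. of_real ((1 + \<bar>t\<bar>) ^ n) * (E u * (nth_vderiv j \<phi> (t - h * u) - nth_vderiv j \<phi> t)) \<partial>lborel)"
          unfolding RmD by simp
        also have "norm \<dots> \<le> (\<integral>u. (h * K) * ((1 + \<bar>u\<bar>) ^ Suc n * norm (E u)) \<partial>lborel)"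
        proof (rule Bochner_Integration.integral_norm_bound_integral)
          show "integrable lborel (\<lambda>u. of_real ((1 + \<bar>t\<bar>) ^ n) * (E u * (nth_vderiv j \<phi> (t - h * u) - nth_vderiv j \<phi> t)))"
            using int by (intro integrable_mult_right) (simp add: right_diff_distrib)
          show "integrable lborel (\<lambda>u. (h * K) * ((1 + \<bar>u\<bar>) ^ Suc n * norm (E u)))"
            using Er unfolding rapid_def by (intro integrable_mult_right) blast
          fix u :: real
          have "norm (of_real ((1 + \<bar>t\<bar>) ^ n) * nth_vderiv j \<phi> (t - h * u) - of_real ((1 + \<bar>t\<bar>) ^ n) * nth_vderiv j \<phi> t)
              \<le> ((1 + \<bar>u\<bar>) ^ n * K) * \<bar>(t - h * u) - t\<bar>"
          proof (rule vector_derivative_bound)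
            show "((\<lambda>y. of_real ((1 + \<bar>t\<bar>) ^ n) * nth_vderiv j \<phi> y) has_vector_derivative
                of_real ((1 + \<bar>t\<bar>) ^ n) * nth_vderiv (Suc j) \<phi> y) (at y)" for y
              by (intro has_vector_derivative_mult_right schwartz_has_vderiv \<phi>)
            fix y assume "y \<in> closed_segment t (t - h * u)"
            then have "\<bar>y - t\<bar> \<le> \<bar>h * u\<bar>"
              by (auto simp: closed_segment_eq_real_ivl split: if_splits)
            also have "\<dots> \<le> \<bar>u\<bar>" using h by (simp add: abs_mult mult_left_le_one_le)
            finally have "(1 + \<bar>t\<bar>) ^ n \<le> (1 + \<bar>u\<bar>) ^ n * (1 + \<bar>y\<bar>) ^ n" by (rule weight_le)
            then have "(1 + \<bar>t\<bar>) ^ n * norm (nth_vderiv (Suc j) \<phi> y)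
                \<le> (1 + \<bar>u\<bar>) ^ n * (1 + \<bar>y\<bar>) ^ n * norm (nth_vderiv (Suc j) \<phi> y)"
              by (rule mult_right_mono) simp
            also have "\<dots> \<le> (1 + \<bar>u\<bar>) ^ n * K"
              using K(2)[of "Suc j" y] j by (simp add: mult.assoc mult_left_mono)
            finally show "norm (of_real ((1 + \<bar>t\<bar>) ^ n) * nth_vderiv (Suc j) \<phi> y) \<le> (1 + \<bar>u\<bar>) ^ n * K"
              unfolding norm_mult norm_of_real by simp
          qed
          then have "(1 + \<bar>t\<bar>) ^ n * norm (nth_vderiv j \<phi> (t - h * u) - nth_vderiv j \<phi> t)
              \<le> ((1 + \<bar>u\<bar>) ^ n * K) * (h * \<bar>u\<bar>)"
            unfolding right_diff_distrib[symmetric] norm_mult norm_of_real using h by (simp add: abs_mult)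
          also have "\<dots> \<le> ((1 + \<bar>u\<bar>) ^ n * K) * (h * (1 + \<bar>u\<bar>))"
            using h K(1) by (intro mult_left_mono) auto
          finally have "norm (E u) * ((1 + \<bar>t\<bar>) ^ n * norm (nth_vderiv j \<phi> (t - h * u) - nth_vderiv j \<phi> t))
              \<le> norm (E u) * (((1 + \<bar>u\<bar>) ^ n * K) * (h * (1 + \<bar>u\<bar>)))"
            by (rule mult_left_mono) simp
          then show "norm (of_real ((1 + \<bar>t\<bar>) ^ n) * (E u * (nth_vderiv j \<phi> (t - h * u) - nth_vderiv j \<phi> t)))
              \<le> (h * K) * ((1 + \<bar>u\<bar>) ^ Suc n * norm (E u))"
            unfolding norm_mult norm_of_real by (simp add: mult_ac)
        qed
        also have "\<dots> = h * K * W" by (simp add: W_def)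
        finally show "(1 + \<bar>t\<bar>) ^ n * norm (nth_vderiv j Rm t) \<le> h * K * W"
          unfolding norm_mult norm_of_real by simp
      qed
      then show ?thesis using RmT smear0[OF h] by simp
    qed
    have "norm (\<kappa> * T \<phi>) \<le> 0"
    proof (rule tendsto_lowerbound)
      have "((\<lambda>h. C * (h * K * W)) \<longlongrightarrow> C * (0 * K * W)) (at_right 0)"
        by (intro tendsto_intros)
      then show "((\<lambda>h. C * (h * K * W)) \<longlongrightarrow> 0) (at_right 0)" by simp
      show "\<forall>\<^sub>F h in at_right 0. norm (\<kappa> * T \<phi>) \<le> C * (h * K * W)"
        by (rule eventually_mono[OF eventually_at_right_real[of 0 1]]) (auto intro!: bound)
    qed simp
    then show ?thesis using \<open>\<kappa> \<noteq> 0\<close> by simp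
  qed
qed

section \<open>Unique recovery\<close>

lemma norm_stft_hermite:
  assumes "T \<in> tempered_distributions"
  shows "norm (stft (hermite_fun r) T z) = hermite_const r * poly_abs r (bargmann T) z"
proof (cases z)
  case (Pair x \<xi>)
  have "norm (exp (- \<i> * cpi * x * \<xi>)) = 1" by simp
  then show ?thesis
    using hermite_const_pos[of r]
    unfolding Pair stft_hermite[OF assms] poly_abs_def norm_mult by simp
qed

text \<open>The modulus is continuous and a nonempty open set is not null, so vanishing almost
  everywhere is vanishing everywhere; the holomorphic uniqueness argument and then the density
  argument with Gaussians take over.\<close>

lemma stft_AE_0_imp:
  assumes T: "T \<in> tempered_distributions"
    and zero: "(\<integral>\<^sup>+z. ennreal (norm (stft (hermite_fun r) T z)) \<partial>lebesgue) = 0"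
  shows "T = (\<lambda>_. 0)"
proof -
  note B = bargmann_holomorphic[OF T]
  have cont: "continuous_on UNIV (poly_abs r (bargmann T))" by (rule poly_abs_continuous[OF B])
  have meas [measurable]: "poly_abs r (bargmann T) \<in> borel_measurable borel"
    by (intro borel_measurable_continuous_onI cont)
  have "(\<integral>\<^sup>+z. ennreal (hermite_const r * poly_abs r (bargmann T) z) \<partial>lborel) = 0"
    using zero unfolding norm_stft_hermite[OF T] nn_integral_completion .
  then have "AE z in lborel. ennreal (hermite_const r * poly_abs r (bargmann T) z) = 0"
    by (subst (asm) nn_integral_0_iff_AE) (auto simp: meas)
  then have AE: "AE z in lborel. poly_abs r (bargmann T) z = 0"
    using hermite_const_pos[of r] poly_abs_nonneg
    by (auto elim!: eventually_mono simp: ennreal_eq_0_iff mult_le_0_iff intro: antisym)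
  have "poly_abs r (bargmann T) z = 0" for z
  proof (rule ccontr)
    assume nz: "poly_abs r (bargmann T) z \<noteq> 0"
    define U where "U = {z. poly_abs r (bargmann T) z \<noteq> 0}"
    have "open U"
      unfolding U_def using cont by (intro open_Collect_neq) auto
    moreover have "U \<in> null_sets lborel"
      using AE \<open>open U\<close> by (subst AE_iff_null_sets) (auto simp: U_def)
    then have "negligible U"
      unfolding negligible_iff_null_sets by (rule null_sets_completionI)
    ultimately show False
      using nz open_not_negligible[of U] unfolding U_def by blast
  qed
  then have "true_poly r (bargmann T) w = 0" for w
    using poly_abs_def[of r "bargmann T" "(Re w, - Im w)"] by simp
  then have "bargmann T w = 0" for w by (rule true_poly_eq_0_imp[OF B])
  then show ?thesis by (intro tempered_eq_0[OF T] bargmann_eq_0_imp[OF T])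
qed

lemma stft_measurable:
  assumes T: "T \<in> tempered_distributions"
  shows "stft (hermite_fun r) T \<in> borel_measurable lebesgue"
proof -
  note B = bargmann_holomorphic[OF T]
  have "stft (hermite_fun r) T = (\<lambda>z. hermite_const r * exp (- \<i> * cpi * of_real (fst z) * of_real (snd z)) *
      true_poly r (bargmann T) (Complex (fst z) (- snd z)))"
    using stft_hermite[OF T] by (auto simp: fun_eq_iff)
  also have "\<dots> \<in> borel_measurable borel"
    unfolding Complex_eq
    by (intro borel_measurable_continuous_onI continuous_intros continuous_on_compose2[OF true_poly_continuous[OF B]]) auto
  finally show ?thesis by (intro measurable_completion) simp
qed

lemma L1_norm_concentration:
  assumes T: "T \<in> tempered_distributions" and R: "R > 0" and \<Delta>: "\<Delta> \<in> sets lebesgue"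
  shows "ennreal (C_quant r R) * L1_norm (\<lambda>z. stft (hermite_fun r) T z * indicator \<Delta> z)
    \<le> A_quant r \<Delta> R * L1_norm (stft (hermite_fun r) T)"
proof -
  have meas: "poly_abs r (bargmann T) \<in> borel_measurable borel"
    by (intro borel_measurable_continuous_onI poly_abs_continuous bargmann_holomorphic T)
  then have mL [measurable]: "(\<lambda>z. ennreal (poly_abs r (bargmann T) z)) \<in> borel_measurable lebesgue"
    by (intro measurable_completion) simp
  have c: "hermite_const r \<ge> 0" using hermite_const_pos[of r] by simp
  have "L1_norm (stft (hermite_fun r) T) = (\<integral>\<^sup>+z. ennreal (hermite_const r) * ennreal (poly_abs r (bargmann T) z) \<partial>lebesgue)"
    unfolding L1_norm_def norm_stft_hermite[OF T] by (simp add: ennreal_mult c poly_abs_nonneg)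
  also have "\<dots> = ennreal (hermite_const r) * (\<integral>\<^sup>+z. ennreal (poly_abs r (bargmann T) z) \<partial>lebesgue)"
    by (rule nn_integral_cmult) measurable
  finally have e1: "L1_norm (stft (hermite_fun r) T) = \<dots>" .
  have "L1_norm (\<lambda>z. stft (hermite_fun r) T z * indicator \<Delta> z)
      = (\<integral>\<^sup>+z. ennreal (hermite_const r) * (ennreal (poly_abs r (bargmann T) z) * indicator \<Delta> z) \<partial>lebesgue)"
    unfolding L1_norm_def norm_mult norm_stft_hermite[OF T]
    by (intro nn_integral_cong) (simp add: indicator_def ennreal_mult c poly_abs_nonneg)
  also have "\<dots> = ennreal (hermite_const r) * (\<integral>\<^sup>+z\<in>\<Delta>. ennreal (poly_abs r (bargmann T) z) \<partial>lebesgue)"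
    by (intro nn_integral_cmult borel_measurable_times_ennreal borel_measurable_indicator mL \<Delta>)
  finally have e2: "L1_norm (\<lambda>z. stft (hermite_fun r) T z * indicator \<Delta> z) = \<dots>" .
  show ?thesis
    unfolding e1 e2
    using mult_left_mono[OF poly_abs_concentration[OF bargmann_holomorphic[OF T] R \<Delta>, of r], of "ennreal (hermite_const r)"]
    by (simp add: mult_ac)
qed

section \<open>Comparison of f with a competitor\<close>

lemma tempered_diff:
  assumes "f \<in> tempered_distributions" "g \<in> tempered_distributions"
  shows "(\<lambda>\<phi>. f \<phi> - g \<phi>) \<in> tempered_distributions"
proof -
  obtain C n where C: "C \<ge> 0" "\<And>\<phi> M. \<phi> \<in> schwartz \<Longrightarrow>
      (\<And>i j t. i \<le> n \<Longrightarrow> j \<le> n \<Longrightarrow> \<bar>t\<bar> ^ i * norm (nth_vderiv j \<phi> t) \<le> M) \<Longrightarrow> norm (f \<phi>) \<le> C * M"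
    using tempered_bound[OF assms(1)] by metis
  obtain C' n' where C': "C' \<ge> 0" "\<And>\<phi> M. \<phi> \<in> schwartz \<Longrightarrow>
      (\<And>i j t. i \<le> n' \<Longrightarrow> j \<le> n' \<Longrightarrow> \<bar>t\<bar> ^ i * norm (nth_vderiv j \<phi> t) \<le> M) \<Longrightarrow> norm (g \<phi>) \<le> C' * M"
    using tempered_bound[OF assms(2)] by metis
  define N where "N = max n n'"
  have "norm (f \<phi> - g \<phi>) \<le> (C + C') * (\<Sum>i\<le>N. \<Sum>j\<le>N. schwartz_seminorm i j \<phi>)" if \<phi>: "\<phi> \<in> schwartz" for \<phi>
  proof -
    define S where "S = (\<Sum>i\<le>N. \<Sum>j\<le>N. schwartz_seminorm i j \<phi>)"
    have le: "\<bar>t\<bar> ^ i * norm (nth_vderiv j \<phi> t) \<le> schwartz_seminorm i j \<phi>" for i j t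
      unfolding schwartz_seminorm_def using \<phi> by (intro cSUP_upper) (auto simp: schwartz_def)
    have ge: "schwartz_seminorm i j \<phi> \<ge> 0" for i j
      using le[of 0 i j] by (rule order_trans[rotated]) simp
    have "\<bar>t\<bar> ^ i * norm (nth_vderiv j \<phi> t) \<le> S" if "i \<le> N" "j \<le> N" for i j t
    proof -
      have "schwartz_seminorm i j \<phi> \<le> (\<Sum>j\<le>N. schwartz_seminorm i j \<phi>)"
        using that ge by (intro member_le_sum) auto
      also have "\<dots> \<le> S" unfolding S_def
        using that ge by (intro member_le_sum[of i "{..N}" "\<lambda>i. \<Sum>j\<le>N. schwartz_seminorm i j \<phi>"] sum_nonneg) auto
      finally show ?thesis using le[of t i j] by linarith
    qed
    then have "norm (f \<phi>) \<le> C * S" "norm (g \<phi>) \<le> C' * S"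
      using C(2)[OF \<phi>] C'(2)[OF \<phi>] by (auto simp: N_def)
    then show ?thesis
      unfolding S_def[symmetric] distrib_right using norm_triangle_ineq4[of "f \<phi>" "g \<phi>"] by linarith
  qed
  moreover have "f (\<lambda>t. \<phi> t + \<psi> t) - g (\<lambda>t. \<phi> t + \<psi> t) = f \<phi> - g \<phi> + (f \<psi> - g \<psi>)"
    if "\<phi> \<in> schwartz" "\<psi> \<in> schwartz" for \<phi> \<psi>
    using assms that by (auto simp: tempered_distributions_def)
  moreover have "f (\<lambda>t. c * \<phi> t) - g (\<lambda>t. c * \<phi> t) = c * (f \<phi> - g \<phi>)" if "\<phi> \<in> schwartz" for c \<phi>
    using tempered_cmult[OF assms(1) that] tempered_cmult[OF assms(2) that] by (simp add: algebra_simps)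
  moreover have "f \<phi> - g \<phi> = 0" if "\<phi> \<notin> schwartz" for \<phi>
    using assms that by (simp add: tempered_distributions_def)
  ultimately show ?thesis
    unfolding tempered_distributions_def by blast
qed

text \<open>On \<Delta> one has |V| + |N| \<le> |V + N| + 2|V|, and off \<Delta> the noise vanishes,
  so |V| + |N| = |V + N|. Hence |V + N| gains on |N| as soon as less than half of the mass of V lies
  on \<Delta>.\<close>

lemma L1_norm_perturb:
  fixes V N :: "real \<times> real \<Rightarrow> complex"
  assumes V: "V \<in> borel_measurable lebesgue" and N: "integrable lebesgue N" and \<Delta>: "\<Delta> \<in> sets lebesgue"
    and supp: "AE z in lebesgue. z \<notin> \<Delta> \<longrightarrow> N z = 0"
    and q: "q < 1 / 2" and conc: "L1_norm (\<lambda>z. V z * indicator \<Delta> z) \<le> q * L1_norm V"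
    and nz: "L1_norm V \<noteq> 0"
  shows "L1_norm N < L1_norm (\<lambda>z. V z + N z)"
proof -
  note [measurable] = V
  have N_meas [measurable]: "N \<in> borel_measurable lebesgue" using N by (rule borel_measurable_integrable)
  have N_fin: "L1_norm N < \<infinity>"
    unfolding L1_norm_def using N integrable_iff_bounded by blast
  have m [measurable]: "(\<lambda>z. ennreal (norm (V z))) \<in> borel_measurable lebesgue"
    "(\<lambda>z. ennreal (norm (N z))) \<in> borel_measurable lebesgue"
    "(\<lambda>z. ennreal (norm (V z + N z))) \<in> borel_measurable lebesgue"
    by measurable
  have [measurable]: "(\<lambda>z. V z * indicator \<Delta> z) \<in> borel_measurable lebesgue"
    using \<Delta> by measurable
  show ?thesis
  proof (cases "L1_norm V = \<infinity>")
    case True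
    have "L1_norm V \<le> (\<integral>\<^sup>+z. ennreal (norm (V z + N z)) + ennreal (norm (N z)) \<partial>lebesgue)"
      unfolding L1_norm_def
    proof (rule nn_integral_mono)
      fix z
      have "norm (V z) \<le> norm (V z + N z) + norm (N z)"
        using norm_triangle_ineq4[of "V z + N z" "N z"] by simp
      then show "ennreal (norm (V z)) \<le> ennreal (norm (V z + N z)) + ennreal (norm (N z))"
        by (simp flip: ennreal_plus)
    qed
    also have "\<dots> = L1_norm (\<lambda>z. V z + N z) + L1_norm N"
      unfolding L1_norm_def by (rule nn_integral_add[OF m(3,2)])
    finally have "L1_norm (\<lambda>z. V z + N z) = \<infinity>"
      using True N_fin by (auto simp: top_unique)
    then show ?thesis using N_fin by simp
  next
    case False
    define VD where "VD = L1_norm (\<lambda>z. V z * indicator \<Delta> z)"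
    define S where "S = L1_norm (\<lambda>z. V z + N z)"
    have le: "L1_norm V + L1_norm N \<le> L1_norm (\<lambda>z. V z + N z) + 2 * VD"
    proof -
      have "L1_norm V + L1_norm N = (\<integral>\<^sup>+z. ennreal (norm (V z)) + ennreal (norm (N z)) \<partial>lebesgue)"
        unfolding L1_norm_def by (rule nn_integral_add[symmetric, OF m(1,2)])
      also have "\<dots> \<le> (\<integral>\<^sup>+z. ennreal (norm (V z + N z)) + 2 * ennreal (norm (V z * indicator \<Delta> z)) \<partial>lebesgue)"
      proof (rule nn_integral_mono_AE, use supp in eventually_elim)
        case (elim z)
        show ?case
        proof (cases "z \<in> \<Delta>")
          case True
          have "norm (V z) + norm (N z) \<le> norm (V z + N z) + 2 * norm (V z)"
            using norm_triangle_ineq4[of "V z + N z" "V z"] by simp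
          then have "ennreal (norm (V z) + norm (N z)) \<le> ennreal (norm (V z + N z) + 2 * norm (V z))"
            by (rule ennreal_leI)
          then show ?thesis using True by (simp add: ennreal_mult)
        qed (use elim in simp)
      qed
      also have "\<dots> = L1_norm (\<lambda>z. V z + N z) + 2 * VD"
        unfolding L1_norm_def VD_def by (subst nn_integral_add) (auto simp: nn_integral_cmult)
      finally show ?thesis .
    qed
    have less: "2 * VD < L1_norm V"
    proof -
      have "2 * VD \<le> (2 * q) * L1_norm V"
        using conc by (simp add: VD_def mult.assoc mult_left_mono)
      also have "\<dots> < 1 * L1_norm V"
      proof (rule ennreal_mult_strict_right_mono)
        have "2 * q < 2 * (1 / 2)" using q by (intro ennreal_mult_strict_left_mono) auto
        also have "2 * (1 / 2) = (1 :: ennreal)" by (simp add: ennreal_times_divide)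
        finally show "2 * q < 1" .
      qed (use False nz in \<open>auto simp: zero_less_iff_neq_zero less_top\<close>)
      finally show ?thesis by simp
    qed
    \<comment> \<open>Cancellation in \<open>ennreal\<close> needs finite summands, so an infinite
      norm of V + N is treated apart; the norm of V is already finite here.\<close>
    show ?thesis
    proof (cases "S = \<infinity>")
      case True
      then show ?thesis using N_fin by (simp add: S_def)
    next
      case S: False
      have "L1_norm V + L1_norm N \<le> S + 2 * VD" using le by (simp add: S_def)
      also have "\<dots> < L1_norm V + S"
        using less S by (simp add: add.commute[of "L1_norm V"] ennreal_add_left_cancel_less)
      finally show ?thesis by (simp add: ennreal_add_left_cancel_less S_def)
    qed
  qed
qed

theorem corollary5:
  fixes r :: nat and R :: real and \<Delta> :: "(real \<times> real) set"
    and f :: "(real \<Rightarrow> complex) \<Rightarrow> complex" and G N :: "real \<times> real \<Rightarrow> complex"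
  assumes "f \<in> M1"
    and "\<Delta> \<in> sets lebesgue"
    and "integrable lebesgue N"
    and "AE z in lebesgue. z \<notin> \<Delta> \<longrightarrow> N z = 0"
    and "G = (\<lambda>z. stft (hermite_fun r) f z + N z)"
    and "R > 0"
    and "A_quant r \<Delta> R < ennreal (C_quant r R / 2)"
  shows "concentration r \<Delta> < 1 / 2 \<and>
    {g. is_arg_min (\<lambda>g. L1_norm (\<lambda>z. G z - stft (hermite_fun r) g z)) (\<lambda>g. g \<in> M1) g} = {f}"
proof -
  define C where "C = C_quant r R"
  define q where "q = A_quant r \<Delta> R / ennreal C"
  \<comment> \<open>For C \<le> 0 the right side of the strict hypothesis would be truncated to 0 by
    \<open>ennreal\<close>, and nothing lies below 0. So dividing by C is legitimate.\<close>
  have C: "C > 0" by (rule ccontr) (use assms(7) in \<open>auto simp: C_def ennreal_neg\<close>)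
  have AC: "A_quant r \<Delta> R = ennreal C * q"
    using C by (simp add: q_def ennreal_times_divide ennreal_mult_divide_eq mult.commute[of "ennreal C"])
  have q: "q < 1 / 2"
  proof -
    have "ennreal C * q < ennreal C * (1 / 2)"
      using assms(7) C unfolding AC C_def[symmetric]
      by (simp add: ennreal_times_divide divide_ennreal[symmetric])
    then show ?thesis
      using mult_left_mono[of "1 / 2" q "ennreal C"] by (meson leD leI zero_le)
  qed
  have conc: "L1_norm (\<lambda>z. stft (hermite_fun r) u z * indicator \<Delta> z) \<le> q * L1_norm (stft (hermite_fun r) u)"
    if u: "u \<in> tempered_distributions" for u
  proof -
    have "ennreal C * L1_norm (\<lambda>z. stft (hermite_fun r) u z * indicator \<Delta> z)
        \<le> ennreal C * (q * L1_norm (stft (hermite_fun r) u))"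
      using L1_norm_concentration[OF u assms(6,2), of r] unfolding AC C_def[symmetric] by (simp add: mult.assoc)
    then show ?thesis using C by (simp add: ennreal_mult_le_mult_iff)
  qed
  have nz: "L1_norm (stft (hermite_fun r) u) \<noteq> 0" if "u \<in> tempered_distributions" "u \<noteq> (\<lambda>_. 0)" for u
    using stft_AE_0_imp[of u r] that unfolding L1_norm_def by blast
  have "concentration r \<Delta> \<le> q"
    unfolding concentration_def
  proof (rule SUP_least)
    fix u assume "u \<in> M1 - {\<lambda>_. 0}"
    then have u: "u \<in> tempered_distributions" "u \<noteq> (\<lambda>_. 0)" by (auto simp: M1_def)
    show "L1_norm (\<lambda>z. stft (hermite_fun r) u z * indicator \<Delta> z) / L1_norm (stft (hermite_fun r) u) \<le> q"
    proof (rule divide_le_posI_ennreal)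
      show "0 < L1_norm (stft (hermite_fun r) u)" using nz[OF u] by (simp add: zero_less_iff_neq_zero)
      show "L1_norm (\<lambda>z. stft (hermite_fun r) u z * indicator \<Delta> z) \<le> L1_norm (stft (hermite_fun r) u) * q"
        using conc[OF u(1)] by (simp add: mult.commute)
    qed
  qed
  then have "concentration r \<Delta> < 1 / 2" using q by (rule le_less_trans)
  moreover have f: "f \<in> tempered_distributions" using assms(1) by (simp add: M1_def)
  have less: "L1_norm (\<lambda>z. G z - stft (hermite_fun r) f z) < L1_norm (\<lambda>z. G z - stft (hermite_fun r) g z)"
    if g: "g \<in> M1" "g \<noteq> f" for g
  proof -
    have g': "g \<in> tempered_distributions" using g by (simp add: M1_def)
    \<comment> \<open>By linearity the objective at g is the norm of V + N with V the transform of f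
      - g, while at f it is the norm of N.\<close>
    define u where "u = (\<lambda>\<phi>. f \<phi> - g \<phi>)"
    have u: "u \<in> tempered_distributions" unfolding u_def by (rule tempered_diff[OF f g'])
    have u0: "u \<noteq> (\<lambda>_. 0)" using g(2) by (simp add: u_def fun_eq_iff) metis
    have stft_u: "stft (hermite_fun r) u z = stft (hermite_fun r) f z - stft (hermite_fun r) g z" for z
      by (simp add: stft_def pairing_def u_def)
    have "(\<lambda>z. G z - stft (hermite_fun r) g z) = (\<lambda>z. stft (hermite_fun r) u z + N z)"
      unfolding assms(5) stft_u by (simp add: algebra_simps)
    moreover have "(\<lambda>z. G z - stft (hermite_fun r) f z) = N" by (simp add: assms(5))
    ultimately show ?thesis
      using L1_norm_perturb[OF stft_measurable[OF u] assms(3,2,4) q conc[OF u] nz[OF u u0]] by simp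
  qed
  have "{g. is_arg_min (\<lambda>g. L1_norm (\<lambda>z. G z - stft (hermite_fun r) g z)) (\<lambda>g. g \<in> M1) g} = {f}"
    using assms(1) less unfolding is_arg_min_def by (auto dest: less_asym)
  ultimately show ?thesis by blast
qed

end
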